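(* With notation as in the context, let $g_0=(x_0,t_0)\in\widetilde{\mathbb M}\setminus\{o\}$ and let $\theta_0\in\Omega_*$ be a global maximizer of $\phi(g_0;\cdot)$ on $\Omega_*$. Then $d(g_0)^2=\phi(g_0;\theta_0)$, and there exists a unique shortest geodesic joining $o$ to $g_0$, namely $\gamma(s)=(x(s),t(s))$, $0\le s\le1$, with $$x(s)=\frac{\sin(sU(\theta_0))}{\sin U(\theta_0)}e^{(s-1)\widetilde U(\theta_0)}x_0,\quad t(s)=\frac12\int_0^s\langle\mathbb Ux(r),\zeta(r)\rangle dr,\quad \zeta(s)=\frac{U(\theta_0)}{\sin U(\theta_0)}e^{(2s-1)\widetilde U(\theta_0)}x_0.$$ Moreover, if $g_0\in\widetilde{\mathbb M}_2$, this shortest geodesic is abnormal.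
   Context: Let $q,m\ge1$, $U^{(1)},\dots,U^{(m)}$ linearly independent real skew-symmetric $q\times q$ matrices; $\mathbb G=\mathbb R^q\times\mathbb R^m$ with law $(x,t)\cdot(x',t')=(x+x',t+t'+\frac12\langle\mathbb Ux,x'\rangle)$, $\langle\mathbb Ux,x'\rangle=(\langle U^{(j)}x,x'\rangle)_j$, identity $o$. Horizontal curves: absolutely continuous $(x(s),t(s))$ with $t'=\frac12\langle\mathbb Ux,x'\rangle$, length $\int_0^1|x'|$; $d(g)$ is the infimum of lengths from $o$ to $g$; a shortest geodesic from $o$ to $g$ is a horizontal curve from $o$ to $g$ of length $d(g)$. $\widetilde U(\tau)=\sum_j\tau_jU^{(j)}$, $U(\tau)=i\widetilde U(\tau)$, $\Omega_*=\{\tau:\|U(\tau)\|<\pi\}$, $\phi((x,t);\tau)=\langle U(\tau)\cot U(\tau)x,x\rangle+4t\cdot\tau$. $\widetilde{\mathbb M}=\{g:\phi(g;\cdot)$ attains its maximum in $\Omega_*\}$, $\widetilde{\mathbb M}_2=\{g:$ the set of global maximizers of $\phi(g;\cdot)$ in $\Omega_*$ has at least two points$\}$. Normal geodesics: for $(\zeta_0,\theta)\in\mathbb R^q\times\mathbb R^m$, $\gamma(\zeta_0,2\theta;s)=(x(s),t(s))$ with $\zeta(s)=e^{2s\widetilde U(\theta)}\zeta_0$, $x(s)=\int_0^s\zeta$, $t(s)=\frac12\int_0^s\langle\mathbb Ux,\zeta\rangle$; its normal extremal lift is $s\mapsto(\gamma(s),(\zeta(s)-\widetilde U(\theta)x(s),\,2\theta))$.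 A normal geodesic is abnormal if it admits two distinct normal extremal lifts (i.e. it equals $\gamma(\zeta_0,2\theta;\cdot)$ and $\gamma(\zeta_0',2\theta';\cdot)$ with distinct lifts). Conventions: $\frac{\sin(s\cdot0)}{\sin0}=s$, $\frac0{\sin0}=1$.
   Formalization: Uniqueness of the shortest geodesic is stated up to reparametrization: every shortest geodesic is γ∘h with h continuous, nondecreasing, mapping [0,1] onto itself; literal uniqueness fails, since e.g. γ(s²) is also a horizontal curve from o to g₀ of length d(g₀). *)

theory Defs
  imports "HOL-Analysis.Analysis"
begin

definition skew :: "real^'q^'q \<Rightarrow> bool" where
  "skew A \<longleftrightarrow> transpose A = - A"

fun mpow :: "real^'q^'q \<Rightarrow> nat \<Rightarrow> real^'q^'q" where
  "mpow A 0 = mat 1"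
| "mpow A (Suc k) = A ** mpow A k"

definition mexp :: "real^'q^'q \<Rightarrow> real^'q^'q" where
  "mexp A = (\<Sum>k. (1 / fact k) *\<^sub>R mpow A k)"

definition cvec :: "real^'q \<Rightarrow> complex^'q" where
  "cvec x = (\<chi> i. complex_of_real (x $ i))"

definition cinner :: "complex^'q \<Rightarrow> complex^'q \<Rightarrow> complex" where
  "cinner z w = (\<Sum>i\<in>UNIV. z $ i * cnj (w $ i))"

text \<open>Functional calculus for a diagonalizable (here: Hermitian) complex matrix:
  f(A) is the matrix acting as multiplication by f(\<lambda>) on every eigenvector
  with eigenvalue \<lambda>.\<close>
definition matfun :: "(complex \<Rightarrow> complex) \<Rightarrow> complex^'q^'q \<Rightarrow> complex^'q^'q" where
  "matfun f A = (THE B. \<forall>v c. A *v v = c *s v \<longrightarrow> B *v v = f c *s v)"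

definition zcot :: "complex \<Rightarrow> complex" where
  "zcot z = (if z = 0 then 1 else z * cos z / sin z)"

definition sinratio :: "real \<Rightarrow> complex \<Rightarrow> complex" where
  "sinratio s z = (if z = 0 then complex_of_real s else sin (complex_of_real s * z) / sin z)"

definition zsin :: "complex \<Rightarrow> complex" where
  "zsin z = (if z = 0 then 1 else z / sin z)"

definition Ut :: "('m \<Rightarrow> real^'q^'q) \<Rightarrow> real^'m \<Rightarrow> real^'q^'q" where
  "Ut U \<tau> = (\<Sum>j\<in>UNIV. (\<tau> $ j) *\<^sub>R U j)"

definition Uc :: "('m \<Rightarrow> real^'q^'q) \<Rightarrow> real^'m \<Rightarrow> complex^'q^'q" where
  "Uc U \<tau> = (\<chi> i j. \<i> * complex_of_real (Ut U \<tau> $ i $ j))"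

definition bracket :: "('m \<Rightarrow> real^'q^'q) \<Rightarrow> real^'q \<Rightarrow> real^'q \<Rightarrow> real^'m" where
  "bracket U x y = (\<chi> j. (U j *v x) \<bullet> y)"

text \<open>\<open>\<Omega>_* = {\<tau>. \<parallel>U(\<tau>)\<parallel> < \<pi>}\<close>, operator norm (\<open>\<parallel>i A\<parallel> = \<parallel>A\<parallel>\<close> for a real matrix A).\<close>
definition Omega :: "('m \<Rightarrow> real^'q^'q) \<Rightarrow> (real^'m) set" where
  "Omega U = {\<tau>. onorm (\<lambda>x. Ut U \<tau> *v x) < pi}"

definition phi :: "('m \<Rightarrow> real^'q^'q) \<Rightarrow> (real^'q) \<times> (real^'m) \<Rightarrow> real^'m \<Rightarrow> real" where
  "phi U g \<tau> = Re (cinner (matfun zcot (Uc U \<tau>) *v cvec (fst g)) (cvec (fst g)))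
                 + 4 * (snd g \<bullet> \<tau>)"

definition Mt :: "('m \<Rightarrow> real^'q^'q) \<Rightarrow> ((real^'q) \<times> (real^'m)) set" where
  "Mt U = {g. \<exists>\<theta>\<in>Omega U. \<forall>\<tau>\<in>Omega U. phi U g \<tau> \<le> phi U g \<theta>}"

definition maximizers :: "('m \<Rightarrow> real^'q^'q) \<Rightarrow> (real^'q) \<times> (real^'m) \<Rightarrow> (real^'m) set" where
  "maximizers U g = {\<theta>\<in>Omega U. \<forall>\<tau>\<in>Omega U. phi U g \<tau> \<le> phi U g \<theta>}"

definition Mt2 :: "('m \<Rightarrow> real^'q^'q) \<Rightarrow> ((real^'q) \<times> (real^'m)) set" where
  "Mt2 U = {g. \<exists>\<theta>1 \<theta>2. \<theta>1 \<in> maximizers U g \<and> \<theta>2 \<in> maximizers U g \<and> \<theta>1 \<noteq> \<theta>2}"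

definition abs_cont_on :: "real \<Rightarrow> real \<Rightarrow> (real \<Rightarrow> 'a::real_normed_vector) \<Rightarrow> bool" where
  "abs_cont_on a b f \<longleftrightarrow>
     (\<forall>\<epsilon>>0. \<exists>\<delta>>0. \<forall>(n::nat) (l::nat \<Rightarrow> real) (r::nat \<Rightarrow> real).
        (\<forall>i<n. a \<le> l i \<and> l i \<le> r i \<and> r i \<le> b) \<and>
        (\<forall>i<n. \<forall>j<n. i \<noteq> j \<longrightarrow> r i \<le> l j \<or> r j \<le> l i) \<and>
        (\<Sum>i<n. r i - l i) < \<delta>
        \<longrightarrow> (\<Sum>i<n. norm (f (r i) - f (l i))) < \<epsilon>)"

definition horizontal :: "('m \<Rightarrow> real^'q^'q) \<Rightarrow> (real \<Rightarrow> (real^'q) \<times> (real^'m)) \<Rightarrow> (real \<Rightarrow> real^'q) \<Rightarrow> bool" where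
  "horizontal U \<gamma> v \<longleftrightarrow>
     abs_cont_on 0 1 (\<lambda>s. fst (\<gamma> s)) \<and> abs_cont_on 0 1 (\<lambda>s. snd (\<gamma> s)) \<and>
     (\<exists>N. negligible N \<and> (\<forall>s\<in>{0..1} - N.
        ((\<lambda>s. fst (\<gamma> s)) has_vector_derivative v s) (at s within {0..1}) \<and>
        ((\<lambda>s. snd (\<gamma> s)) has_vector_derivative (1/2) *\<^sub>R bracket U (fst (\<gamma> s)) (v s)) (at s within {0..1})))"

definition curve_length :: "(real \<Rightarrow> real^'q) \<Rightarrow> real" where
  "curve_length v = integral {0..1} (\<lambda>s. norm (v s))"

definition origin :: "(real^'q) \<times> (real^'m)" where
  "origin = (0, 0)"

definition dist_cc :: "('m \<Rightarrow> real^'q^'q) \<Rightarrow> (real^'q) \<times> (real^'m) \<Rightarrow> real" where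
  "dist_cc U g = Inf {L. \<exists>\<gamma> v. horizontal U \<gamma> v \<and> \<gamma> 0 = origin \<and> \<gamma> 1 = g \<and> L = curve_length v}"

definition shortest_geodesic :: "('m \<Rightarrow> real^'q^'q) \<Rightarrow> (real^'q) \<times> (real^'m) \<Rightarrow> (real \<Rightarrow> (real^'q) \<times> (real^'m)) \<Rightarrow> bool" where
  "shortest_geodesic U g \<gamma> \<longleftrightarrow>
     (\<exists>v. horizontal U \<gamma> v \<and> \<gamma> 0 = origin \<and> \<gamma> 1 = g \<and> curve_length v = dist_cc U g)"

definition ngz :: "('m \<Rightarrow> real^'q^'q) \<Rightarrow> real^'q \<Rightarrow> real^'m \<Rightarrow> real \<Rightarrow> real^'q" where
  "ngz U \<zeta>0 \<theta> s = mexp ((2 * s) *\<^sub>R Ut U \<theta>) *v \<zeta>0"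

definition ngx :: "('m \<Rightarrow> real^'q^'q) \<Rightarrow> real^'q \<Rightarrow> real^'m \<Rightarrow> real \<Rightarrow> real^'q" where
  "ngx U \<zeta>0 \<theta> s = integral {0..s} (ngz U \<zeta>0 \<theta>)"

definition normal_geodesic :: "('m \<Rightarrow> real^'q^'q) \<Rightarrow> real^'q \<Rightarrow> real^'m \<Rightarrow> real \<Rightarrow> (real^'q) \<times> (real^'m)" where
  "normal_geodesic U \<zeta>0 \<theta> s =
     (ngx U \<zeta>0 \<theta> s,
      (1/2) *\<^sub>R integral {0..s} (\<lambda>r. bracket U (ngx U \<zeta>0 \<theta> r) (ngz U \<zeta>0 \<theta> r)))"

definition normal_lift :: "('m \<Rightarrow> real^'q^'q) \<Rightarrow> real^'q \<Rightarrow> real^'m \<Rightarrow> real \<Rightarrow> ((real^'q) \<times> (real^'m)) \<times> ((real^'q) \<times> (real^'m))" where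
  "normal_lift U \<zeta>0 \<theta> s =
     (normal_geodesic U \<zeta>0 \<theta> s, (ngz U \<zeta>0 \<theta> s - Ut U \<theta> *v ngx U \<zeta>0 \<theta> s, 2 *\<^sub>R \<theta>))"

definition abnormal :: "('m \<Rightarrow> real^'q^'q) \<Rightarrow> (real \<Rightarrow> (real^'q) \<times> (real^'m)) \<Rightarrow> bool" where
  "abnormal U \<gamma> \<longleftrightarrow>
     (\<exists>\<zeta>0 \<theta> \<zeta>0' \<theta>'.
        (\<forall>s\<in>{0..1}. \<gamma> s = normal_geodesic U \<zeta>0 \<theta> s \<and> \<gamma> s = normal_geodesic U \<zeta>0' \<theta>' s) \<and>
        (\<exists>s\<in>{0..1}. normal_lift U \<zeta>0 \<theta> s \<noteq> normal_lift U \<zeta>0' \<theta>' s))"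

end

theory Submission
  imports Defs
begin

text \<open>For \<open>\<theta> \<in> Omega U\<close> put \<open>A = Ut U \<theta>\<close> and let \<open>N s\<close> be the inverse of \<open>\<integral>\<^sub>0\<^sup>s exp (2rA) dr\<close>.
  The function \<open>S s (x, t) = \<langle>N s x, x\<rangle> + 4 \<langle>t, \<theta>\<rangle>\<close> solves the Hamilton-Jacobi equation of the
  energy for \<open>0 < s \<le> 1\<close> and equals \<open>phi U (x, t) \<theta>\<close> at \<open>s = 1\<close>. Following \<open>S\<close> along a horizontal
  curve from the origin, with the time \<open>s\<close> proportional to arc length, bounds \<open>phi U g \<theta>\<close> by the
  squared length of every curve to \<open>g\<close>, with equality only for the normal geodesic with parameter
  \<open>\<theta>\<close>. So these geodesics are the unique shortest curves to their end points.

  It remains to see that a maximizer \<open>\<theta>\<close> of \<open>phi U (x, t)\<close> yields a geodesic ending at \<open>(x, t)\<close>.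
  Let \<open>p \<tau>\<close> be the vertical end point of the geodesic with parameter \<open>\<tau>\<close> and horizontal end point
  \<open>x\<close>. By the bound, \<open>\<tau>\<close> maximizes \<open>phi U (x, p \<tau>)\<close>; comparing with the maximality of \<open>\<theta>\<close> gives
  \<open>\<langle>t - p \<tau>, \<tau> - \<theta>\<rangle> \<le> 0\<close>, and \<open>\<tau> \<longlongrightarrow> \<theta>\<close> along \<open>t - p \<theta>\<close> gives \<open>t = p \<theta>\<close>. Two distinct
  maximizers thus yield the same curve with different covectors.\<close>

subsection \<open>Matrix calculus\<close>

lemma bounded_bilinear_matrix_vector_mult:
  "bounded_bilinear ((*v) :: real^'n^'m \<Rightarrow> real^'n \<Rightarrow> real^'m)"
  unfolding bilinear_conv_bounded_bilinear[symmetric] bilinear_def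
  by (auto intro!: linearI simp: matrix_vector_mult_add_rdistrib matrix_vector_right_distrib
      scaleR_matrix_vector_assoc matrix_vector_mult_scaleR)

lemma bounded_bilinear_matrix_matrix_mult:
  "bounded_bilinear ((**) :: real^'n^'m \<Rightarrow> real^'p^'n \<Rightarrow> real^'p^'m)"
  unfolding bilinear_conv_bounded_bilinear[symmetric] bilinear_def
  by (auto intro!: linearI simp: matrix_matrix_mult_def vec_eq_iff sum.distrib algebra_simps
      sum_distrib_left)

lemmas continuous_on_matrix_vector_mult [continuous_intros] =
  bounded_bilinear.continuous_on[OF bounded_bilinear_matrix_vector_mult]

lemmas continuous_on_matrix_matrix_mult [continuous_intros] =
  bounded_bilinear.continuous_on[OF bounded_bilinear_matrix_matrix_mult]

lemma bounded_linear_transpose: "bounded_linear (transpose :: real^'n^'m \<Rightarrow> real^'m^'n)"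
  unfolding linear_conv_bounded_linear[symmetric]
  by (rule linearI) (simp_all add: transpose_def vec_eq_iff)

lemma inner_transpose_left: "(transpose A *v x) \<bullet> y = x \<bullet> (A *v (y :: real^'n))"
  by (simp add: dot_lmul_matrix)

lemma
  assumes "invertible A"
  shows matrix_inv_right: "A ** matrix_inv A = mat 1"
    and matrix_inv_left: "matrix_inv A ** A = mat 1"
proof -
  have "A ** matrix_inv A = mat 1 \<and> matrix_inv A ** A = mat 1"
    using assms unfolding invertible_def matrix_inv_def by (rule someI_ex)
  then show "A ** matrix_inv A = mat 1" "matrix_inv A ** A = mat 1" by simp_all
qed

lemma matrix_inv_entry:
  fixes A :: "real^'n^'n"
  assumes "det A \<noteq> 0"
  shows "matrix_inv A $ k $ l = det (\<chi> i j. if j = k then axis l 1 $ i else A $ i $ j) / det A"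
proof -
  have "A *v (matrix_inv A *v axis l 1) = axis l 1"
    using assms by (simp add: matrix_vector_mul_assoc matrix_inv_right invertible_det_nz)
  then have "matrix_inv A *v axis l 1
      = (\<chi> k. det (\<chi> i j. if j = k then axis l 1 $ i else A $ i $ j) / det A)"
    using cramer[OF assms] by blast
  then show ?thesis by (simp add: matrix_vector_mult_basis column_def vec_eq_iff)
qed

lemma tendsto_det:
  fixes f :: "'a \<Rightarrow> real^'n^'n"
  assumes "(f \<longlongrightarrow> A) F"
  shows "((\<lambda>x. det (f x)) \<longlongrightarrow> det A) F"
  unfolding det_def by (intro tendsto_intros assms)

lemma tendsto_matrix_inv:
  fixes f :: "'a \<Rightarrow> real^'n^'n"
  assumes f: "(f \<longlongrightarrow> A) F" and A: "invertible A"
  shows "((\<lambda>x. matrix_inv (f x)) \<longlongrightarrow> matrix_inv A) F"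
proof (intro vec_tendstoI)
  fix k l
  have A: "det A \<noteq> 0" using A by (simp add: invertible_det_nz)
  have "((\<lambda>x. det (\<chi> i j. if j = k then axis l 1 $ i else f x $ i $ j) / det (f x))
      \<longlongrightarrow> det (\<chi> i j. if j = k then axis l 1 $ i else A $ i $ j) / det A) F"
  proof (intro tendsto_divide tendsto_det tendsto_vec_lambda f A)
    show "((\<lambda>x. if j = k then axis l 1 $ i else f x $ i $ j)
        \<longlongrightarrow> (if j = k then axis l 1 $ i else A $ i $ j)) F" for i j
      by (cases "j = k") (auto intro!: tendsto_intros f)
  qed
  moreover have "\<forall>\<^sub>F x in F. det (f x) \<noteq> 0"
    using tendsto_imp_eventually_ne[OF tendsto_det[OF f] A] .
  then have "\<forall>\<^sub>F x in F. det (\<chi> i j. if j = k then axis l 1 $ i else f x $ i $ j) / det (f x)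
      = matrix_inv (f x) $ k $ l"
    by eventually_elim (simp add: matrix_inv_entry)
  ultimately show "((\<lambda>x. matrix_inv (f x) $ k $ l) \<longlongrightarrow> matrix_inv A $ k $ l) F"
    unfolding matrix_inv_entry[OF A] by (rule Lim_transform_eventually)
qed

lemma has_vector_derivative_iff_quotient:
  "(f has_vector_derivative f') (at x within S) \<longleftrightarrow>
    ((\<lambda>y. (f y - f x) /\<^sub>R (y - x)) \<longlongrightarrow> f') (at x within S)"
proof -
  have "norm (f y - f x - (y - x) *\<^sub>R f') / \<bar>y - x\<bar> = norm ((f y - f x) /\<^sub>R (y - x) - f')" if "y \<noteq> x"
    for y
  proof -
    have "(f y - f x) /\<^sub>R (y - x) - f' = (f y - f x - (y - x) *\<^sub>R f') /\<^sub>R (y - x)"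
      using that by (simp add: scaleR_diff_right)
    then show ?thesis by (simp add: divide_inverse_commute)
  qed
  then have "\<forall>\<^sub>F y in at x within S. norm (f y - f x - (y - x) *\<^sub>R f') / \<bar>y - x\<bar>
      = norm ((f y - f x) /\<^sub>R (y - x) - f')"
    by (simp add: eventually_at_filter)
  from tendsto_cong[OF this, of 0] show ?thesis
    unfolding has_vector_derivative_def has_derivative_iff_norm
    by (simp add: bounded_linear_scaleR_left tendsto_norm_zero_iff LIM_zero_iff diff_diff_eq)
qed

lemma has_vector_derivative_matrix_inv:
  fixes M :: "real \<Rightarrow> real^'n^'n"
  assumes M: "(M has_vector_derivative M') (at s within S)" and inv: "invertible (M s)"
  shows "((\<lambda>s. matrix_inv (M s)) has_vector_derivative - (matrix_inv (M s) ** M' ** matrix_inv (M s)))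
    (at s within S)"
proof -
  interpret mult: bounded_bilinear "(**) :: real^'n^'n \<Rightarrow> real^'n^'n \<Rightarrow> real^'n^'n"
    by (rule bounded_bilinear_matrix_matrix_mult)
  let ?N = "\<lambda>s. matrix_inv (M s)"
  have M_lim: "(M \<longlongrightarrow> M s) (at s within S)"
    using has_vector_derivative_continuous[OF M] by (simp add: continuous_within)
  have quotient: "((\<lambda>y. (M y - M s) /\<^sub>R (y - s)) \<longlongrightarrow> M') (at s within S)"
    using M by (simp add: has_vector_derivative_iff_quotient)
  have "((\<lambda>y. - (?N y ** ((M y - M s) /\<^sub>R (y - s)) ** ?N s)) \<longlongrightarrow> - (?N s ** M' ** ?N s))
      (at s within S)"
    by (intro tendsto_minus mult.tendsto tendsto_const tendsto_matrix_inv M_lim inv quotient)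
  moreover have "\<forall>\<^sub>F y in at s within S. det (M y) \<noteq> 0"
    using tendsto_imp_eventually_ne[OF tendsto_det[OF M_lim]] inv by (simp add: invertible_det_nz)
  then have "\<forall>\<^sub>F y in at s within S. - (?N y ** ((M y - M s) /\<^sub>R (y - s)) ** ?N s)
      = (?N y - ?N s) /\<^sub>R (y - s)"
  proof eventually_elim
    case (elim y)
    then have "?N y ** M y = mat 1" "M s ** ?N s = mat 1"
      using inv by (simp_all add: matrix_inv_left matrix_inv_right invertible_det_nz)
    then have "- (?N y ** (M y - M s) ** ?N s) = ?N y - ?N s"
      by (simp add: mult.diff_left mult.diff_right) (simp add: matrix_mul_assoc[symmetric])
    then show ?case by (simp add: mult.scaleR_left mult.scaleR_right scaleR_minus_right[symmetric])
  qed
  ultimately show ?thesis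
    unfolding has_vector_derivative_iff_quotient by (rule Lim_transform_eventually)
qed

subsection \<open>The matrix exponential and its integral\<close>

lemma mpow_scaleR: "mpow (s *\<^sub>R A) k = s ^ k *\<^sub>R mpow A k"
proof (induction k)
  case (Suc k)
  then show ?case
    by (simp add: bounded_bilinear.scaleR_left[OF bounded_bilinear_matrix_matrix_mult]
        bounded_bilinear.scaleR_right[OF bounded_bilinear_matrix_matrix_mult])
qed simp

lemma mpow_commute: "mpow A k ** A = A ** mpow A k"
  by (induction k) (simp_all add: matrix_mul_assoc[symmetric])

lemma transpose_mpow: "transpose (mpow A k) = mpow (transpose A) k"
  by (induction k) (simp_all add: matrix_transpose_mul mpow_commute)

lemma continuous_on_mpow: "continuous_on S (\<lambda>A. mpow A k)"
  by (induction k) (auto intro!: continuous_intros)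

lemma norm_mpow_le:
  obtains K :: real where "K \<ge> 0"
    "\<And>(A :: real^'q^'q) k. norm (mpow A k) \<le> norm (mat 1 :: real^'q^'q) * (norm A * K) ^ k"
proof -
  obtain K where K: "K \<ge> 0"
    "\<And>(A :: real^'q^'q) (B :: real^'q^'q). norm (A ** B) \<le> norm A * norm B * K"
    using bounded_bilinear.nonneg_bounded[OF bounded_bilinear_matrix_matrix_mult] by blast
  have "norm (mpow A k) \<le> norm (mat 1 :: real^'q^'q) * (norm A * K) ^ k" for A :: "real^'q^'q" and k
  proof (induction k)
    case (Suc k)
    have "norm (mpow A (Suc k)) \<le> norm (mpow A k) * (norm A * K)"
      using K(2)[of A "mpow A k"] by (simp add: mult_ac)
    also have "\<dots> \<le> norm (mat 1 :: real^'q^'q) * (norm A * K) ^ k * (norm A * K)"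
      using Suc K(1) by (intro mult_right_mono) auto
    finally show ?case by (simp add: mult_ac)
  qed simp
  with K(1) show thesis by (rule that)
qed

lemma uniform_limit_mexp:
  "uniform_limit (cball (0 :: real^'q^'q) R) (\<lambda>n A. \<Sum>k<n. (1 / fact k) *\<^sub>R mpow A k) mexp sequentially"
proof -
  let ?c = "norm (mat 1 :: real^'q^'q)"
  obtain K where K: "K \<ge> 0" "\<And>(A :: real^'q^'q) k. norm (mpow A k) \<le> ?c * (norm A * K) ^ k"
    using norm_mpow_le by blast
  have "norm ((1 / fact k) *\<^sub>R mpow A k) \<le> ?c * ((R * K) ^ k /\<^sub>R fact k)"
    if "A \<in> cball 0 R" for A :: "real^'q^'q" and k
  proof -
    have "(norm A * K) ^ k \<le> (R * K) ^ k"
      using that K(1) by (intro power_mono mult_right_mono) auto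
    then have "norm (mpow A k) \<le> ?c * (R * K) ^ k"
      using K(2)[of A k] mult_left_mono[of "(norm A * K) ^ k" "(R * K) ^ k" ?c] by simp
    then show ?thesis by (simp add: field_simps)
  qed
  moreover have "summable (\<lambda>k. ?c * ((R * K) ^ k /\<^sub>R fact k))"
    by (intro summable_mult summable_exp_generic)
  ultimately show ?thesis
    unfolding mexp_def[abs_def] by (rule Weierstrass_m_test)
qed

lemma mexp_sums: "(\<lambda>k. (1 / fact k) *\<^sub>R mpow A k) sums mexp A"
  using tendsto_uniform_limitI[OF uniform_limit_mexp[of "norm A"], of A] by (simp add: sums_def)

lemma continuous_on_mexp [continuous_intros]:
  fixes f :: "'a::topological_space \<Rightarrow> real^'q^'q"
  assumes "continuous_on S f"
  shows "continuous_on S (\<lambda>s. mexp (f s))"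
proof -
  have "continuous_on (cball 0 R) (mexp :: real^'q^'q \<Rightarrow> real^'q^'q)" for R
    by (rule uniform_limit_theorem[OF _ uniform_limit_mexp])
      (auto intro!: always_eventually continuous_intros continuous_on_mpow)
  then have "isCont (mexp :: real^'q^'q \<Rightarrow> real^'q^'q) A" for A
    by (rule continuous_on_interior[of "cball 0 (norm A + 1)"]) (simp add: interior_cball)
  then show ?thesis
    using continuous_on_compose2[of UNIV mexp S f] assms
    by (simp add: continuous_at_imp_continuous_on)
qed

lemma mexp_0 [simp]: "mexp 0 = mat 1"
proof -
  have "(1 / fact k) *\<^sub>R mpow (0 :: real^'a^'a) k = (if k = 0 then mat 1 else 0)" for k
    by (cases k) (simp_all add: matrix_matrix_mult_def vec_eq_iff)
  then have "(\<lambda>k. if k = 0 then mat 1 else 0) sums mexp (0 :: real^'a^'a)"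
    using mexp_sums[of "0 :: real^'a^'a"] by simp
  from sums_unique2[OF this sums_single[of 0 "\<lambda>_. mat 1"]] show ?thesis .
qed

lemma transpose_mexp: "transpose (mexp A) = mexp (transpose A)"
proof -
  have "(\<lambda>k. (1 / fact k) *\<^sub>R mpow (transpose A) k) sums transpose (mexp A)"
    using bounded_linear.sums[OF bounded_linear_transpose mexp_sums[of A]]
    by (simp add: transpose_scalar transpose_mpow)
  then show ?thesis using mexp_sums sums_unique2 by blast
qed

lemma mexp_scaleR_entry_sums:
  "(\<lambda>k. (mpow A k $ i $ j / fact k) * s ^ k) sums (mexp (s *\<^sub>R A) $ i $ j)"
  using bounded_linear.sums[OF
      bounded_linear_compose[OF bounded_linear_vec_nth bounded_linear_vec_nth]
      mexp_sums[of "s *\<^sub>R A"], of i j]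
  by (simp add: mpow_scaleR mult.commute)

lemma has_vector_derivative_vecI:
  assumes "\<And>i. ((\<lambda>s. f s $ i) has_vector_derivative (f' $ i)) (at x within S)"
  shows "((f :: real \<Rightarrow> 'a::real_normed_vector^'n) has_vector_derivative f') (at x within S)"
  using assms unfolding has_vector_derivative_def has_derivative_within
  by (auto intro!: vec_tendstoI bounded_linear_scaleR_left)

lemma mexp_has_vector_derivative:
  "((\<lambda>s. mexp (s *\<^sub>R A)) has_vector_derivative (A ** mexp (s *\<^sub>R A))) (at s within S)"
proof (intro has_vector_derivative_vecI)
  fix i j
  let ?c = "\<lambda>k. mpow A k $ i $ j / fact k"
  have entry: "(\<lambda>s. \<Sum>n. ?c n * s ^ n) = (\<lambda>s. mexp (s *\<^sub>R A) $ i $ j)"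
    using mexp_scaleR_entry_sums[of A i j] by (auto simp: sums_iff)
  have "diffs ?c n * s ^ n = (\<Sum>l\<in>UNIV. A $ i $ l * ((mpow A n $ l $ j / fact n) * s ^ n))" for n
  proof -
    have "diffs ?c n = mpow A (Suc n) $ i $ j / fact n"
      by (simp add: diffs_def del: mpow.simps)
    then show ?thesis
      by (simp add: matrix_matrix_mult_def sum_distrib_right sum_divide_distrib mult.assoc)
  qed
  then have "(\<lambda>n. diffs ?c n * s ^ n) sums (\<Sum>l\<in>UNIV. A $ i $ l * mexp (s *\<^sub>R A) $ l $ j)"
    using sums_sum[OF sums_mult[OF mexp_scaleR_entry_sums]] by (simp only:)
  then have diffs: "(\<Sum>n. diffs ?c n * s ^ n) = (A ** mexp (s *\<^sub>R A)) $ i $ j"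
    by (simp add: sums_iff matrix_matrix_mult_def)
  have "((\<lambda>x. \<Sum>n. ?c n * x ^ n) has_field_derivative (\<Sum>n. diffs ?c n * s ^ n)) (at s)"
    by (rule termdiffs_strong_converges_everywhere) (rule sums_summable[OF mexp_scaleR_entry_sums])
  then show "((\<lambda>s. mexp (s *\<^sub>R A) $ i $ j) has_vector_derivative
      (A ** mexp (s *\<^sub>R A)) $ i $ j) (at s within S)"
    unfolding entry diffs
    by (simp add: has_real_derivative_iff_has_vector_derivative[symmetric]
        has_field_derivative_at_within)
qed

lemma mexp_double_has_vector_derivative:
  "((\<lambda>s. mexp ((2 * s) *\<^sub>R A)) has_vector_derivative 2 *\<^sub>R (A ** mexp ((2 * s) *\<^sub>R A))) (at s within S)"
  using mexp_has_vector_derivative[of "2 *\<^sub>R A" s S]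
  by (simp add: mult.commute bounded_bilinear.scaleR_left[OF bounded_bilinear_matrix_matrix_mult])

definition mexp_int :: "real^'q^'q \<Rightarrow> real \<Rightarrow> real^'q^'q" where
  "mexp_int A s = integral {0..s} (\<lambda>r. mexp ((2 * r) *\<^sub>R A))"

lemma mexp_int_has_integral:
  "((\<lambda>r. mexp ((2 * r) *\<^sub>R A)) has_integral mexp_int A s) {0..s}"
  unfolding mexp_int_def
  by (intro integrable_integral integrable_continuous_interval continuous_intros)

lemma mexp_int_has_vector_derivative:
  assumes "s \<in> {0..T}"
  shows "(mexp_int A has_vector_derivative mexp ((2 * s) *\<^sub>R A)) (at s within {0..T})"
  unfolding mexp_int_def[abs_def]
  by (intro integral_has_vector_derivative continuous_intros assms)

lemma mexp_eq_mexp_int: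
  assumes "s \<ge> 0"
  shows "mexp ((2 * s) *\<^sub>R A) = mat 1 + 2 *\<^sub>R (A ** mexp_int A s)"
proof -
  have "((\<lambda>r. 2 *\<^sub>R (A ** mexp ((2 * r) *\<^sub>R A))) has_integral
      mexp ((2 * s) *\<^sub>R A) - mexp ((2 * 0) *\<^sub>R A)) {0..s}"
    by (rule fundamental_theorem_of_calculus[OF assms mexp_double_has_vector_derivative])
  moreover have "((\<lambda>r. A ** mexp ((2 * r) *\<^sub>R A)) has_integral A ** mexp_int A s) {0..s}"
    using has_integral_linear[OF mexp_int_has_integral
        bounded_bilinear.bounded_linear_right[OF bounded_bilinear_matrix_matrix_mult, of A], of A s]
    by (simp add: o_def)
  ultimately have "mexp ((2 * s) *\<^sub>R A) - mexp ((2 * 0) *\<^sub>R A) = 2 *\<^sub>R (A ** mexp_int A s)"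
    by (rule has_integral_unique[OF _ has_integral_cmul])
  then show ?thesis by (simp add: algebra_simps)
qed

lemma transpose_mexp_int: "transpose (mexp_int A s) = mexp_int (transpose A) s"
  using has_integral_linear[OF mexp_int_has_integral bounded_linear_transpose, of A s]
  by (simp add: o_def transpose_mexp transpose_scalar mexp_int_def[of "transpose A"]
      integral_unique)

lemma mexp_int_scaleR:
  assumes "r \<ge> 0"
  shows "mexp_int A r = r *\<^sub>R mexp_int (r *\<^sub>R A) 1"
proof (cases "r = 0")
  case False
  then have "((\<lambda>s. mexp ((2 * s) *\<^sub>R (r *\<^sub>R A))) has_integral (1 / r) *\<^sub>R mexp_int A r) {0..1}"
    using has_integral_stretch_real[OF mexp_int_has_integral, of r A r] assms by (simp add: mult_ac)
  then show ?thesis using False by (simp add: mexp_int_def[of "r *\<^sub>R A"] integral_unique)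
qed (simp add: mexp_int_def)

lemma continuous_on_mexp_int [continuous_intros]:
  assumes "continuous_on S f" "continuous_on S s" "\<And>x. x \<in> S \<Longrightarrow> s x \<ge> 0"
  shows "continuous_on S (\<lambda>x. mexp_int (f x) (s x))"
proof -
  have "continuous_on (S \<times> cbox 0 1) (\<lambda>p. mexp ((2 * snd p) *\<^sub>R (s (fst p) *\<^sub>R f (fst p))))"
    by (intro continuous_intros continuous_on_compose2[OF assms(1)]
        continuous_on_compose2[OF assms(2)]) auto
  then have "continuous_on S (\<lambda>x. integral (cbox 0 1) (\<lambda>r. mexp ((2 * r) *\<^sub>R (s x *\<^sub>R f x))))"
    by (intro integral_continuous_on_param) (simp add: case_prod_unfold)
  then have "continuous_on S (\<lambda>x. s x *\<^sub>R mexp_int (s x *\<^sub>R f x) 1)"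
    using assms(2) by (intro continuous_intros) (auto simp: mexp_int_def)
  then show ?thesis
    by (rule continuous_on_cong[THEN iffD1, rotated 2])
      (simp_all add: mexp_int_scaleR[OF assms(3), symmetric])
qed

subsection \<open>Spectral theory of skew-symmetric matrices\<close>

lemma rayleigh_quotient_attains_max:
  fixes f :: "'a::euclidean_space \<Rightarrow> 'a"
  assumes lin: "linear f" and S: "subspace S" "S \<noteq> {0}"
  obtains v where "v \<in> S" "norm v = 1" "\<And>x. x \<in> S \<Longrightarrow> f x \<bullet> x \<le> (f v \<bullet> v) * (x \<bullet> x)"
proof -
  let ?K = "sphere 0 1 \<inter> S"
  have unit: "x /\<^sub>R norm x \<in> ?K" if "x \<in> S" "x \<noteq> 0" for x
    using that S(1) by (simp add: subspace_scale)
  obtain a where "a \<in> S" "a \<noteq> 0" using S subspace_0 by blast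
  then have "?K \<noteq> {}" using unit by blast
  moreover have "compact ?K" by (simp add: compact_Int_closed closed_subspace S(1))
  moreover have "continuous_on ?K (\<lambda>x. f x \<bullet> x)"
    by (intro continuous_intros linear_continuous_on)
      (simp add: lin linear_conv_bounded_linear[symmetric])
  ultimately obtain v where v: "v \<in> ?K" and max: "\<And>y. y \<in> ?K \<Longrightarrow> f y \<bullet> y \<le> f v \<bullet> v"
    using continuous_attains_sup[of ?K "\<lambda>x. f x \<bullet> x"] by blast
  have "f x \<bullet> x \<le> (f v \<bullet> v) * (x \<bullet> x)" if "x \<in> S" for x
  proof (cases "x = 0")
    case False
    have "f (x /\<^sub>R norm x) \<bullet> (x /\<^sub>R norm x) = (f x \<bullet> x) / (x \<bullet> x)"
      by (simp add: linear_scale[OF lin] divide_inverse dot_square_norm power2_eq_square mult_ac)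
    then have "(f x \<bullet> x) / (x \<bullet> x) \<le> f v \<bullet> v" using max[OF unit[OF that False]] by simp
    then show ?thesis using False by (simp add: pos_divide_le_eq)
  qed (simp add: linear_0[OF lin])
  with v show thesis by (intro that) auto
qed

lemma selfadjoint_has_eigenvector:
  fixes f :: "'a::euclidean_space \<Rightarrow> 'a"
  assumes lin: "linear f" and selfadjoint: "\<And>x y. f x \<bullet> y = x \<bullet> f y"
    and S: "subspace S" "S \<noteq> {0}" and invariant: "\<And>x. x \<in> S \<Longrightarrow> f x \<in> S"
  obtains v r where "v \<in> S" "v \<noteq> 0" "f v = r *\<^sub>R v"
proof -
  obtain v where v: "v \<in> S" "norm v = 1" and max: "\<And>x. x \<in> S \<Longrightarrow> f x \<bullet> x \<le> (f v \<bullet> v) * (x \<bullet> x)"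
    using rayleigh_quotient_attains_max[OF lin S] by blast
  define r where "r = f v \<bullet> v"
  define Q where "Q x = r * (x \<bullet> x) - f x \<bullet> x" for x
  \<comment> \<open>\<open>Q\<close> is minimal at \<open>v\<close>, and its derivative in the direction of the residual \<open>w\<close> is \<open>2 * (w \<bullet> w)\<close>.\<close>
  define w where "w = r *\<^sub>R v - f v"
  have expand: "Q (v + e *\<^sub>R w) = 2 * e * (w \<bullet> w) + e\<^sup>2 * Q w" for e
  proof -
    have "f v = r *\<^sub>R v - w" by (simp add: w_def)
    then have "f v \<bullet> w = r * (v \<bullet> w) - w \<bullet> w" by (simp only: inner_diff_left inner_scaleR_left)
    moreover have "v \<bullet> v = 1" "f v \<bullet> v = r" "w \<bullet> v = v \<bullet> w"
      using v by (simp_all add: dot_square_norm r_def inner_commute)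
    moreover note products = calculation
    ultimately have "f w \<bullet> v = r * (v \<bullet> w) - w \<bullet> w"
      using selfadjoint[of w v] by (simp add: inner_commute)
    then show ?thesis
      by (simp add: Q_def linear_add[OF lin] linear_scale[OF lin] inner_add_left inner_add_right
          products)
        (simp add: power2_eq_square algebra_simps)
  qed
  have deriv: "((\<lambda>e. Q (v + e *\<^sub>R w)) has_real_derivative 2 * (w \<bullet> w)) (at 0)"
    unfolding expand by (auto intro!: derivative_eq_intros)
  have "w \<in> S" using v(1) S(1) invariant by (simp add: w_def subspace_diff subspace_scale)
  then have "Q (v + e *\<^sub>R w) \<ge> 0" for e
    using max[of "v + e *\<^sub>R w"] v(1) S(1) by (simp add: Q_def r_def subspace_add subspace_scale)
  then have "2 * (w \<bullet> w) = 0"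
    using DERIV_local_min[OF deriv zero_less_one] expand[of 0] by simp
  then have "f v = r *\<^sub>R v" by (simp add: w_def)
  then show thesis using v by (intro that[of v r]) auto
qed

lemma span_eigenvectors_selfadjoint:
  fixes f :: "'a::euclidean_space \<Rightarrow> 'a"
  assumes lin: "linear f" and selfadjoint: "\<And>x y. f x \<bullet> y = x \<bullet> f y"
  shows "span {v. \<exists>r. f v = r *\<^sub>R v} = UNIV"
proof (rule ccontr)
  let ?E = "{v. \<exists>r. f v = r *\<^sub>R v}"
  define S where "S = {w. \<forall>v\<in>?E. orthogonal w v}"
  assume "span ?E \<noteq> UNIV"
  then have "span ?E \<subset> span UNIV" by auto
  then obtain a where "a \<noteq> 0" "\<And>y. y \<in> span ?E \<Longrightarrow> orthogonal a y"
    using orthogonal_to_subspace_exists_gen[of ?E UNIV] by blast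
  then have "a \<in> S" "S \<noteq> {0}" by (auto simp: S_def span_base)
  moreover have "subspace S"
    by (auto simp: S_def subspace_def orthogonal_clauses)
  moreover have "f w \<in> S" if w: "w \<in> S" for w
    unfolding S_def
  proof clarify
    fix v r assume "f v = r *\<^sub>R v"
    moreover from this have "w \<bullet> v = 0" using w by (auto simp: S_def orthogonal_def)
    ultimately show "orthogonal (f w) v" by (simp add: orthogonal_def selfadjoint)
  qed
  ultimately obtain v r where v: "v \<in> S" "v \<noteq> 0" "f v = r *\<^sub>R v"
    using selfadjoint_has_eigenvector[OF lin selfadjoint] by metis
  then have "orthogonal v v" by (auto simp: S_def)
  then show False using v(2) by (simp add: orthogonal_self)
qed

definition cmat :: "real^'q^'q \<Rightarrow> complex^'q^'q" where
  "cmat A = (\<chi> i j. complex_of_real (A $ i $ j))"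

lemma cmat_mult: "cmat (A ** B) = cmat A ** cmat B"
  by (simp add: cmat_def matrix_matrix_mult_def vec_eq_iff)

lemma cmat_mat_1: "cmat (mat 1) = mat 1"
  by (simp add: cmat_def mat_def vec_eq_iff)

lemma cmat_mult_cvec: "cmat A *v cvec x = cvec (A *v x)"
  by (simp add: cmat_def cvec_def matrix_vector_mult_def vec_eq_iff)

lemma cmat_eq_iff: "cmat A = cmat B \<longleftrightarrow> A = B"
  by (simp add: cmat_def vec_eq_iff)

lemma Re_cinner_cvec: "Re (cinner (cvec x) (cvec y)) = x \<bullet> y"
  by (simp add: cinner_def cvec_def inner_vec_def)

lemma Re_cmat_mult: "(\<chi> i. Re ((cmat A *v v) $ i)) = A *v (\<chi> i. Re (v $ i))"
  by (simp add: cmat_def matrix_vector_mult_def vec_eq_iff)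

lemma Im_cmat_mult: "(\<chi> i. Im ((cmat A *v v) $ i)) = A *v (\<chi> i. Im (v $ i))"
  by (simp add: cmat_def matrix_vector_mult_def vec_eq_iff)

lemma bounded_bilinear_cmat_mult: "bounded_bilinear (\<lambda>A. (*v) (cmat A))"
  unfolding bilinear_conv_bounded_bilinear[symmetric] bilinear_def
  by (auto intro!: linearI simp: cmat_def matrix_vector_mult_def vec_eq_iff sum.distrib
      algebra_simps sum_distrib_left scaleR_conv_of_real[where 'a=complex])

lemma bounded_linear_vector_scalar_mult_left: "bounded_linear (\<lambda>c. c *s (v :: complex^'n))"
  unfolding linear_conv_bounded_linear[symmetric]
  by (rule linearI) (simp_all add: vec_eq_iff distrib_right)

lemma skew_inner: "skew A \<Longrightarrow> (A *v x) \<bullet> y = - (x \<bullet> (A *v y))"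
  using inner_transpose_left[of A x y]
  by (simp only: skew_def bounded_bilinear.minus_left[OF bounded_bilinear_matrix_vector_mult]
      inner_minus_left minus_minus)

lemma skew_inner_self: "skew A \<Longrightarrow> (A *v x) \<bullet> x = 0"
  using skew_inner[of A x x] by (simp add: inner_commute)

lemma cmat_skew_selfadjoint:
  assumes "skew A"
  shows "(\<i> *s (cmat A *v x)) \<bullet> y = x \<bullet> (\<i> *s (cmat A *v y))"
proof -
  let ?Re = "\<lambda>v::complex^'a. \<chi> i. Re (v $ i)" and ?Im = "\<lambda>v::complex^'a. \<chi> i. Im (v $ i)"
  have inner: "v \<bullet> w = ?Re v \<bullet> ?Re w + ?Im v \<bullet> ?Im w" for v w
    by (simp add: inner_vec_def inner_complex_def sum.distrib)
  have parts: "?Re (\<i> *s (cmat A *v v)) = - (A *v ?Im v)" "?Im (\<i> *s (cmat A *v v)) = A *v ?Re v"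
    for v
    unfolding Re_cmat_mult[symmetric] Im_cmat_mult[symmetric] by (simp_all add: vec_eq_iff)
  show ?thesis
    unfolding inner parts by (simp add: skew_inner[OF assms])
qed

lemma ii_smult_eq_iff: "\<i> *s x = y \<longleftrightarrow> x = (- \<i>) *s (y :: complex^'n)"
proof -
  have "(- \<i>) *s (\<i> *s x) = x" "\<i> *s ((- \<i>) *s y) = y" by simp_all
  then show ?thesis by metis
qed

lemma span_eigenvectors_skew:
  assumes "skew A"
  shows "span {v. \<exists>r::real. cmat A *v v = (- \<i> * of_real r) *s v} = UNIV"
proof -
  have "(\<i> *s (cmat A *v v) = r *\<^sub>R v) = (cmat A *v v = (- \<i> * of_real r) *s v)" for v r
  proof -
    have "r *\<^sub>R v = complex_of_real r *s v"
      by (simp add: vec_eq_iff scaleR_conv_of_real[where 'a=complex])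
    then show ?thesis by (simp add: ii_smult_eq_iff)
  qed
  moreover have "linear (\<lambda>v. \<i> *s (cmat A *v v))"
    by (rule linearI)
      (simp_all add: vec_eq_iff bounded_bilinear.add_right[OF bounded_bilinear_cmat_mult]
        bounded_bilinear.scaleR_right[OF bounded_bilinear_cmat_mult] distrib_left)
  ultimately show ?thesis
    using span_eigenvectors_selfadjoint[OF _ cmat_skew_selfadjoint[OF assms]] by simp
qed

lemma matrix_eq_on_eigenvectors:
  assumes "skew A"
    and eq: "\<And>v c. v \<noteq> 0 \<Longrightarrow> cmat A *v v = (- \<i> * c) *s v \<Longrightarrow> B *v v = C *v v"
  shows "B = C"
proof -
  have lin: "linear (\<lambda>x::complex^'a. B *v x)" for B
    by (rule linearI) (simp_all add: matrix_vector_mult_def vec_eq_iff scaleR_sum_right distrib_left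
        sum.distrib)
  have "B *v x = C *v x" for x
  proof (rule linear_eq_on_span[OF lin lin])
    show "x \<in> span {v. \<exists>r::real. cmat A *v v = (- \<i> * of_real r) *s v}"
      using span_eigenvectors_skew[OF assms(1)] by simp
    show "B *v v = C *v v" if "v \<in> {v. \<exists>r::real. cmat A *v v = (- \<i> * of_real r) *s v}" for v
      using that eq[of v] by (cases "v = 0") auto
  qed
  then show ?thesis by (simp add: matrix_eq)
qed

lemma Uc_eigen_iff: "Uc U \<tau> *v v = c *s v \<longleftrightarrow> cmat (Ut U \<tau>) *v v = (- \<i> * c) *s v"
proof -
  have "Uc U \<tau> *v v = \<i> *s (cmat (Ut U \<tau>) *v v)"
    by (simp add: Uc_def cmat_def matrix_vector_mult_def vec_eq_iff sum_distrib_left mult.assoc)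
  then show ?thesis by (simp add: ii_smult_eq_iff vector_smult_assoc)
qed

lemma matfun_Uc_eqI:
  assumes skew: "skew (Ut U \<tau>)"
    and eigen: "\<And>v c. v \<noteq> 0 \<Longrightarrow> cmat (Ut U \<tau>) *v v = (- \<i> * c) *s v \<Longrightarrow> B *v v = f c *s v"
  shows "matfun f (Uc U \<tau>) = B"
  unfolding matfun_def Uc_eigen_iff
proof (rule the_equality)
  show "\<forall>v c. cmat (Ut U \<tau>) *v v = (- \<i> * c) *s v \<longrightarrow> B *v v = f c *s v"
  proof (intro allI impI)
    fix v c assume "cmat (Ut U \<tau>) *v v = (- \<i> * c) *s v"
    then show "B *v v = f c *s v" using eigen by (cases "v = 0") auto
  qed
next
  fix C assume "\<forall>v c. cmat (Ut U \<tau>) *v v = (- \<i> * c) *s v \<longrightarrow> C *v v = f c *s v"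
  then show "C = B" using eigen by (intro matrix_eq_on_eigenvectors[OF skew]) simp
qed

subsection \<open>Eigenvalues of the exponential and of its integral\<close>

lemma cmat_mpow_eigen:
  assumes "cmat A *v v = d *s v"
  shows "cmat (mpow A k) *v v = d ^ k *s v"
proof (induction k)
  case (Suc k)
  have "cmat (mpow A (Suc k)) *v v = d ^ k *s (cmat A *v v)"
    by (simp add: cmat_mult matrix_vector_mul_assoc[symmetric] Suc vector_scalar_commute)
  then show ?case using assms by (simp add: mult.commute)
qed (simp add: cmat_mat_1)

lemma cmat_mexp_eigen:
  assumes "cmat A *v v = d *s v"
  shows "cmat (mexp (s *\<^sub>R A)) *v v = exp (of_real s * d) *s v"
proof -
  interpret cmat: bounded_bilinear "\<lambda>A :: real^'a^'a. (*v) (cmat A)"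
    by (rule bounded_bilinear_cmat_mult)
  have "cmat ((1 / fact k) *\<^sub>R mpow (s *\<^sub>R A) k) *v v = ((of_real s * d) ^ k /\<^sub>R fact k) *s v" for k
    using cmat_mpow_eigen[OF assms, of k]
    by (simp add: mpow_scaleR cmat.scaleR_left vec_eq_iff power_mult_distrib divide_inverse
        scaleR_conv_of_real[where 'a=complex])
  moreover have "(\<lambda>k. cmat ((1 / fact k) *\<^sub>R mpow (s *\<^sub>R A) k) *v v) sums (cmat (mexp (s *\<^sub>R A)) *v v)"
    by (rule bounded_linear.sums[OF cmat.bounded_linear_left mexp_sums])
  ultimately have "(\<lambda>k. ((of_real s * d) ^ k /\<^sub>R fact k) *s v) sums (cmat (mexp (s *\<^sub>R A)) *v v)"
    by simp
  moreover have "(\<lambda>k. ((of_real s * d) ^ k /\<^sub>R fact k) *s v) sums (exp (of_real s * d) *s v)"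
    by (rule bounded_linear.sums[OF bounded_linear_vector_scalar_mult_left exp_converges])
  ultimately show ?thesis by (rule sums_unique2)
qed

definition sinc :: "real \<Rightarrow> complex \<Rightarrow> complex" where
  "sinc s z = (if z = 0 then of_real s else sin (of_real s * z) / z)"

lemma mult_sinc: "z * sinc s z = sin (of_real s * z)"
  by (simp add: sinc_def)

lemma exp_minus_ii: "exp (- \<i> * z) = cos z - \<i> * sin (z :: complex)"
  using exp_Euler[of "- z"] by simp

lemma exp_sinc_has_vector_derivative:
  "((\<lambda>s. exp (- \<i> * of_real s * z) * sinc s z) has_vector_derivative exp (- \<i> * of_real (2 * s) * z))
    (at s within S)"
proof (cases "z = 0")
  case True
  then show ?thesis by (auto simp: sinc_def intro!: derivative_eq_intros)
next
  case False
  let ?w = "of_real s :: complex"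
  have "((\<lambda>w. exp (- \<i> * w * z) * (sin (w * z) / z)) has_field_derivative
      exp (- \<i> * ?w * z) * (cos (?w * z) - \<i> * sin (?w * z))) (at ?w)"
    using False by (auto intro!: derivative_eq_intros simp: field_simps)
  moreover have "exp (- \<i> * ?w * z) * (cos (?w * z) - \<i> * sin (?w * z))
      = exp (- \<i> * of_real (2 * s) * z)"
    by (simp only: exp_minus_ii[symmetric] exp_add[symmetric]) (simp add: algebra_simps)
  ultimately have "((\<lambda>w. exp (- \<i> * w * z) * (sin (w * z) / z)) has_field_derivative
      exp (- \<i> * of_real (2 * s) * z)) (at ?w)"
    by simp
  from has_vector_derivative_real_field[OF this] show ?thesis
    using False by (simp add: sinc_def)
qed

lemma cmat_mexp_int_eigen:
  assumes eigen: "cmat A *v v = (- \<i> * c) *s v" and "s \<ge> 0"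
  shows "cmat (mexp_int A s) *v v = (exp (- \<i> * of_real s * c) * sinc s c) *s v"
proof -
  have "cmat (mexp ((2 * r) *\<^sub>R A)) *v v = exp (- \<i> * of_real (2 * r) * c) *s v" for r
    using cmat_mexp_eigen[OF eigen, of "2 * r"] by (simp add: mult_ac)
  then have "((\<lambda>r. exp (- \<i> * of_real (2 * r) * c) *s v) has_integral cmat (mexp_int A s) *v v)
      {0..s}"
    using has_integral_linear[OF mexp_int_has_integral
        bounded_bilinear.bounded_linear_left[OF bounded_bilinear_cmat_mult, of v], of A s]
    by (simp add: o_def)
  moreover have "((\<lambda>r. exp (- \<i> * of_real (2 * r) * c) *s v) has_integral
      (exp (- \<i> * of_real s * c) * sinc s c) *s v - (exp (- \<i> * of_real 0 * c) * sinc 0 c) *s v)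
      {0..s}"
    by (intro fundamental_theorem_of_calculus assms(2)
        bounded_linear.has_vector_derivative[OF bounded_linear_vector_scalar_mult_left]
        exp_sinc_has_vector_derivative)
  ultimately show ?thesis by (auto dest: has_integral_unique simp: sinc_def)
qed

lemma skew_eigenvalue_le_onorm:
  assumes "cmat A *v v = (- \<i> * of_real r) *s v" "v \<noteq> 0"
  shows "\<bar>r\<bar> \<le> onorm ((*v) A)"
proof -
  let ?x = "\<chi> i. Re (v $ i)" and ?y = "\<chi> i. Im (v $ i)"
  have "A *v ?x = r *\<^sub>R ?y" "A *v ?y = - r *\<^sub>R ?x"
    unfolding Re_cmat_mult[symmetric] Im_cmat_mult[symmetric] assms(1) by (simp_all add: vec_eq_iff)
  then have "\<bar>r\<bar> * norm ?y \<le> onorm ((*v) A) * norm ?x" "\<bar>r\<bar> * norm ?x \<le> onorm ((*v) A) * norm ?y"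
    using onorm[OF matrix_vector_mul_bounded_linear, of A] by (metis norm_scaleR abs_minus_cancel)+
  then have "\<bar>r\<bar> * (norm ?x + norm ?y) \<le> onorm ((*v) A) * (norm ?x + norm ?y)"
    by (simp add: distrib_left)
  moreover have "?x \<noteq> 0 \<or> ?y \<noteq> 0"
    using assms(2) by (auto simp: vec_eq_iff complex_eq_iff)
  then have "norm ?x + norm ?y > 0"
    by (metis add_nonneg_pos add_pos_nonneg norm_ge_zero zero_less_norm_iff)
  ultimately show ?thesis by (rule mult_right_le_imp_le)
qed

lemma invertible_if_surj_cmat:
  assumes "surj ((*v) (cmat M))"
  shows "invertible M"
proof -
  have "y \<in> range ((*v) M)" for y
  proof -
    obtain v where "cmat M *v v = cvec y" using assms by (metis surjD)
    then have "y = M *v (\<chi> i. Re (v $ i))"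
      unfolding Re_cmat_mult[symmetric] by (simp add: cvec_def vec_eq_iff)
    then show ?thesis by blast
  qed
  then have "surj ((*v) M)" by blast
  then show ?thesis
    using matrix_right_invertible_surjective invertible_right_inverse by blast
qed

lemma invertible_mexp_int:
  assumes skew: "skew A" and onorm: "onorm ((*v) A) < pi" and s: "0 < s" "s \<le> 1"
  shows "invertible (mexp_int A s)"
proof (rule invertible_if_surj_cmat)
  let ?M = "mexp_int A s"
  interpret cmat: bounded_bilinear "\<lambda>A :: real^'a^'a. (*v) (cmat A)"
    by (rule bounded_bilinear_cmat_mult)
  have "v \<in> range ((*v) (cmat ?M))" if eigen: "cmat A *v v = (- \<i> * of_real r) *s v" for v r
  proof (cases "v = 0")
    case True
    then show ?thesis by (intro range_eqI[of _ _ 0]) simp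
  next
    case False
    have "\<bar>s * r\<bar> < pi"
      using skew_eigenvalue_le_onorm[OF eigen False] onorm s mult_left_le_one_le[of "\<bar>r\<bar>" s]
      by (simp add: abs_mult)
    then have "sinc s (of_real r) \<noteq> 0"
      using s sin_eq_0_pi[of "s * r"]
      by (auto simp: sinc_def abs_less_iff sin_of_real simp flip: of_real_mult)
    then have "v = cmat ?M
        *v (inverse (exp (- \<i> * of_real s * of_real r) * sinc s (of_real r)) *s v)"
      using cmat_mexp_int_eigen[OF eigen, of s] s
      by (simp add: vector_scalar_commute vector_smult_assoc del: inverse_mult_distrib)
    then show ?thesis by blast
  qed
  then have "span {v. \<exists>r::real. cmat A *v v = (- \<i> * of_real r) *s v} \<subseteq> range ((*v) (cmat ?M))"
    by (intro span_minimal
        linear_subspace_image[OF bounded_linear.linear[OF cmat.bounded_linear_right]]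
        subspace_UNIV) auto
  then show "surj ((*v) (cmat ?M))" using span_eigenvectors_skew[OF skew] by auto
qed

definition mexp_int_inv :: "real^'q^'q \<Rightarrow> real \<Rightarrow> real^'q^'q" where
  "mexp_int_inv A s = matrix_inv (mexp_int A s)"

lemma cmat_inverse_eigen:
  assumes "invertible M" "cmat M *v v = m *s v" "v \<noteq> 0"
  shows "m \<noteq> 0" "cmat (matrix_inv M) *v v = inverse m *s v"
proof -
  have "v = cmat (matrix_inv M ** M) *v v" by (simp add: matrix_inv_left[OF assms(1)] cmat_mat_1)
  also have "\<dots> = m *s (cmat (matrix_inv M) *v v)"
    by (simp add: cmat_mult matrix_vector_mul_assoc[symmetric] assms(2) vector_scalar_commute)
  finally have inverse: "v = m *s (cmat (matrix_inv M) *v v)" .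
  show "m \<noteq> 0" using inverse assms(3) by auto
  then have "inverse m *s v = cmat (matrix_inv M) *v v"
    by (subst inverse) (simp add: vector_smult_assoc)
  then show "cmat (matrix_inv M) *v v = inverse m *s v" by simp
qed

subsection \<open>Identities for skew-symmetric matrices\<close>

lemma mexp_minus_right:
  assumes "skew A"
  shows "mexp (s *\<^sub>R A) ** mexp (- s *\<^sub>R A) = mat 1"
proof -
  have "cmat (mexp (s *\<^sub>R A) ** mexp (- s *\<^sub>R A)) = cmat (mat 1)"
  proof (rule matrix_eq_on_eigenvectors[OF assms])
    fix v c assume eigen: "cmat A *v v = (- \<i> * c) *s v"
    show "cmat (mexp (s *\<^sub>R A) ** mexp (- s *\<^sub>R A)) *v v = cmat (mat 1) *v v"
      using cmat_mexp_eigen[OF eigen, of s] cmat_mexp_eigen[OF eigen, of "- s"]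
      by (simp add: cmat_mult cmat_mat_1 matrix_vector_mul_assoc[symmetric] vector_scalar_commute
          vector_smult_assoc exp_add[symmetric])
  qed
  then show ?thesis by (simp add: cmat_eq_iff)
qed

lemma norm_mexp_mult:
  assumes "skew A"
  shows "norm (mexp (s *\<^sub>R A) *v x) = norm x"
proof -
  have "transpose (mexp (s *\<^sub>R A)) = mexp (- s *\<^sub>R A)"
    using assms by (simp add: transpose_mexp transpose_scalar skew_def)
  moreover have "mexp (- s *\<^sub>R A) ** mexp (s *\<^sub>R A) = mat 1"
    using mexp_minus_right[OF assms, of "- s"] by simp
  ultimately have "(mexp (s *\<^sub>R A) *v x) \<bullet> (mexp (s *\<^sub>R A) *v x) = x \<bullet> x"
    using inner_transpose_left[of "mexp (s *\<^sub>R A)" "mexp (s *\<^sub>R A) *v x" x]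
    by (simp add: matrix_vector_mul_assoc inner_commute)
  then show ?thesis by (simp add: norm_eq_sqrt_inner)
qed

lemma transpose_mexp_int_mult_mexp:
  assumes "skew A" "s \<ge> 0"
  shows "transpose (mexp_int A s) ** mexp ((2 * s) *\<^sub>R A) = mexp_int A s"
proof -
  have "cmat (mexp_int (- A) s ** mexp ((2 * s) *\<^sub>R A)) = cmat (mexp_int A s)"
  proof (rule matrix_eq_on_eigenvectors[OF assms(1)])
    fix v c assume eigen: "cmat A *v v = (- \<i> * c) *s v"
    then have "cmat (- A) *v v = (- \<i> * - c) *s v"
      by (simp add: cmat_def matrix_vector_mult_def vec_eq_iff sum_negf)
    from cmat_mexp_int_eigen[OF this assms(2)]
    have "cmat (mexp_int (- A) s) *v v = (exp (\<i> * of_real s * c) * sinc s c) *s v"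
      by (simp add: sinc_def)
    moreover have "exp (of_real (2 * s) * (- \<i> * c)) * exp (\<i> * of_real s * c)
        = exp (- \<i> * of_real s * c)"
      by (simp add: exp_add[symmetric] algebra_simps)
    ultimately show "cmat (mexp_int (- A) s ** mexp ((2 * s) *\<^sub>R A)) *v v = cmat (mexp_int A s) *v v"
      using cmat_mexp_eigen[OF eigen, of "2 * s"] cmat_mexp_int_eigen[OF eigen assms(2)]
      by (simp add: cmat_mult matrix_vector_mul_assoc[symmetric] vector_scalar_commute
          vector_smult_assoc mult.assoc[symmetric])
  qed
  then show ?thesis using assms(1) by (simp add: cmat_eq_iff transpose_mexp_int skew_def)
qed

definition geodesic_velocity :: "real^'q^'q \<Rightarrow> real \<Rightarrow> real^'q \<Rightarrow> real^'q" where
  "geodesic_velocity A s x = mexp ((2 * s) *\<^sub>R A) *v (mexp_int_inv A s *v x)"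

lemma matrix_mult_inverse_vector: "A ** B = mat 1 \<Longrightarrow> A *v (B *v x) = x"
  by (simp add: matrix_vector_mul_assoc)

context
  fixes A :: "real^'q^'q"
  assumes skew: "skew A" and onorm: "onorm ((*v) A) < pi"
begin

lemma mexp_int_inv_right:
  "0 < s \<Longrightarrow> s \<le> 1 \<Longrightarrow> mexp_int A s *v (mexp_int_inv A s *v x) = x"
  unfolding mexp_int_inv_def
  by (rule matrix_mult_inverse_vector[OF matrix_inv_right[OF invertible_mexp_int[OF skew onorm]]])

lemma mexp_int_inv_left:
  "0 < s \<Longrightarrow> s \<le> 1 \<Longrightarrow> mexp_int_inv A s *v (mexp_int A s *v x) = x"
  unfolding mexp_int_inv_def
  by (rule matrix_mult_inverse_vector[OF matrix_inv_left[OF invertible_mexp_int[OF skew onorm]]])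

lemma mexp_int_inv_has_vector_derivative:
  assumes "0 < s" "s \<le> 1" "S \<subseteq> {0..1}"
  shows "(mexp_int_inv A has_vector_derivative
    - (mexp_int_inv A s ** mexp ((2 * s) *\<^sub>R A) ** mexp_int_inv A s)) (at s within S)"
  unfolding mexp_int_inv_def[abs_def]
  using assms
  by (intro has_vector_derivative_matrix_inv invertible_mexp_int[OF skew onorm]
      has_vector_derivative_within_subset[OF mexp_int_has_vector_derivative]) auto

lemma continuous_on_mexp_int_inv:
  assumes "S \<subseteq> {0<..1}"
  shows "continuous_on S (mexp_int_inv A)"
  unfolding continuous_on_eq_continuous_within
proof
  fix s assume "s \<in> S"
  with assms show "continuous (at s within S) (mexp_int_inv A)"
    by (intro has_vector_derivative_continuous[OF mexp_int_inv_has_vector_derivative]) auto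
qed

lemma geodesic_velocity_eq:
  assumes "0 < s" "s \<le> 1"
  shows "geodesic_velocity A s x = mexp_int_inv A s *v x + 2 *\<^sub>R (A *v x)"
  using assms mexp_int_inv_right[OF assms, of x]
  by (simp add: geodesic_velocity_def mexp_eq_mexp_int matrix_vector_mult_add_rdistrib
      scaleR_matrix_vector_assoc[symmetric] matrix_vector_mul_assoc[symmetric])

lemma mexp_int_inv_adjoint:
  assumes s: "0 < s" "s \<le> 1"
  shows "(mexp_int_inv A s *v x) \<bullet> y = x \<bullet> geodesic_velocity A s y"
proof -
  let ?M = "mexp_int A s" and ?N = "mexp_int_inv A s"
  have "x \<bullet> geodesic_velocity A s y = (?M *v (?N *v x)) \<bullet> geodesic_velocity A s y"
    by (simp add: mexp_int_inv_right[OF s])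
  also have "\<dots> = (?N *v x) \<bullet> (transpose ?M *v geodesic_velocity A s y)"
    using inner_transpose_left[of ?M "geodesic_velocity A s y" "?N *v x"]
    by (simp only: inner_commute)
  also have "transpose ?M *v geodesic_velocity A s y = ?M *v (?N *v y)"
    using transpose_mexp_int_mult_mexp[OF skew less_imp_le[OF s(1)]]
    by (metis geodesic_velocity_def matrix_vector_mul_assoc)
  finally show ?thesis by (simp add: mexp_int_inv_right[OF s])
qed

end

subsection \<open>The functional calculus in terms of the exponential\<close>

lemma
  shows zcot_eq_sinc: "zcot z = cos z / sinc 1 z"
    and zsin_eq_sinc: "zsin z = 1 / sinc 1 z"
    and sinratio_eq_sinc: "sinratio s z = sinc s z / sinc 1 z"
  by (auto simp: zcot_def zsin_def sinratio_def sinc_def)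

context
  fixes U :: "'m::finite \<Rightarrow> real^'q::finite^'q" and \<tau> :: "real^'m"
  assumes skew: "skew (Ut U \<tau>)" and inv: "invertible (mexp_int (Ut U \<tau>) 1)"
begin

lemma cmat_mexp_int_inv_eigen:
  assumes "cmat (Ut U \<tau>) *v v = (- \<i> * c) *s v" "v \<noteq> 0"
  shows "sinc 1 c \<noteq> 0" "cmat (mexp_int_inv (Ut U \<tau>) 1) *v v = (exp (\<i> * c) / sinc 1 c) *s v"
  using cmat_inverse_eigen[OF inv cmat_mexp_int_eigen[OF assms(1), of 1] assms(2)]
  by (auto simp: mexp_int_inv_def exp_minus field_simps)

lemma matfun_zcot: "matfun zcot (Uc U \<tau>) = cmat (mexp_int_inv (Ut U \<tau>) 1 + Ut U \<tau>)"
proof (rule matfun_Uc_eqI[OF skew])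
  fix v c assume v: "v \<noteq> 0" and eigen: "cmat (Ut U \<tau>) *v v = (- \<i> * c) *s v"
  have "exp (\<i> * c) = cos c + \<i> * c * sinc 1 c"
    using exp_Euler[of c] mult_sinc[of c 1] by (simp add: mult.assoc)
  then have "zcot c = exp (\<i> * c) / sinc 1 c + - \<i> * c"
    using cmat_mexp_int_inv_eigen(1)[OF eigen v] by (simp add: zcot_eq_sinc field_simps)
  then show "cmat (mexp_int_inv (Ut U \<tau>) 1 + Ut U \<tau>) *v v = zcot c *s v"
    by (simp add: bounded_bilinear.add_left[OF bounded_bilinear_cmat_mult]
        cmat_mexp_int_inv_eigen(2)[OF eigen v] eigen vector_sadd_rdistrib)
qed

lemma matfun_zsin: "matfun zsin (Uc U \<tau>)
    = cmat (mexp ((2 * s) *\<^sub>R Ut U \<tau>) ** mexp_int_inv (Ut U \<tau>) 1 ** mexp ((1 - 2 * s) *\<^sub>R Ut U \<tau>))"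
proof (rule matfun_Uc_eqI[OF skew])
  fix v c assume v: "v \<noteq> 0" and eigen: "cmat (Ut U \<tau>) *v v = (- \<i> * c) *s v"
  have "exp (of_real (1 - 2 * s) * (- \<i> * c)) * (exp (\<i> * c) / sinc 1 c)
      * exp (of_real (2 * s) * (- \<i> * c)) = zsin c"
    by (simp add: zsin_eq_sinc exp_add[symmetric] algebra_simps)
  then show "cmat (mexp ((2 * s) *\<^sub>R Ut U \<tau>) ** mexp_int_inv (Ut U \<tau>) 1
        ** mexp ((1 - 2 * s) *\<^sub>R Ut U \<tau>)) *v v
      = zsin c *s v"
    by (simp only: cmat_mult matrix_vector_mul_assoc[symmetric] vector_scalar_commute
        vector_smult_assoc cmat_mexp_eigen[OF eigen] cmat_mexp_int_inv_eigen(2)[OF eigen v]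
        mult.assoc)
qed

lemma matfun_sinratio:
  assumes "s \<ge> 0"
  shows "matfun (sinratio s) (Uc U \<tau>)
      = cmat (mexp_int (Ut U \<tau>) s ** mexp_int_inv (Ut U \<tau>) 1 ** mexp ((1 - s) *\<^sub>R Ut U \<tau>))"
proof (rule matfun_Uc_eqI[OF skew])
  fix v c assume v: "v \<noteq> 0" and eigen: "cmat (Ut U \<tau>) *v v = (- \<i> * c) *s v"
  have "exp (of_real (1 - s) * (- \<i> * c)) * exp (\<i> * c) * exp (- \<i> * of_real s * c) = 1"
    by (simp add: exp_add[symmetric] algebra_simps)
  moreover have "a * (b / d) * (a' * b') = (a * b * a') * (b' / d)" for a b a' b' d :: complex
    by simp
  ultimately have "exp (of_real (1 - s) * (- \<i> * c)) * (exp (\<i> * c) / sinc 1 c)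
      * (exp (- \<i> * of_real s * c) * sinc s c) = sinratio s c"
    by (simp only: sinratio_eq_sinc mult_1)
  then show "cmat (mexp_int (Ut U \<tau>) s ** mexp_int_inv (Ut U \<tau>) 1 ** mexp ((1 - s) *\<^sub>R Ut U \<tau>)) *v v
      = sinratio s c *s v"
    by (simp only: cmat_mult matrix_vector_mul_assoc[symmetric] vector_scalar_commute
        vector_smult_assoc cmat_mexp_eigen[OF eigen] cmat_mexp_int_inv_eigen(2)[OF eigen v]
        cmat_mexp_int_eigen[OF eigen assms] mult.assoc)
qed

lemma phi_eq: "phi U (x, t) \<tau> = (mexp_int_inv (Ut U \<tau>) 1 *v x) \<bullet> x + 4 * (t \<bullet> \<tau>)"
  by (simp add: phi_def matfun_zcot cmat_mult_cvec Re_cinner_cvec matrix_vector_mult_add_rdistrib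
      inner_add_left skew_inner_self[OF skew])

lemma matfun_zsin_mexp:
  "matfun zsin (Uc U \<tau>) *v cvec (mexp ((2 * s - 1) *\<^sub>R Ut U \<tau>) *v x)
    = cvec (mexp ((2 * s) *\<^sub>R Ut U \<tau>) *v (mexp_int_inv (Ut U \<tau>) 1 *v x))"
proof -
  have "mexp ((1 - 2 * s) *\<^sub>R Ut U \<tau>) *v (mexp ((2 * s - 1) *\<^sub>R Ut U \<tau>) *v x) = x"
    using mexp_minus_right[OF skew, of "1 - 2 * s"] by (simp add: matrix_vector_mul_assoc)
  then show ?thesis by (simp add: matfun_zsin[of s] cmat_mult_cvec
      matrix_vector_mul_assoc[symmetric])
qed

lemma matfun_sinratio_mexp:
  assumes "s \<ge> 0"
  shows "matfun (sinratio s) (Uc U \<tau>) *v cvec (mexp ((s - 1) *\<^sub>R Ut U \<tau>) *v x)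
    = cvec (mexp_int (Ut U \<tau>) s *v (mexp_int_inv (Ut U \<tau>) 1 *v x))"
proof -
  have "mexp ((1 - s) *\<^sub>R Ut U \<tau>) *v (mexp ((s - 1) *\<^sub>R Ut U \<tau>) *v x) = x"
    using mexp_minus_right[OF skew, of "1 - s"] by (simp add: matrix_vector_mul_assoc)
  then show ?thesis
    by (simp add: matfun_sinratio[OF assms] cmat_mult_cvec matrix_vector_mul_assoc[symmetric])
qed

end

subsection \<open>Absolutely continuous functions\<close>

definition interval_family :: "real \<Rightarrow> real \<Rightarrow> 'i set \<Rightarrow> ('i \<Rightarrow> real) \<Rightarrow> ('i \<Rightarrow> real) \<Rightarrow> bool" where
  "interval_family a b J l r \<longleftrightarrow> finite J \<and> (\<forall>i\<in>J. a \<le> l i \<and> l i \<le> r i \<and> r i \<le> b)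
     \<and> disjoint_family_on (\<lambda>i. {l i<..<r i}) J"

lemma interval_familyD:
  assumes "interval_family a b J l r"
  shows "finite J" "i \<in> J \<Longrightarrow> a \<le> l i" "i \<in> J \<Longrightarrow> l i \<le> r i" "i \<in> J \<Longrightarrow> r i \<le> b"
    "disjoint_family_on (\<lambda>i. {l i<..<r i}) J"
  using assms by (auto simp: interval_family_def)

lemma interval_family_subset:
  "interval_family a b J l r \<Longrightarrow> K \<subseteq> J \<Longrightarrow> interval_family a b K l r"
  by (auto simp: interval_family_def finite_subset disjoint_family_on_def)

lemma interval_family_separated:
  assumes "interval_family a b J l r" "i \<in> J" "j \<in> J" "i \<noteq> j" "l i < r i" "l j < r j"
  shows "r i \<le> l j \<or> r j \<le> l i"
proof (rule ccontr)
  assume "\<not> ?thesis"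
  then have "max (l i) (l j) < min (r i) (r j)" using assms(5,6) by auto
  then obtain x where "max (l i) (l j) < x" "x < min (r i) (r j)" using dense by blast
  then have "x \<in> {l i<..<r i} \<inter> {l j<..<r j}" by simp
  then show False using disjoint_family_onD[OF interval_familyD(5)[OF assms(1)] assms(2-4)] by blast
qed

lemma has_integral_interval_family:
  fixes f :: "real \<Rightarrow> 'a::banach"
  assumes J: "interval_family a b J l r" and f: "\<And>i. i \<in> J \<Longrightarrow> f integrable_on {l i..r i}"
  shows "(f has_integral (\<Sum>i\<in>J. integral {l i..r i} f)) (\<Union>i\<in>J. {l i<..<r i})"
proof (rule has_integral_UN[OF interval_familyD(1)[OF J]])
  show "(f has_integral integral {l i..r i} f) {l i<..<r i}" if "i \<in> J" for i
    using f[OF that] has_integral_Icc_iff_Ioo[of f _ "l i" "r i"]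
    by (simp add: has_integral_integral)
  show "pairwise (\<lambda>i j. negligible ({l i<..<r i} \<inter> {l j<..<r j})) J"
    using interval_familyD(5)[OF J] by (auto simp: pairwise_def disjoint_family_on_def)
qed

lemma sum_length_interval_family_le:
  assumes J: "interval_family a b J l r" and W: "W \<in> lmeasurable" "(\<Union>i\<in>J. {l i<..<r i}) \<subseteq> W"
  shows "(\<Sum>i\<in>J. r i - l i) \<le> measure lebesgue W"
proof -
  have "(\<Sum>i\<in>J. r i - l i) = (\<Sum>i\<in>J. integral {l i..r i} (\<lambda>_. 1))"
    using interval_familyD(3)[OF J] by simp
  then have "((\<lambda>_. 1) has_integral (\<Sum>i\<in>J. r i - l i)) (\<Union>i\<in>J. {l i<..<r i})"
    using has_integral_interval_family[OF J integrable_continuous_interval[OF continuous_on_const],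
        of "1::real"]
    by simp
  then show ?thesis
    using has_integral_subset_le[OF W(2), of "\<lambda>_. 1::real"] W(1) lmeasure_integral[OF W(1)]
    by (auto simp: lmeasurable_iff_integrable_on integrable_integral)
qed

lemma division_of_interval:
  assumes div: "\<D> division_of {a..b::real}" and K: "K \<in> \<D>"
  shows "K = {Inf K..Sup K}" "a \<le> Inf K" "Inf K \<le> Sup K" "Sup K \<le> b"
proof -
  obtain c d where "K = {c..d}" using division_ofD(4)[OF div K] by auto
  then show "K = {Inf K..Sup K}" "a \<le> Inf K" "Inf K \<le> Sup K" "Sup K \<le> b"
    using division_ofD(2,3)[OF div K] by auto
qed

lemma interval_family_division:
  assumes div: "\<D> division_of {a..b}"
  shows "interval_family a b \<D> Inf Sup"
proof -
  have "interior K = {Inf K<..<Sup K}" if "K \<in> \<D>" for K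
    using division_of_interval(1)[OF div that] by (metis interior_atLeastAtMost_real)
  then have "disjoint_family_on (\<lambda>K. {Inf K<..<Sup K}) \<D>"
    using division_ofD(5)[OF div] by (auto simp: disjoint_family_on_def)
  then show ?thesis
    using division_of_interval(2-4)[OF div] division_of_finite[OF div]
    by (simp add: interval_family_def)
qed

lemma tagged_division_of_interval:
  assumes p: "p tagged_division_of {a..b}" and xk: "(x, k) \<in> p"
  shows "k = {Inf k..Sup k}" "a \<le> Inf k" "Inf k \<le> x" "x \<le> Sup k" "Sup k \<le> b"
    "measure lborel k = Sup k - Inf k"
proof -
  obtain c d where "k = {c..d}" using tagged_division_ofD(4)[OF p xk] by auto
  then show "k = {Inf k..Sup k}" "a \<le> Inf k" "Inf k \<le> x" "x \<le> Sup k" "Sup k \<le> b"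
    "measure lborel k = Sup k - Inf k"
    using tagged_division_ofD(2,3)[OF p xk] by auto
qed

lemma interval_family_tagged_division:
  assumes p: "p tagged_division_of {a..b}"
  shows "interval_family a b p (\<lambda>z. Inf (snd z)) (\<lambda>z. Sup (snd z))"
proof -
  have "disjoint_family_on (\<lambda>z. {Inf (snd z)<..<Sup (snd z)}) p"
    unfolding disjoint_family_on_def
  proof (intro ballI impI)
    fix y z assume yz: "y \<in> p" "z \<in> p" "y \<noteq> z"
    have "interior (snd z) = {Inf (snd z)<..<Sup (snd z)}" if "z \<in> p" for z
      using tagged_division_of_interval(1)[OF p, of "fst z" "snd z"] that
      by (metis interior_atLeastAtMost_real prod.collapse)
    then show "{Inf (snd y)<..<Sup (snd y)} \<inter> {Inf (snd z)<..<Sup (snd z)} = {}"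
      using tagged_division_ofD(5)[OF p, of "fst y" "snd y" "fst z" "snd z"] yz by simp
  qed
  moreover have "a \<le> Inf (snd z) \<and> Inf (snd z) \<le> Sup (snd z) \<and> Sup (snd z) \<le> b" if "z \<in> p" for z
    using tagged_division_of_interval(2-5)[OF p, of "fst z" "snd z"] that by simp
  ultimately show ?thesis
    using tagged_division_of_finite[OF p] by (simp add: interval_family_def)
qed

lemma abs_cont_onI:
  assumes "\<And>\<epsilon>. \<epsilon> > 0 \<Longrightarrow> \<exists>\<delta>>0. \<forall>(J :: nat set) l r. interval_family a b J l r \<longrightarrow>
    (\<Sum>i\<in>J. r i - l i) < \<delta> \<longrightarrow> (\<Sum>i\<in>J. norm (f (r i) - f (l i))) < \<epsilon>"
  shows "abs_cont_on a b f"
  unfolding abs_cont_on_def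
proof (intro allI impI)
  fix \<epsilon> :: real assume "\<epsilon> > 0"
  then obtain \<delta> where "\<delta> > 0" and \<delta>: "\<And>(J :: nat set) l r. interval_family a b J l r \<Longrightarrow>
      (\<Sum>i\<in>J. r i - l i) < \<delta> \<Longrightarrow> (\<Sum>i\<in>J. norm (f (r i) - f (l i))) < \<epsilon>"
    using assms by blast
  have "interval_family a b {..<n} l r"
    if "\<forall>i<n. a \<le> l i \<and> l i \<le> r i \<and> r i \<le> b" "\<forall>i<n. \<forall>j<n. i \<noteq> j \<longrightarrow> r i \<le> l j \<or> r j \<le> l i"
      for n :: nat and l r
    using that by (auto simp: interval_family_def disjoint_family_on_def min_le_iff_disj
        le_max_iff_disj)
  with \<delta> \<open>\<delta> > 0\<close>
  show "\<exists>\<delta>>0. \<forall>(n::nat) l r. (\<forall>i<n. a \<le> l i \<and> l i \<le> r i \<and> r i \<le> b) \<and>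
      (\<forall>i<n. \<forall>j<n. i \<noteq> j \<longrightarrow> r i \<le> l j \<or> r j \<le> l i) \<and> (\<Sum>i<n. r i - l i) < \<delta> \<longrightarrow>
      (\<Sum>i<n. norm (f (r i) - f (l i))) < \<epsilon>"
    by (intro exI[of _ \<delta>] conjI allI impI) auto
qed

lemma abs_cont_on_interval_family:
  assumes "abs_cont_on a b f" "\<epsilon> > 0"
  obtains \<delta> where "\<delta> > 0" "\<And>(J :: 'i set) l r. interval_family a b J l r \<Longrightarrow>
      (\<Sum>i\<in>J. r i - l i) < \<delta> \<Longrightarrow> (\<Sum>i\<in>J. norm (f (r i) - f (l i))) < \<epsilon>"
proof -
  obtain \<delta> where "\<delta> > 0" and \<delta>: "\<forall>(n::nat) l r. (\<forall>i<n. a \<le> l i \<and> l i \<le> r i \<and> r i \<le> b) \<and>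
        (\<forall>i<n. \<forall>j<n. i \<noteq> j \<longrightarrow> r i \<le> l j \<or> r j \<le> l i) \<and>
        (\<Sum>i<n. r i - l i) < \<delta> \<longrightarrow> (\<Sum>i<n. norm (f (r i) - f (l i))) < \<epsilon>"
    using assms unfolding abs_cont_on_def by blast
  have "(\<Sum>i\<in>J. norm (f (r i) - f (l i))) < \<epsilon>"
    if J: "interval_family a b J l r" and small: "(\<Sum>i\<in>J. r i - l i) < \<delta>" for J :: "'i set" and l r
  proof -
    \<comment> \<open>A degenerate interval may lie inside another one, so only the proper ones are separated.\<close>
    define P where "P = {i\<in>J. l i < r i}"
    have P: "finite P" "P \<subseteq> J" using interval_familyD(1)[OF J] by (auto simp: P_def)
    have degenerate: "r i = l i" if "i \<in> J - P" for i
      using that interval_familyD(3)[OF J, of i] by (auto simp: P_def)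
    obtain h where h: "bij_betw h {..<card P} P"
      using ex_bij_betw_nat_finite[OF P(1)] by (auto simp: atLeast0LessThan)
    then have hP: "\<And>n. n < card P \<Longrightarrow> h n \<in> P" and hJ: "\<And>n. n < card P \<Longrightarrow> h n \<in> J"
      and inj: "inj_on h {..<card P}"
      using P(2) by (auto simp: bij_betw_def)
    have reindex: "(\<Sum>i\<in>J. g i) = (\<Sum>n<card P. g (h n))" if "\<And>i. i \<in> J - P \<Longrightarrow> g i = 0"
      for g :: "'i \<Rightarrow> real"
      using sum.mono_neutral_right[OF interval_familyD(1)[OF J] P(2), of g] that
        sum.reindex_bij_betw[OF h, of g] by simp
    have "(\<Sum>n<card P. norm (f (r (h n)) - f (l (h n)))) < \<epsilon>"
    proof (rule \<delta>[THEN spec, of "card P", THEN spec, of "\<lambda>n. l (h n)", THEN spec, of "\<lambda>n. r (h n)",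
        THEN mp],
        intro conjI)
      show "\<forall>m<card P. \<forall>n<card P. m \<noteq> n \<longrightarrow> r (h m) \<le> l (h n) \<or> r (h n) \<le> l (h m)"
      proof (intro allI impI)
        fix m n assume "m < card P" "n < card P" "m \<noteq> n"
        then show "r (h m) \<le> l (h n) \<or> r (h n) \<le> l (h m)"
          using interval_family_separated[OF J, of "h m" "h n"] hP[of m] hP[of n]
            inj_onD[OF inj, of m n]
          by (auto simp: P_def)
      qed
    qed (use small reindex[of "\<lambda>i. r i - l i"] degenerate interval_familyD(2-4)[OF J] hJ in auto)
    then show ?thesis using reindex[of "\<lambda>i. norm (f (r i) - f (l i))"] degenerate by simp
  qed
  with \<open>\<delta> > 0\<close> show thesis by (rule that)
qed

lemma abs_cont_on_subinterval:
  assumes "abs_cont_on a b f" "a \<le> c" "d \<le> b"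
  shows "abs_cont_on c d f"
proof (rule abs_cont_onI)
  fix \<epsilon> :: real assume "\<epsilon> > 0"
  moreover have "interval_family a b J l r" if "interval_family c d J l r" for J :: "nat set"
    and l r
    using that assms(2,3) by (fastforce simp: interval_family_def)
  ultimately show "\<exists>\<delta>>0. \<forall>(J :: nat set) l r. interval_family c d J l r \<longrightarrow>
    (\<Sum>i\<in>J. r i - l i) < \<delta> \<longrightarrow> (\<Sum>i\<in>J. norm (f (r i) - f (l i))) < \<epsilon>"
    using abs_cont_on_interval_family[OF assms(1), of \<epsilon>] by metis
qed

lemma abs_cont_on_compare:
  fixes f :: "real \<Rightarrow> 'a::real_normed_vector" and g :: "real \<Rightarrow> 'b::real_normed_vector"
  assumes f: "abs_cont_on a b f" and g: "abs_cont_on a b g"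
    and bound: "\<And>s t. a \<le> s \<Longrightarrow> s \<le> t \<Longrightarrow> t \<le> b \<Longrightarrow>
      norm (h t - h s) \<le> C * (norm (f t - f s) + norm (g t - g s))"
  shows "abs_cont_on a b h"
proof (rule abs_cont_onI)
  fix \<epsilon> :: real assume \<epsilon>: "\<epsilon> > 0"
  define \<eta> where "\<eta> = \<epsilon> / (2 * (\<bar>C\<bar> + 1))"
  have \<eta>: "\<eta> > 0" using \<epsilon> by (simp add: \<eta>_def add_nonneg_pos)
  obtain \<delta>1 where \<delta>1: "\<delta>1 > 0" "\<And>(J :: nat set) l r. interval_family a b J l r \<Longrightarrow>
      (\<Sum>i\<in>J. r i - l i) < \<delta>1 \<Longrightarrow> (\<Sum>i\<in>J. norm (f (r i) - f (l i))) < \<eta>"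
    using abs_cont_on_interval_family[OF f \<eta>] by metis
  obtain \<delta>2 where \<delta>2: "\<delta>2 > 0" "\<And>(J :: nat set) l r. interval_family a b J l r \<Longrightarrow>
      (\<Sum>i\<in>J. r i - l i) < \<delta>2 \<Longrightarrow> (\<Sum>i\<in>J. norm (g (r i) - g (l i))) < \<eta>"
    using abs_cont_on_interval_family[OF g \<eta>] by metis
  have "(\<Sum>i\<in>J. norm (h (r i) - h (l i))) < \<epsilon>"
    if J: "interval_family a b J l r" and small: "(\<Sum>i\<in>J. r i - l i) < min \<delta>1 \<delta>2" for J :: "nat set"
      and l r
  proof -
    let ?\<Delta> = "\<lambda>i. norm (f (r i) - f (l i)) + norm (g (r i) - g (l i))"
    have "(\<Sum>i\<in>J. norm (h (r i) - h (l i))) \<le> (\<Sum>i\<in>J. (\<bar>C\<bar> + 1) * ?\<Delta> i)"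
    proof (rule sum_mono)
      fix i assume "i \<in> J"
      then have "norm (h (r i) - h (l i)) \<le> C * ?\<Delta> i"
        using bound[of "l i" "r i"] interval_familyD(2-4)[OF J] by simp
      also have "\<dots> \<le> (\<bar>C\<bar> + 1) * ?\<Delta> i" by (intro mult_right_mono) auto
      finally show "norm (h (r i) - h (l i)) \<le> (\<bar>C\<bar> + 1) * ?\<Delta> i" .
    qed
    also have "\<dots> = (\<bar>C\<bar> + 1)
        * ((\<Sum>i\<in>J. norm (f (r i) - f (l i))) + (\<Sum>i\<in>J. norm (g (r i) - g (l i))))"
      by (simp add: sum_distrib_left[symmetric] sum.distrib)
    also have "\<dots> < (\<bar>C\<bar> + 1) * (\<eta> + \<eta>)"
      using \<delta>1(2)[OF J] \<delta>2(2)[OF J] small by (intro mult_strict_left_mono add_strict_mono) auto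
    also have "\<dots> = \<epsilon>" by (simp add: \<eta>_def field_simps add_nonneg_eq_0_iff)
    finally show ?thesis .
  qed
  then show "\<exists>\<delta>>0. \<forall>(J :: nat set) l r. interval_family a b J l r \<longrightarrow>
      (\<Sum>i\<in>J. r i - l i) < \<delta> \<longrightarrow> (\<Sum>i\<in>J. norm (h (r i) - h (l i))) < \<epsilon>"
    using \<delta>1(1) \<delta>2(1) by (intro exI[of _ "min \<delta>1 \<delta>2"]) auto
qed

lemma abs_cont_on_ident: "abs_cont_on a b (\<lambda>s. s)"
proof (rule abs_cont_onI)
  fix \<epsilon> :: real assume "\<epsilon> > 0"
  moreover have "(\<Sum>i\<in>J. norm (r i - l i)) = (\<Sum>i\<in>J. r i - l i)" if "interval_family a b J l r"
    for J :: "nat set" and l r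
    using interval_familyD(3)[OF that] by (intro sum.cong) auto
  ultimately show "\<exists>\<delta>>0. \<forall>(J :: nat set) l r. interval_family a b J l r \<longrightarrow>
      (\<Sum>i\<in>J. r i - l i) < \<delta> \<longrightarrow> (\<Sum>i\<in>J. norm (r i - l i)) < \<epsilon>"
    by (intro exI[of _ \<epsilon>]) auto
qed

lemma abs_cont_on_imp_continuous_on:
  assumes "abs_cont_on a b f"
  shows "continuous_on {a..b} f"
  unfolding continuous_on_iff
proof (intro ballI allI impI)
  fix s \<epsilon> :: real assume s: "s \<in> {a..b}" and \<epsilon>: "\<epsilon> > 0"
  obtain \<delta> where \<delta>: "\<delta> > 0" "\<And>(J :: nat set) l r. interval_family a b J l r \<Longrightarrow>
      (\<Sum>i\<in>J. r i - l i) < \<delta> \<Longrightarrow> (\<Sum>i\<in>J. norm (f (r i) - f (l i))) < \<epsilon>"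
    using abs_cont_on_interval_family[OF assms \<epsilon>] by metis
  have close: "dist (f u) (f t) < \<epsilon>" if "a \<le> t" "t \<le> u" "u \<le> b" "u - t < \<delta>" for t u
    using \<delta>(2)[of "{0}" "\<lambda>_. t" "\<lambda>_. u"] that
    by (simp add: interval_family_def disjoint_family_on_def dist_norm)
  have "dist (f t) (f s) < \<epsilon>" if "t \<in> {a..b}" "dist t s < \<delta>" for t
    using that s close[of s t] close[of t s]
    by (cases "s \<le> t") (auto simp: dist_real_def dist_commute)
  with \<delta>(1) show "\<exists>\<delta>>0. \<forall>t\<in>{a..b}. dist t s < \<delta> \<longrightarrow> dist (f t) (f s) < \<epsilon>" by blast
qed

subsection \<open>The fundamental theorem of calculus for absolutely continuous functions\<close>

definition ac_derivative ::
  "real \<Rightarrow> real \<Rightarrow> (real \<Rightarrow> 'a::real_normed_vector) \<Rightarrow> (real \<Rightarrow> 'a) \<Rightarrow> bool" where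
  "ac_derivative a b f f' \<longleftrightarrow> abs_cont_on a b f \<and>
     (\<exists>N. negligible N \<and> (\<forall>s\<in>{a..b} - N. (f has_vector_derivative f' s) (at s within {a..b})))"

lemma ac_derivative_subinterval:
  assumes "ac_derivative a b f f'" "a \<le> c" "d \<le> b"
  shows "ac_derivative c d f f'"
proof -
  obtain N where f: "abs_cont_on a b f" and N: "negligible N"
    and deriv: "\<And>s. s \<in> {a..b} - N \<Longrightarrow> (f has_vector_derivative f' s) (at s within {a..b})"
    using assms(1) unfolding ac_derivative_def by blast
  have "(f has_vector_derivative f' s) (at s within {c..d})" if "s \<in> {c..d} - N" for s
    using that assms(2,3) by (intro has_vector_derivative_within_subset[OF deriv]) auto
  then show ?thesis using abs_cont_on_subinterval[OF f assms(2,3)] N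
    by (auto simp: ac_derivative_def)
qed

lemma has_vector_derivative_straddle:
  assumes "(f has_vector_derivative v) (at s within {a..b})" "\<eta> > 0"
  obtains d where "d > 0" "\<And>l r. a \<le> l \<Longrightarrow> l \<le> s \<Longrightarrow> s \<le> r \<Longrightarrow> r \<le> b \<Longrightarrow> {l..r} \<subseteq> ball s d \<Longrightarrow>
    norm ((r - l) *\<^sub>R v - (f r - f l)) \<le> \<eta> * (r - l)"
proof -
  obtain d where d: "d > 0" and approx: "\<And>y. y \<in> {a..b} \<Longrightarrow> \<bar>y - s\<bar> < d \<Longrightarrow>
      norm (f y - f s - (y - s) *\<^sub>R v) \<le> \<eta> * \<bar>y - s\<bar>"
    using assms unfolding has_vector_derivative_def has_derivative_within_alt
    by (auto simp: ball_def)
  have "norm ((r - l) *\<^sub>R v - (f r - f l)) \<le> \<eta> * (r - l)"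
    if lr: "a \<le> l" "l \<le> s" "s \<le> r" "r \<le> b" "{l..r} \<subseteq> ball s d" for l r
  proof -
    have "l \<in> ball s d" "r \<in> ball s d" using subsetD[OF lr(5)] lr(2,3) by simp_all
    then have "norm (f l - f s - (l - s) *\<^sub>R v) \<le> \<eta> * (s - l)"
      "norm (f r - f s - (r - s) *\<^sub>R v) \<le> \<eta> * (r - s)"
      using approx[of l] approx[of r] lr by (auto simp: dist_real_def)
    then have "norm ((f l - f s - (l - s) *\<^sub>R v) - (f r - f s - (r - s) *\<^sub>R v))
        \<le> \<eta> * (s - l) + \<eta> * (r - s)"
      by (meson add_mono norm_triangle_ineq4 order_trans)
    then show ?thesis by (simp add: algebra_simps)
  qed
  with d show thesis by (rule that)
qed

lemma negligible_open_superset: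
  assumes "negligible N" "\<delta> > 0"
  obtains W where "open W" "N \<subseteq> W" "W \<in> lmeasurable" "measure lebesgue W < \<delta>"
proof -
  have N: "N \<in> lmeasurable" "measure lebesgue N = 0"
    using assms(1) by (auto simp: negligible_iff_measure)
  obtain W where W: "open W" "N \<subseteq> W" "W - N \<in> lmeasurable" "emeasure lebesgue (W - N) < ennreal \<delta>"
    using sets_lebesgue_outer_open[OF fmeasurableD[OF N(1)] assms(2)] by metis
  have "W = (W - N) \<union> N" using W(2) by blast
  then have "W \<in> lmeasurable" "measure lebesgue W \<le> measure lebesgue (W - N) + measure lebesgue N"
    using fmeasurable.Un[OF W(3) N(1)] measure_Un_le[OF fmeasurableD[OF W(3)] fmeasurableD[OF N(1)]]
    by metis+
  moreover have "measure lebesgue (W - N) < \<delta>"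
    using W(4) assms(2) emeasure_eq_measure2[OF W(3)] by (simp add: ennreal_less_iff)
  ultimately show thesis using W(1,2) N(2) by (intro that[of W]) auto
qed

lemma abs_cont_on_small_variation_near_negligible:
  assumes f: "abs_cont_on a b f" and N: "negligible N" and "\<epsilon> > 0"
  obtains W where "open W" "N \<subseteq> W" "\<And>(J :: 'i set) l r. interval_family a b J l r \<Longrightarrow>
    (\<Union>i\<in>J. {l i<..<r i}) \<subseteq> W \<Longrightarrow> (\<Sum>i\<in>J. norm (f (r i) - f (l i))) < \<epsilon>"
proof -
  obtain \<delta> where \<delta>: "\<delta> > 0" and variation: "\<And>(J :: 'i set) l r. interval_family a b J l r \<Longrightarrow>
      (\<Sum>i\<in>J. r i - l i) < \<delta> \<Longrightarrow> (\<Sum>i\<in>J. norm (f (r i) - f (l i))) < \<epsilon>"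
    using abs_cont_on_interval_family[OF f \<open>\<epsilon> > 0\<close>] by metis
  obtain W where W: "open W" "N \<subseteq> W" "W \<in> lmeasurable" "measure lebesgue W < \<delta>"
    using negligible_open_superset[OF N \<delta>] by metis
  show thesis
  proof (rule that[OF W(1,2)])
    fix J :: "'i set" and l r
    assume J: "interval_family a b J l r" and sub: "(\<Union>i\<in>J. {l i<..<r i}) \<subseteq> W"
    show "(\<Sum>i\<in>J. norm (f (r i) - f (l i))) < \<epsilon>"
      using sum_length_interval_family_le[OF J W(3) sub] W(4) by (intro variation[OF J]) simp
  qed
qed

lemma derivative_gauge:
  assumes deriv: "\<And>s. s \<in> {a..b} - N \<Longrightarrow> (f has_vector_derivative f' s) (at s within {a..b})"
    and W: "open W" "N \<subseteq> W" and "\<eta> > 0"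
  obtains d where "\<And>s. d s > 0" "\<And>s. s \<in> N \<Longrightarrow> ball s (d s) \<subseteq> W"
    "\<And>s l r. s \<in> {a..b} - N \<Longrightarrow> a \<le> l \<Longrightarrow> l \<le> s \<Longrightarrow> s \<le> r \<Longrightarrow> r \<le> b \<Longrightarrow> {l..r} \<subseteq> ball s (d s) \<Longrightarrow>
       norm ((r - l) *\<^sub>R f' s - (f r - f l)) \<le> \<eta> * (r - l)"
proof -
  have "\<exists>d>0. (s \<in> N \<longrightarrow> ball s d \<subseteq> W) \<and> (s \<in> {a..b} - N \<longrightarrow>
      (\<forall>l r. a \<le> l \<longrightarrow> l \<le> s \<longrightarrow> s \<le> r \<longrightarrow> r \<le> b \<longrightarrow> {l..r} \<subseteq> ball s d \<longrightarrow>
        norm ((r - l) *\<^sub>R f' s - (f r - f l)) \<le> \<eta> * (r - l)))" for s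
  proof (cases "s \<in> {a..b} - N")
    case True
    then show ?thesis using has_vector_derivative_straddle[OF deriv[OF True] \<open>\<eta> > 0\<close>]
      by (metis DiffD2)
  next
    case False
    then show ?thesis using W by (metis open_contains_ball subsetD zero_less_one)
  qed
  then show thesis using that by metis
qed

lemma riemann_sum_error_le:
  fixes f v :: "real \<Rightarrow> 'a::real_normed_vector"
  assumes p: "p tagged_division_of {a..b}" and "a \<le> b" "\<eta> \<ge> 0"
    and good: "\<And>s k. (s, k) \<in> p \<Longrightarrow> s \<notin> N \<Longrightarrow>
      norm ((Sup k - Inf k) *\<^sub>R v s - (f (Sup k) - f (Inf k))) \<le> \<eta> * (Sup k - Inf k)"
    and bad: "\<And>s. s \<in> N \<Longrightarrow> v s = 0"
  shows "norm ((\<Sum>(s, k)\<in>p. measure lborel k *\<^sub>R v s) - (f b - f a))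
    \<le> \<eta> * (b - a) + (\<Sum>z\<in>{z \<in> p. fst z \<in> N}. norm (f (Sup (snd z)) - f (Inf (snd z))))"
proof -
  define Q where "Q = {z \<in> p. fst z \<in> N}"
  define T where "T = (\<lambda>(s, k). measure lborel k *\<^sub>R v s - (f (Sup k) - f (Inf k)))"
  have finite: "finite p" and Q: "Q \<subseteq> p" using p by (auto simp: Q_def tagged_division_of_finite)
  have "(\<Sum>(s, k)\<in>p. measure lborel k *\<^sub>R v s) - (f b - f a) = (\<Sum>z\<in>p. T z)"
    unfolding additive_tagged_division_1[OF \<open>a \<le> b\<close> p, of f, symmetric] T_def
    by (simp add: sum_subtractf[symmetric] case_prod_unfold)
  also have "norm \<dots> \<le> (\<Sum>z\<in>p. norm (T z))" by (rule norm_sum)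
  also have "\<dots> = (\<Sum>z\<in>p - Q. norm (T z)) + (\<Sum>z\<in>Q. norm (T z))"
    by (rule sum.subset_diff[OF Q finite])
  also have "(\<Sum>z\<in>p - Q. norm (T z)) \<le> (\<Sum>z\<in>p - Q. \<eta> * measure lborel (snd z))"
  proof (rule sum_mono, clarify)
    fix s k assume "(s, k) \<in> p" "(s, k) \<notin> Q"
    then show "norm (T (s, k)) \<le> \<eta> * measure lborel (snd (s, k))"
      using good[of s k] tagged_division_of_interval(6)[OF p, of s k] by (simp add: T_def Q_def)
  qed
  also have "\<dots> \<le> (\<Sum>z\<in>p. \<eta> * measure lborel (snd z))"
    using finite \<open>\<eta> \<ge> 0\<close> by (intro sum_mono2) auto
  also have "\<dots> = \<eta> * (b - a)"
    using additive_content_tagged_division[of p a b] p \<open>a \<le> b\<close>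
    by (simp add: sum_distrib_left[symmetric] case_prod_unfold)
  also have "(\<Sum>z\<in>Q. norm (T z)) = (\<Sum>z\<in>Q. norm (f (Sup (snd z)) - f (Inf (snd z))))"
    using bad by (intro sum.cong) (auto simp: T_def Q_def norm_minus_commute)
  finally show ?thesis by (simp add: Q_def)
qed

lemma fine_riemann_sum_error_less:
  fixes f v :: "real \<Rightarrow> 'a::real_normed_vector"
  assumes p: "p tagged_division_of {a..b}" and fine: "(\<lambda>s. ball s (d s)) fine p"
    and "a \<le> b" "\<eta> \<ge> 0"
    and good: "\<And>s l r. s \<in> {a..b} - N \<Longrightarrow> a \<le> l \<Longrightarrow> l \<le> s \<Longrightarrow> s \<le> r \<Longrightarrow> r \<le> b \<Longrightarrow>
      {l..r} \<subseteq> ball s (d s) \<Longrightarrow> norm ((r - l) *\<^sub>R v s - (f r - f l)) \<le> \<eta> * (r - l)"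
    and bad: "\<And>s. s \<in> N \<Longrightarrow> v s = 0" "\<And>s. s \<in> N \<Longrightarrow> ball s (d s) \<subseteq> W"
    and variation: "\<And>(J :: (real \<times> real set) set) l r. interval_family a b J l r \<Longrightarrow>
      (\<Union>i\<in>J. {l i<..<r i}) \<subseteq> W \<Longrightarrow> (\<Sum>i\<in>J. norm (f (r i) - f (l i))) < \<epsilon>"
  shows "norm ((\<Sum>(s, k)\<in>p. measure lborel k *\<^sub>R v s) - (f b - f a)) < \<eta> * (b - a) + \<epsilon>"
proof -
  have ball: "{Inf k..Sup k} \<subseteq> ball s (d s)" if "(s, k) \<in> p" for s k
    using fineD[OF fine that] tagged_division_of_interval(1)[OF p that] by simp
  let ?Q = "{z \<in> p. fst z \<in> N}"
  have family: "interval_family a b ?Q (\<lambda>z. Inf (snd z)) (\<lambda>z. Sup (snd z))"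
    by (rule interval_family_subset[OF interval_family_tagged_division[OF p]]) auto
  have "(\<Union>z\<in>?Q. {Inf (snd z)<..<Sup (snd z)}) \<subseteq> W"
    using ball bad(2) by fastforce
  then have "(\<Sum>z\<in>?Q. norm (f (Sup (snd z)) - f (Inf (snd z)))) < \<epsilon>"
    by (rule variation[OF family])
  moreover have "norm ((Sup k - Inf k) *\<^sub>R v s - (f (Sup k) - f (Inf k))) \<le> \<eta> * (Sup k - Inf k)"
    if "(s, k) \<in> p" "s \<notin> N" for s k
    using good[of s "Inf k" "Sup k"] ball[OF that(1)]
      tagged_division_of_interval(2-5)[OF p that(1)] that(2) by simp
  from riemann_sum_error_le[OF p \<open>a \<le> b\<close> \<open>\<eta> \<ge> 0\<close> this bad(1)]
  have "norm ((\<Sum>(s, k)\<in>p. measure lborel k *\<^sub>R v s) - (f b - f a))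
      \<le> \<eta> * (b - a) + (\<Sum>z\<in>?Q. norm (f (Sup (snd z)) - f (Inf (snd z))))"
    by simp
  ultimately show ?thesis by simp
qed

theorem ac_derivative_has_integral:
  fixes f :: "real \<Rightarrow> 'a::real_normed_vector"
  assumes f: "ac_derivative a b f f'" and "a \<le> b"
  shows "(f' has_integral f b - f a) {a..b}"
proof -
  obtain N where ac: "abs_cont_on a b f" and N: "negligible N"
    and deriv: "\<And>s. s \<in> {a..b} - N \<Longrightarrow> (f has_vector_derivative f' s) (at s within {a..b})"
    using f unfolding ac_derivative_def by blast
  define v where "v s = (if s \<in> N then 0 else f' s)" for s
  have deriv_v: "(f has_vector_derivative v s) (at s within {a..b})" if "s \<in> {a..b} - N" for s
    using deriv[OF that] that by (simp add: v_def)
  have "\<exists>\<gamma>. gauge \<gamma> \<and> (\<forall>p. p tagged_division_of {a..b} \<and> \<gamma> fine p \<longrightarrow>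
      norm ((\<Sum>(s, k)\<in>p. measure lborel k *\<^sub>R v s) - (f b - f a)) < e)" if e: "e > 0" for e
  proof -
    obtain W where W: "open W" "N \<subseteq> W"
      and variation: "\<And>(J :: (real \<times> real set) set) l r. interval_family a b J l r \<Longrightarrow>
        (\<Union>i\<in>J. {l i<..<r i}) \<subseteq> W \<Longrightarrow> (\<Sum>i\<in>J. norm (f (r i) - f (l i))) < e / 2"
      using abs_cont_on_small_variation_near_negligible[OF ac N half_gt_zero[OF e]] by blast
    define \<eta> where "\<eta> = e / (2 * (b - a + 1))"
    have \<eta>: "\<eta> > 0" "\<eta> * (b - a) < e / 2" using e \<open>a \<le> b\<close> by (auto simp: \<eta>_def field_simps)
    obtain d where d: "\<And>s. d s > 0" "\<And>s. s \<in> N \<Longrightarrow> ball s (d s) \<subseteq> W"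
      "\<And>s l r. s \<in> {a..b} - N \<Longrightarrow> a \<le> l \<Longrightarrow> l \<le> s \<Longrightarrow> s \<le> r \<Longrightarrow> r \<le> b \<Longrightarrow> {l..r} \<subseteq> ball s (d s) \<Longrightarrow>
         norm ((r - l) *\<^sub>R v s - (f r - f l)) \<le> \<eta> * (r - l)"
      using derivative_gauge[OF deriv_v W \<eta>(1)] by metis
    have zero: "v s = 0" if "s \<in> N" for s using that by (simp add: v_def)
    have "norm ((\<Sum>(s, k)\<in>p. measure lborel k *\<^sub>R v s) - (f b - f a)) < e"
      if "p tagged_division_of {a..b}" "(\<lambda>s. ball s (d s)) fine p" for p
    proof -
      have "norm ((\<Sum>(s, k)\<in>p. measure lborel k *\<^sub>R v s) - (f b - f a)) < \<eta> * (b - a) + e / 2"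
        by (rule fine_riemann_sum_error_less[OF that \<open>a \<le> b\<close> less_imp_le[OF \<eta>(1)] d(3) zero d(2)
              variation])
      then show ?thesis using \<eta>(2) by simp
    qed
    then show ?thesis
      using d(1) by (intro exI[of _ "\<lambda>s. ball s (d s)"]) (simp add: gauge_ball_dependent)
  qed
  then have "(v has_integral f b - f a) {a..b}" by (simp add: has_integral_real)
  then show ?thesis
    by (rule has_integral_spike[OF N, rotated]) (simp add: v_def)
qed

lemma ac_derivative_integrable_on:
  assumes "ac_derivative a b f f'" "a \<le> c" "c \<le> d" "d \<le> b"
  shows "f' integrable_on {c..d}" "integral {c..d} f' = f d - f c"
  using ac_derivative_has_integral[OF ac_derivative_subinterval[OF assms(1,2,4)] assms(3)]
  by (auto simp: has_integral_iff)

lemma ac_derivative_absolutely_integrable: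
  fixes f :: "real \<Rightarrow> 'a::euclidean_space"
  assumes f: "ac_derivative a b f f'" and "a \<le> b"
  shows "f' absolutely_integrable_on {a..b}"
proof -
  have ac: "abs_cont_on a b f" using f by (simp add: ac_derivative_def)
  obtain \<delta> where \<delta>: "\<delta> > 0" and variation: "\<And>(J :: real set set) l r. interval_family a b J l r \<Longrightarrow>
      (\<Sum>i\<in>J. r i - l i) < \<delta> \<Longrightarrow> (\<Sum>i\<in>J. norm (f (r i) - f (l i))) < 1"
    using abs_cont_on_interval_family[OF ac zero_less_one] by metis
  have short: "f' absolutely_integrable_on {c..d}" if cd: "a \<le> c" "c \<le> d" "d \<le> b" "d - c < \<delta>"
    for c d
    unfolding box_real[symmetric]
  proof (rule bounded_variation_absolutely_integrable_interval)
    show "f' integrable_on cbox c d" using ac_derivative_integrable_on(1)[OF f cd(1-3)] by simp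
    fix \<D> assume "\<D> division_of cbox c d"
    then have family: "interval_family c d \<D> Inf Sup" and "\<D> division_of {c..d}"
      by (simp_all add: interval_family_division)
    have "integral K f' = f (Sup K) - f (Inf K)" if "K \<in> \<D>" for K
      using division_of_interval[OF \<open>\<D> division_of {c..d}\<close> that] cd
        ac_derivative_integrable_on(2)[OF f, of "Inf K" "Sup K"] by (metis order_trans)
    moreover have "interval_family a b \<D> Inf Sup"
      using family cd by (fastforce simp: interval_family_def)
    moreover have "(\<Sum>K\<in>\<D>. Sup K - Inf K) < \<delta>"
      using sum_length_interval_family_le[OF family, of "{c..d}"] interval_familyD[OF family] cd
      by force
    ultimately show "(\<Sum>K\<in>\<D>. norm (integral K f')) \<le> 1"
      using variation by (fastforce intro: less_imp_le)
  qed
  let ?P = "\<lambda>c d. a \<le> c \<longrightarrow> d \<le> b \<longrightarrow> f' absolutely_integrable_on {c..d}"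
  have "?P a b"
  proof (rule Bolzano[of a b ?P])
    show "?P c e" if "?P c d" "?P d e" "c \<le> d" "d \<le> e" for c d e
      using that by (auto intro: absolutely_integrable_on_combine)
    show "\<exists>\<epsilon>>0. \<forall>c d. c \<le> s \<and> s \<le> d \<and> d - c < \<epsilon> \<longrightarrow> ?P c d" for s
      using \<delta> short by (intro exI[of _ \<delta>]) auto
  qed (rule \<open>a \<le> b\<close>)
  then show ?thesis by simp
qed

lemma ac_derivative_unique:
  assumes "ac_derivative a b f h" "ac_derivative a b g h" "f c = g c" "c \<in> {a..b}" "s \<in> {a..b}"
  shows "f s = g s"
proof (cases "c \<le> s")
  case True
  then show ?thesis
    using ac_derivative_integrable_on(2)[OF assms(1), of c s]
      ac_derivative_integrable_on(2)[OF assms(2), of c s]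
      assms(3-5) by simp
next
  case False
  then show ?thesis
    using ac_derivative_integrable_on(2)[OF assms(1), of s c]
      ac_derivative_integrable_on(2)[OF assms(2), of s c]
      assms(3-5) by simp
qed

lemma ac_derivative_spike:
  assumes "ac_derivative a b f f'" "negligible N" "\<And>s. s \<in> {a..b} - N \<Longrightarrow> g s = f' s"
  shows "ac_derivative a b f g"
proof -
  obtain M where M: "abs_cont_on a b f" "negligible M"
    "\<And>s. s \<in> {a..b} - M \<Longrightarrow> (f has_vector_derivative f' s) (at s within {a..b})"
    using assms(1) unfolding ac_derivative_def by blast
  then have "negligible (M \<union> N)"
    "\<forall>s\<in>{a..b} - (M \<union> N). (f has_vector_derivative g s) (at s within {a..b})"
    using assms(2,3) by auto
  then show ?thesis using M(1) unfolding ac_derivative_def by blast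
qed

lemma ac_derivative_combine:
  assumes f: "ac_derivative a b f f'" and g: "ac_derivative a b g g'"
    and bound: "\<And>s t. a \<le> s \<Longrightarrow> s \<le> t \<Longrightarrow> t \<le> b \<Longrightarrow>
      norm (h t - h s) \<le> C * (norm (f t - f s) + norm (g t - g s))"
    and deriv: "\<And>s. s \<in> {a..b} \<Longrightarrow> (f has_vector_derivative f' s) (at s within {a..b}) \<Longrightarrow>
      (g has_vector_derivative g' s) (at s within {a..b}) \<Longrightarrow>
      (h has_vector_derivative h' s) (at s within {a..b})"
  shows "ac_derivative a b h h'"
proof -
  obtain M where M: "negligible M"
    "\<And>s. s \<in> {a..b} - M \<Longrightarrow> (f has_vector_derivative f' s) (at s within {a..b})"
    using f unfolding ac_derivative_def by blast
  obtain N where N: "negligible N"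
    "\<And>s. s \<in> {a..b} - N \<Longrightarrow> (g has_vector_derivative g' s) (at s within {a..b})"
    using g unfolding ac_derivative_def by blast
  have "abs_cont_on a b h"
    using f g by (intro abs_cont_on_compare[OF _ _ bound]) (auto simp: ac_derivative_def)
  moreover have "negligible (M \<union> N)" using M(1) N(1) by simp
  moreover have "(h has_vector_derivative h' s) (at s within {a..b})" if "s \<in> {a..b} - (M \<union> N)"
    for s
    using that by (intro deriv M(2) N(2)) auto
  ultimately show ?thesis unfolding ac_derivative_def by blast
qed

lemma ac_derivative_add:
  assumes "ac_derivative a b f f'" "ac_derivative a b g g'"
  shows "ac_derivative a b (\<lambda>s. f s + g s) (\<lambda>s. f' s + g' s)"
proof (rule ac_derivative_combine[OF assms])
  show "norm (f t + g t - (f s + g s)) \<le> 1 * (norm (f t - f s) + norm (g t - g s))" for s t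
    using norm_triangle_ineq[of "f t - f s" "g t - g s"] by (simp add: algebra_simps)
qed (rule has_vector_derivative_add)

lemma ac_derivative_bounded_linear:
  assumes h: "bounded_linear h" and f: "ac_derivative a b f f'"
  shows "ac_derivative a b (\<lambda>s. h (f s)) (\<lambda>s. h (f' s))"
proof -
  obtain K where K: "K \<ge> 0" "\<And>x. norm (h x) \<le> norm x * K"
    using bounded_linear.nonneg_bounded[OF h] by blast
  have "norm (h (f t) - h (f s)) \<le> K * (norm (f t - f s) + norm (f t - f s))" for s t
    using K(2)[of "f t - f s"] mult_nonneg_nonneg[OF K(1) norm_ge_zero, of "f t - f s"]
    by (simp add: linear_diff[OF bounded_linear.linear[OF h]] distrib_left mult.commute)
  then show ?thesis
    by (rule ac_derivative_combine[OF f f]) (intro bounded_linear.has_vector_derivative[OF h])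
qed

lemma ac_derivative_bounded_bilinear:
  assumes h: "bounded_bilinear h" and f: "ac_derivative a b f f'" and g: "ac_derivative a b g g'"
  shows "ac_derivative a b (\<lambda>s. h (f s) (g s)) (\<lambda>s. h (f s) (g' s) + h (f' s) (g s))"
proof -
  interpret bounded_bilinear h by (rule h)
  have "bounded (f ` {a..b})" "bounded (g ` {a..b})"
    using f g by (auto intro!: compact_imp_bounded compact_continuous_image
        abs_cont_on_imp_continuous_on simp: ac_derivative_def)
  then obtain B1 B2 where B: "\<And>s. s \<in> {a..b} \<Longrightarrow> norm (f s) \<le> B1" "\<And>s. s \<in> {a..b} \<Longrightarrow> norm (g s) \<le> B2"
    unfolding bounded_iff by (metis imageI)
  obtain K where K: "K \<ge> 0" "\<And>x y. norm (h x y) \<le> norm x * norm y * K" using nonneg_bounded by blast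
  define B where "B = max B1 B2"
  show ?thesis
  proof (rule ac_derivative_combine[OF f g])
    fix s t assume st: "a \<le> s" "s \<le> t" "t \<le> b"
    have "h (f t) (g t) - h (f s) (g s) = h (f t) (g t - g s) + h (f t - f s) (g s)"
      by (simp add: diff_left diff_right)
    also have "norm \<dots> \<le> norm (f t) * norm (g t - g s) * K + norm (f t - f s) * norm (g s) * K"
      by (intro norm_triangle_mono K(2))
    also have "\<dots> \<le> B * norm (g t - g s) * K + norm (f t - f s) * B * K"
      using B(1)[of t] B(2)[of s] st K(1)
      by (intro add_mono mult_right_mono mult_left_mono) (auto simp: B_def max_def)
    finally show "norm (h (f t) (g t) - h (f s) (g s))
        \<le> (B * K) * (norm (f t - f s) + norm (g t - g s))"
      by (simp add: algebra_simps)
  qed (rule has_vector_derivative)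
qed

lemma ac_derivative_compose:
  fixes G :: "real \<Rightarrow> 'a::real_normed_vector"
  assumes \<sigma>: "ac_derivative a b \<sigma> u" and range: "\<sigma> ` {a..b} \<subseteq> {c..d}"
    and G: "\<And>r. r \<in> {c..d} \<Longrightarrow> (G has_vector_derivative G' r) (at r within {c..d})"
    and G': "continuous_on {c..d} G'"
  shows "ac_derivative a b (\<lambda>s. G (\<sigma> s)) (\<lambda>s. u s *\<^sub>R G' (\<sigma> s))"
proof -
  have "bounded (G' ` {c..d})"
    by (rule compact_imp_bounded[OF compact_continuous_image[OF G' compact_Icc]])
  then obtain B where B: "B > 0" "\<And>r. r \<in> {c..d} \<Longrightarrow> norm (G' r) \<le> B"
    unfolding bounded_pos by auto
  have lipschitz: "norm (G q - G p) \<le> B * norm (q - p)" if "p \<in> {c..d}" "q \<in> {c..d}" for p q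
  proof (rule differentiable_bound[of "{c..d}" G "\<lambda>r x. x *\<^sub>R G' r"])
    show "(G has_derivative (\<lambda>x. x *\<^sub>R G' r)) (at r within {c..d})" if "r \<in> {c..d}" for r
      using G[OF that] by (simp add: has_vector_derivative_def)
    show "onorm (\<lambda>x. x *\<^sub>R G' r) \<le> B" if "r \<in> {c..d}" for r
      using B(2)[OF that] by (simp add: onorm_scaleR_left onorm_id)
  qed (use that in auto)
  show ?thesis
  proof (rule ac_derivative_combine[OF \<sigma> \<sigma>])
    show "norm (G (\<sigma> t) - G (\<sigma> s)) \<le> B * (norm (\<sigma> t - \<sigma> s) + norm (\<sigma> t - \<sigma> s))"
      if "a \<le> s" "s \<le> t" "t \<le> b" for s t
      using lipschitz[of "\<sigma> s" "\<sigma> t"] range that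
        mult_nonneg_nonneg[OF less_imp_le[OF B(1)] norm_ge_zero, of "\<sigma> t - \<sigma> s"]
      by (simp add: distrib_left image_subset_iff)
    show "((\<lambda>s. G (\<sigma> s)) has_vector_derivative u s *\<^sub>R G' (\<sigma> s)) (at s within {a..b})"
      if "s \<in> {a..b}" "(\<sigma> has_vector_derivative u s) (at s within {a..b})" for s
    proof -
      have "(G has_vector_derivative G' (\<sigma> s)) (at (\<sigma> s) within \<sigma> ` {a..b})"
        by (rule has_vector_derivative_within_subset[OF G[OF subsetD[OF range imageI[OF that(1)]]]
            range])
      from vector_diff_chain_within[OF that(2) this] show ?thesis by (simp add: o_def)
    qed
  qed
qed

lemma ac_derivative_of_C1:
  assumes "\<And>s. s \<in> {a..b} \<Longrightarrow> (f has_vector_derivative f' s) (at s within {a..b})"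
    "continuous_on {a..b} f'"
  shows "ac_derivative a b f f'"
proof -
  have "ac_derivative a b (\<lambda>s. s) (\<lambda>_. 1)"
    by (auto simp: ac_derivative_def abs_cont_on_ident intro!: exI[of _ "{}"] derivative_eq_intros)
  from ac_derivative_compose[OF this _ assms] show ?thesis by simp
qed

subsection \<open>Indefinite integrals\<close>

lemma integral_increment:
  fixes f :: "real \<Rightarrow> 'a::euclidean_space"
  assumes "f integrable_on {a..b}" "a \<le> s" "s \<le> t" "t \<le> b"
  shows "integral {a..t} f - integral {a..s} f = integral {s..t} f"
proof -
  have "f integrable_on {a..t}" using assms by (intro integrable_on_subinterval[OF assms(1)]) auto
  then show ?thesis
    using Henstock_Kurzweil_Integration.integral_combine[OF assms(2,3), of f]
    by (simp add: algebra_simps)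
qed

lemma integral_truncation_error_small:
  fixes f :: "real \<Rightarrow> real"
  assumes f: "f absolutely_integrable_on {a..b}" and nonneg: "\<And>s. s \<in> {a..b} \<Longrightarrow> f s \<ge> 0" and "\<epsilon> > 0"
  obtains n where "(\<lambda>s. max (f s - real n) 0) integrable_on {a..b}"
    "integral {a..b} (\<lambda>s. max (f s - real n) 0) < \<epsilon>"
proof -
  have int: "(\<lambda>s. max (f s - real n) 0) integrable_on {a..b}" for n
    by (intro set_lebesgue_integral_eq_integral absolutely_integrable_max_1 set_integral_diff f)
      auto
  have "(\<lambda>n. integral {a..b} (\<lambda>s. max (f s - real n) 0)) \<longlonglongrightarrow> integral {a..b} (\<lambda>_. 0)"
  proof (rule dominated_convergence(2)[where h = f])
    show "(\<lambda>n. max (f s - real n) 0) \<longlonglongrightarrow> 0" for s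
    proof (rule tendsto_eventually)
      obtain n where "f s \<le> real n" using real_arch_simple by blast
      then have "max (f s - real m) 0 = 0" if "m \<ge> n" for m using that by simp
      then show "\<forall>\<^sub>F m in sequentially. max (f s - real m) 0 = 0"
        by (auto simp: eventually_sequentially)
    qed
  qed (use int f nonneg in \<open>auto simp: absolutely_integrable_on_def\<close>)
  then have "\<forall>\<^sub>F n in sequentially. integral {a..b} (\<lambda>s. max (f s - real n) 0) < \<epsilon>"
    using \<open>\<epsilon> > 0\<close> by (intro order_tendstoD(2)) simp_all
  then obtain n where "integral {a..b} (\<lambda>s. max (f s - real n) 0) < \<epsilon>"
    by (auto simp: eventually_sequentially)
  with int show thesis by (rule that)
qed

lemma integral_le_integral_truncation_error:
  fixes f :: "real \<Rightarrow> real"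
  assumes "f integrable_on {a..b}" "(\<lambda>s. max (f s - c) 0) integrable_on {a..b}" "a \<le> b"
  shows "integral {a..b} f \<le> integral {a..b} (\<lambda>s. max (f s - c) 0) + c * (b - a)"
proof -
  have "integral {a..b} f \<le> integral {a..b} (\<lambda>s. max (f s - c) 0 + c)"
    using assms by (intro integral_le integrable_add) auto
  also have "\<dots> = integral {a..b} (\<lambda>s. max (f s - c) 0) + c * (b - a)"
    using assms(2,3) by (subst Henstock_Kurzweil_Integration.integral_add) auto
  finally show ?thesis .
qed

lemma sum_integral_interval_family_le:
  fixes f :: "real \<Rightarrow> real"
  assumes J: "interval_family a b J l r"
    and f: "f integrable_on {a..b}" "\<And>s. s \<in> {a..b} \<Longrightarrow> f s \<ge> 0"
  shows "(\<Sum>i\<in>J. integral {l i..r i} f) \<le> integral {a..b} f"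
proof (rule has_integral_subset_le)
  show "(\<Union>i\<in>J. {l i<..<r i}) \<subseteq> {a..b}" using interval_familyD(2-4)[OF J] by fastforce
  show "(f has_integral (\<Sum>i\<in>J. integral {l i..r i} f)) (\<Union>i\<in>J. {l i<..<r i})"
    using interval_familyD(2-4)[OF J]
    by (intro has_integral_interval_family[OF J] integrable_on_subinterval[OF f(1)]) auto
  show "(f has_integral integral {a..b} f) {a..b}" using f(1) by (rule integrable_integral)
qed (use f(2) in blast)

lemma abs_cont_on_indefinite_integral_nonneg:
  fixes f :: "real \<Rightarrow> real"
  assumes f: "f absolutely_integrable_on {a..b}" and nonneg: "\<And>s. s \<in> {a..b} \<Longrightarrow> f s \<ge> 0"
  shows "abs_cont_on a b (\<lambda>s. integral {a..s} f)"
proof (rule abs_cont_onI)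
  fix \<epsilon> :: real assume \<epsilon>: "\<epsilon> > 0"
  obtain n where "(\<lambda>s. max (f s - real n) 0) integrable_on {a..b}"
    "integral {a..b} (\<lambda>s. max (f s - real n) 0) < \<epsilon> / 2"
    using integral_truncation_error_small[OF f nonneg half_gt_zero[OF \<epsilon>]] by blast
  moreover define g where "g = (\<lambda>s. max (f s - real n) 0)"
  ultimately have g: "g integrable_on {a..b}" "integral {a..b} g < \<epsilon> / 2" by simp_all
  have fi: "f integrable_on {a..b}" using f by (rule set_lebesgue_integral_eq_integral)
  define \<delta> where "\<delta> = \<epsilon> / (2 * (real n + 1))"
  have \<delta>: "\<delta> > 0" "real n * \<delta> \<le> \<epsilon> / 2" using \<epsilon> by (auto simp: \<delta>_def field_simps)
  have increment: "norm (integral {a..t} f - integral {a..s} f)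
      \<le> integral {s..t} g + real n * (t - s)"
    if st: "a \<le> s" "s \<le> t" "t \<le> b" for s t
  proof -
    have sub: "{s..t} \<subseteq> {a..b}" using st by auto
    have "0 \<le> integral {s..t} f"
      using st nonneg by (intro integral_nonneg integrable_on_subinterval[OF fi sub]) auto
    then show ?thesis
      using integral_le_integral_truncation_error[OF integrable_on_subinterval[OF fi sub] _ st(2),
          of "real n"]
        integrable_on_subinterval[OF g(1) sub] integral_increment[OF fi st] by (simp add: g_def)
  qed
  have "(\<Sum>i\<in>J. norm (integral {a..r i} f - integral {a..l i} f)) < \<epsilon>"
    if J: "interval_family a b J l r" and small: "(\<Sum>i\<in>J. r i - l i) < \<delta>" for J :: "nat set" and l r
  proof -
    have "(\<Sum>i\<in>J. norm (integral {a..r i} f - integral {a..l i} f))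
        \<le> (\<Sum>i\<in>J. integral {l i..r i} g + real n * (r i - l i))"
      using interval_familyD(2-4)[OF J] by (intro sum_mono increment)
    moreover have "(\<Sum>i\<in>J. integral {l i..r i} g) \<le> integral {a..b} g"
      by (rule sum_integral_interval_family_le[OF J g(1)]) (simp add: g_def)
    moreover have "real n * (\<Sum>i\<in>J. r i - l i) \<le> real n * \<delta>"
      using small by (intro mult_left_mono) auto
    ultimately show ?thesis using g(2) \<delta>(2) by (simp add: sum.distrib sum_distrib_left)
  qed
  then show "\<exists>\<delta>>0. \<forall>(J :: nat set) l r. interval_family a b J l r \<longrightarrow> (\<Sum>i\<in>J. r i - l i) < \<delta> \<longrightarrow>
      (\<Sum>i\<in>J. norm (integral {a..r i} f - integral {a..l i} f)) < \<epsilon>"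
    using \<delta>(1) by blast
qed

lemma negligible_uminus_image:
  assumes "negligible (N :: real set)"
  shows "negligible (uminus ` N)"
  using negligible_differentiable_image_negligible[OF _ assms, of uminus]
  by (simp add: differentiable_on_minus differentiable_on_ident)

lemma right_average_tendsto_ae:
  fixes f :: "real \<Rightarrow> 'a::euclidean_space"
  assumes f: "\<And>a b. f integrable_on {a..b}"
  obtains N where "negligible N"
    "\<And>s e. s \<notin> N \<Longrightarrow> e > 0 \<Longrightarrow> \<exists>d>0. \<forall>h. 0 < h \<and> h < d \<longrightarrow> norm (integral {s..s + h} f /\<^sub>R h - f s) < e"
proof (rule integrable_ccontinuous_explicit[of f])
  show "f integrable_on cbox a b" for a b using f by simp
qed (rule that, simp_all)

lemma left_average_tendsto_ae:
  fixes f :: "real \<Rightarrow> 'a::euclidean_space"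
  assumes f: "\<And>a b. f integrable_on {a..b}"
  obtains N where "negligible N"
    "\<And>s e. s \<notin> N \<Longrightarrow> e > 0 \<Longrightarrow> \<exists>d>0. \<forall>h. 0 < h \<and> h < d \<longrightarrow> norm (integral {s - h..s} f /\<^sub>R h - f s) < e"
proof (rule right_average_tendsto_ae[of "\<lambda>s. f (- s)"])
  show "(\<lambda>s. f (- s)) integrable_on {a..b}" for a b
    using Henstock_Kurzweil_Integration.integrable_reflect_real[of f "- a" "- b"] f by simp
  fix N assume N: "negligible N" and average: "\<And>s e. s \<notin> N \<Longrightarrow> e > 0 \<Longrightarrow>
      \<exists>d>0. \<forall>h. 0 < h \<and> h < d \<longrightarrow> norm (integral {s..s + h} (\<lambda>s. f (- s)) /\<^sub>R h - f (- s)) < e"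
  show thesis
  proof
    show "negligible (uminus ` N)" using N by (rule negligible_uminus_image)
    fix s e :: real assume "s \<notin> uminus ` N" "e > 0"
    then have "- s \<notin> N" by (metis image_eqI minus_minus)
    moreover have "integral {- s..- s + h} (\<lambda>s. f (- s)) = integral {s - h..s} f" for h
      using Henstock_Kurzweil_Integration.integral_reflect_real[of s "s - h" f] by simp
    ultimately show "\<exists>d>0. \<forall>h. 0 < h \<and> h < d \<longrightarrow> norm (integral {s - h..s} f /\<^sub>R h - f s) < e"
      using average[of "- s" e] \<open>e > 0\<close> by simp
  qed
qed

lemma has_vector_derivative_indefinite_integral_of_averages:
  fixes f :: "real \<Rightarrow> 'a::euclidean_space"
  assumes f: "f integrable_on {a..b}" and s: "s \<in> {a..b}"
    and right: "\<And>e. e > 0 \<Longrightarrow> \<exists>d>0. \<forall>h. 0 < h \<and> h < d \<and> s + h \<le> b \<longrightarrow>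
      norm (integral {s..s + h} f /\<^sub>R h - f s) < e"
    and left: "\<And>e. e > 0 \<Longrightarrow> \<exists>d>0. \<forall>h. 0 < h \<and> h < d \<and> a \<le> s - h \<longrightarrow>
      norm (integral {s - h..s} f /\<^sub>R h - f s) < e"
  shows "((\<lambda>s. integral {a..s} f) has_vector_derivative f s) (at s within {a..b})"
  unfolding has_vector_derivative_iff_quotient
proof (rule tendstoI)
  fix e :: real assume e: "e > 0"
  obtain d1 where d1: "d1 > 0"
    "\<And>h. 0 < h \<Longrightarrow> h < d1 \<Longrightarrow> s + h \<le> b \<Longrightarrow> norm (integral {s..s + h} f /\<^sub>R h - f s) < e"
    using right[OF e] by blast
  obtain d2 where d2: "d2 > 0"
    "\<And>h. 0 < h \<Longrightarrow> h < d2 \<Longrightarrow> a \<le> s - h \<Longrightarrow> norm (integral {s - h..s} f /\<^sub>R h - f s) < e"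
    using left[OF e] by blast
  have "dist ((integral {a..t} f - integral {a..s} f) /\<^sub>R (t - s)) (f s) < e"
    if t: "t \<in> {a..b}" "t \<noteq> s" "dist t s < min d1 d2" for t
  proof (cases "s < t")
    case True
    then show ?thesis
      using d1(2)[of "t - s"] integral_increment[OF f, of s t] t s
      by (simp add: dist_norm dist_real_def)
  next
    case False
    then have "integral {a..s} f - integral {a..t} f = integral {t..s} f"
      using integral_increment[OF f, of t s] t s by simp
    then have "(integral {a..t} f - integral {a..s} f) /\<^sub>R (t - s) = integral {t..s} f /\<^sub>R (s - t)"
      by (metis inverse_minus_eq minus_diff_eq scaleR_minus_left scaleR_minus_right)
    then show ?thesis
      using d2(2)[of "s - t"] False t s by (simp add: dist_norm dist_real_def)
  qed
  then show "\<forall>\<^sub>F t in at s within {a..b}.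
      dist ((integral {a..t} f - integral {a..s} f) /\<^sub>R (t - s)) (f s) < e"
    using d1(1) d2(1) unfolding eventually_at by (intro exI[of _ "min d1 d2"]) auto
qed

theorem indefinite_integral_has_vector_derivative_ae:
  fixes f :: "real \<Rightarrow> 'a::euclidean_space"
  assumes f: "f integrable_on {a..b}"
  obtains N where "negligible N"
    "\<And>s. s \<in> {a..b} - N \<Longrightarrow> ((\<lambda>s. integral {a..s} f) has_vector_derivative f s) (at s within {a..b})"
proof -
  define g where "g = (\<lambda>s. if s \<in> {a..b} then f s else 0)"
  have g: "g integrable_on {c..d}" for c d
    unfolding g_def integrable_restrict_Int Int_atLeastAtMost
    by (rule integrable_on_subinterval[OF f]) auto
  have restrict: "integral {s..t} g = integral {s..t} f" if "a \<le> s" "t \<le> b" for s t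
    using that by (intro Henstock_Kurzweil_Integration.integral_cong) (auto simp: g_def)
  obtain M where M: "negligible M" and right: "\<And>s e. s \<notin> M \<Longrightarrow> e > 0 \<Longrightarrow>
      \<exists>d>0. \<forall>h. 0 < h \<and> h < d \<longrightarrow> norm (integral {s..s + h} g /\<^sub>R h - g s) < e"
    using right_average_tendsto_ae[OF g] by blast
  obtain N where N: "negligible N" and left: "\<And>s e. s \<notin> N \<Longrightarrow> e > 0 \<Longrightarrow>
      \<exists>d>0. \<forall>h. 0 < h \<and> h < d \<longrightarrow> norm (integral {s - h..s} g /\<^sub>R h - g s) < e"
    using left_average_tendsto_ae[OF g] by blast
  have "((\<lambda>s. integral {a..s} f) has_vector_derivative f s) (at s within {a..b})"
    if s: "s \<in> {a..b} - (M \<union> N)" for s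
  proof (rule has_vector_derivative_indefinite_integral_of_averages[OF f])
    have gs: "g s = f s" using s by (simp add: g_def)
    fix e :: real assume e: "e > 0"
    obtain d where "d > 0" "\<And>h. 0 < h \<Longrightarrow> h < d \<Longrightarrow> norm (integral {s..s + h} g /\<^sub>R h - g s) < e"
      using right[of s e] s e by blast
    then show "\<exists>d>0. \<forall>h. 0 < h \<and> h < d \<and> s + h \<le> b \<longrightarrow> norm (integral {s..s + h} f /\<^sub>R h - f s) < e"
      using s by (intro exI[of _ d]) (simp add: restrict[symmetric] gs[symmetric])
    obtain d where "d > 0" "\<And>h. 0 < h \<Longrightarrow> h < d \<Longrightarrow> norm (integral {s - h..s} g /\<^sub>R h - g s) < e"
      using left[of s e] s e by blast
    then show "\<exists>d>0. \<forall>h. 0 < h \<and> h < d \<and> a \<le> s - h \<longrightarrow> norm (integral {s - h..s} f /\<^sub>R h - f s) < e"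
      using s by (intro exI[of _ d]) (simp add: restrict[symmetric] gs[symmetric])
  qed (use s in auto)
  with M N show thesis by (intro that[of "M \<union> N"]) auto
qed

theorem ac_derivative_indefinite_integral:
  fixes f :: "real \<Rightarrow> 'a::euclidean_space"
  assumes f: "f absolutely_integrable_on {a..b}"
  shows "ac_derivative a b (\<lambda>s. integral {a..s} f) f"
proof -
  have norm_f: "(\<lambda>s. norm (f s)) absolutely_integrable_on {a..b}"
    using absolutely_integrable_norm[OF f] by (simp add: o_def)
  have variation: "abs_cont_on a b (\<lambda>s. integral {a..s} (\<lambda>r. norm (f r)))"
    using norm_f by (rule abs_cont_on_indefinite_integral_nonneg) simp
  have "abs_cont_on a b (\<lambda>s. integral {a..s} f)"
  proof (rule abs_cont_on_compare[OF variation variation, where C = 1])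
    fix s t assume st: "a \<le> s" "s \<le> t" "t \<le> b"
    have int: "f integrable_on {a..b}" "(\<lambda>r. norm (f r)) integrable_on {a..b}"
      using f norm_f by (auto simp: absolutely_integrable_on_def)
    have "norm (integral {s..t} f) \<le> integral {s..t} (\<lambda>r. norm (f r))"
      using st int by (intro Henstock_Kurzweil_Integration.integral_norm_bound_integral)
        (auto intro: integrable_on_subinterval)
    then show "norm (integral {a..t} f - integral {a..s} f)
        \<le> 1 * (norm (integral {a..t} (\<lambda>r. norm (f r)) - integral {a..s} (\<lambda>r. norm (f r)))
          + norm (integral {a..t} (\<lambda>r. norm (f r)) - integral {a..s} (\<lambda>r. norm (f r))))"
      by (simp add: integral_increment[OF int(1) st] integral_increment[OF int(2) st])
  qed
  moreover obtain N where "negligible N"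
    "\<And>s. s \<in> {a..b} - N \<Longrightarrow> ((\<lambda>s. integral {a..s} f) has_vector_derivative f s) (at s within {a..b})"
    using indefinite_integral_has_vector_derivative_ae f by (metis absolutely_integrable_on_def)
  ultimately show ?thesis unfolding ac_derivative_def by blast
qed

lemma has_integral_0_nonneg_imp_negligible:
  fixes f :: "real \<Rightarrow> real"
  assumes "(f has_integral 0) S" "\<And>s. s \<in> S \<Longrightarrow> f s \<ge> 0"
  shows "negligible {s\<in>S. f s \<noteq> 0}"
proof -
  have a: "f absolutely_integrable_on S"
    using assms by (intro nonnegative_absolutely_integrable_1) auto
  then have i: "integrable lebesgue (\<lambda>s. indicator S s *\<^sub>R f s)" by (simp add: set_integrable_def)
  have "integral\<^sup>L lebesgue (\<lambda>s. indicator S s *\<^sub>R f s) = 0"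
    using set_lebesgue_integral_eq_integral(2)[OF a] assms(1)
    by (simp add: set_lebesgue_integral_def integral_unique)
  then have "AE s in lebesgue. indicator S s *\<^sub>R f s = 0"
    using integral_nonneg_eq_0_iff_AE[OF i] assms(2) by (auto simp: indicator_def)
  then obtain N where N: "N \<in> null_sets lebesgue" "{s. indicator S s *\<^sub>R f s \<noteq> 0} \<subseteq> N"
    unfolding eventually_ae_filter by auto
  then have "negligible N" by (simp add: negligible_iff_null_sets)
  moreover have "{s\<in>S. f s \<noteq> 0} \<subseteq> N" using N(2) by (auto simp: indicator_def)
  ultimately show ?thesis using negligible_subset by blast
qed

subsection \<open>Normal geodesics\<close>

lemma bounded_linear_Ut: "bounded_linear (Ut U)"
  unfolding linear_conv_bounded_linear[symmetric] Ut_def[abs_def]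
  by (rule linearI) (simp_all add: scaleR_add_left sum.distrib scaleR_sum_right)

lemma OmegaD: "\<theta> \<in> Omega U \<Longrightarrow> onorm ((*v) (Ut U \<theta>)) < pi"
  by (simp add: Omega_def)

lemma skew_Ut:
  assumes "\<And>j. skew (U j)"
  shows "skew (Ut U \<tau>)"
  using assms unfolding skew_def Ut_def
  by (simp add: linear_sum[OF bounded_linear.linear[OF bounded_linear_transpose]] transpose_scalar
      sum_negf)

lemma bracket_inner: "bracket U x y \<bullet> \<tau> = (Ut U \<tau> *v x) \<bullet> y"
proof -
  have "Ut U \<tau> *v x = (\<Sum>j\<in>UNIV. \<tau> $ j *\<^sub>R (U j *v x))"
    unfolding Ut_def
    by (simp add: bounded_bilinear.sum_left[OF bounded_bilinear_matrix_vector_mult]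
        scaleR_matrix_vector_assoc)
  then show ?thesis
    by (simp add: bracket_def inner_vec_def[of "vec_lambda _"] inner_sum_left mult.commute)
qed

lemma bounded_bilinear_bracket: "bounded_bilinear (bracket U)"
  unfolding bilinear_conv_bounded_bilinear[symmetric] bilinear_def
  by (auto intro!: linearI simp: bracket_def vec_eq_iff inner_add_left inner_add_right
      matrix_vector_right_distrib matrix_vector_mult_scaleR)

lemmas continuous_on_bracket [continuous_intros] =
  bounded_bilinear.continuous_on[OF bounded_bilinear_bracket]

lemma continuous_on_ngz [continuous_intros]: "continuous_on S (ngz U \<zeta> \<theta>)"
  unfolding ngz_def[abs_def] by (intro continuous_intros)

lemma ngx_eq_mexp_int: "ngx U \<zeta> \<theta> s = mexp_int (Ut U \<theta>) s *v \<zeta>"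
  using has_integral_linear[OF mexp_int_has_integral
      bounded_bilinear.bounded_linear_left[OF bounded_bilinear_matrix_vector_mult, of \<zeta>],
      of "Ut U \<theta>" s]
  by (simp add: ngx_def ngz_def[abs_def] o_def integral_unique)

lemma ngx_0 [simp]: "ngx U \<zeta> \<theta> 0 = 0"
  by (simp add: ngx_def)

lemma ngz_eq: "s \<ge> 0 \<Longrightarrow> ngz U \<zeta> \<theta> s = \<zeta> + 2 *\<^sub>R (Ut U \<theta> *v ngx U \<zeta> \<theta> s)"
  by (simp add: ngz_def mexp_eq_mexp_int ngx_eq_mexp_int matrix_vector_mult_add_rdistrib
      scaleR_matrix_vector_assoc[symmetric] matrix_vector_mul_assoc[symmetric])

lemma ngx_has_vector_derivative:
  "s \<in> {0..1} \<Longrightarrow> (ngx U \<zeta> \<theta> has_vector_derivative ngz U \<zeta> \<theta> s) (at s within {0..1})"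
  unfolding ngx_def[abs_def] by (rule integral_has_vector_derivative[OF continuous_on_ngz])

lemma continuous_on_ngx [continuous_intros]: "continuous_on {0..1} (ngx U \<zeta> \<theta>)"
  unfolding ngx_eq_mexp_int[abs_def] by (intro continuous_intros) auto

lemma norm_ngz: "skew (Ut U \<theta>) \<Longrightarrow> norm (ngz U \<zeta> \<theta> s) = norm \<zeta>"
  by (simp add: ngz_def norm_mexp_mult)

lemma curve_length_ngz: "skew (Ut U \<theta>) \<Longrightarrow> curve_length (ngz U \<zeta> \<theta>) = norm \<zeta>"
  by (simp add: curve_length_def norm_ngz)

lemma normal_geodesic_snd_has_vector_derivative:
  "s \<in> {0..1} \<Longrightarrow> ((\<lambda>s. snd (normal_geodesic U \<zeta> \<theta> s)) has_vector_derivative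
     (1/2) *\<^sub>R bracket U (ngx U \<zeta> \<theta> s) (ngz U \<zeta> \<theta> s)) (at s within {0..1})"
  unfolding normal_geodesic_def snd_conv
  by (intro bounded_linear.has_vector_derivative[OF bounded_linear_scaleR_right]
      integral_has_vector_derivative continuous_intros)

lemma normal_geodesic_0: "normal_geodesic U \<zeta> \<theta> 0 = origin"
  by (simp add: normal_geodesic_def origin_def)

subsection \<open>Horizontal curves\<close>

definition horizontal_on ::
  "real \<Rightarrow> real \<Rightarrow> ('m \<Rightarrow> real^'q^'q) \<Rightarrow> (real \<Rightarrow> (real^'q) \<times> (real^'m)) \<Rightarrow> (real \<Rightarrow> real^'q) \<Rightarrow> bool" where
  "horizontal_on a b U \<gamma> v \<longleftrightarrow> ac_derivative a b (\<lambda>s. fst (\<gamma> s)) v \<and>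
     ac_derivative a b (\<lambda>s. snd (\<gamma> s)) (\<lambda>s. (1/2) *\<^sub>R bracket U (fst (\<gamma> s)) (v s))"

lemma horizontal_iff_horizontal_on: "horizontal U \<gamma> v \<longleftrightarrow> horizontal_on 0 1 U \<gamma> v"
proof
  assume "horizontal_on 0 1 U \<gamma> v"
  then obtain M N where M: "negligible M" "\<And>s. s \<in> {0..1} - M \<Longrightarrow>
        ((\<lambda>s. fst (\<gamma> s)) has_vector_derivative v s) (at s within {0..1})"
      and N: "negligible N" "\<And>s. s \<in> {0..1} - N \<Longrightarrow>
        ((\<lambda>s. snd (\<gamma> s)) has_vector_derivative (1/2) *\<^sub>R bracket U (fst (\<gamma> s)) (v s))
        (at s within {0..1})"
      and "abs_cont_on 0 1 (\<lambda>s. fst (\<gamma> s))" "abs_cont_on 0 1 (\<lambda>s. snd (\<gamma> s))"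
    unfolding horizontal_on_def ac_derivative_def by blast
  moreover have "negligible (M \<union> N)" using M(1) N(1) by simp
  ultimately show "horizontal U \<gamma> v" unfolding horizontal_def by blast
qed (unfold horizontal_def horizontal_on_def ac_derivative_def, blast)

lemma horizontal_on_subinterval:
  "horizontal_on a b U \<gamma> v \<Longrightarrow> a \<le> c \<Longrightarrow> d \<le> b \<Longrightarrow> horizontal_on c d U \<gamma> v"
  by (auto simp: horizontal_on_def intro: ac_derivative_subinterval)

lemma horizontal_normal_geodesic: "horizontal U (normal_geodesic U \<zeta> \<theta>) (ngz U \<zeta> \<theta>)"
  unfolding horizontal_iff_horizontal_on horizontal_on_def
proof
  have fst: "fst (normal_geodesic U \<zeta> \<theta> s) = ngx U \<zeta> \<theta> s" for s by (simp add: normal_geodesic_def)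
  show "ac_derivative 0 1 (\<lambda>s. fst (normal_geodesic U \<zeta> \<theta> s)) (ngz U \<zeta> \<theta>)"
    unfolding fst by (rule ac_derivative_of_C1[OF ngx_has_vector_derivative continuous_on_ngz])
  show "ac_derivative 0 1 (\<lambda>s. snd (normal_geodesic U \<zeta> \<theta> s))
      (\<lambda>s. (1/2) *\<^sub>R bracket U (fst (normal_geodesic U \<zeta> \<theta> s)) (ngz U \<zeta> \<theta> s))"
    unfolding fst
    by (rule ac_derivative_of_C1[OF normal_geodesic_snd_has_vector_derivative])
      (assumption, intro continuous_intros)
qed

definition arc_length :: "(real \<Rightarrow> real^'q) \<Rightarrow> real \<Rightarrow> real" where
  "arc_length v s = integral {0..s} (\<lambda>r. norm (v r))"

lemma arc_length_0 [simp]: "arc_length v 0 = 0"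
  by (simp add: arc_length_def)

lemma arc_length_1: "arc_length v 1 = curve_length v"
  by (simp add: arc_length_def curve_length_def)

lemma arc_length_ngz: "skew (Ut U \<theta>) \<Longrightarrow> s \<ge> 0 \<Longrightarrow> arc_length (ngz U \<zeta> \<theta>) s = s * norm \<zeta>"
  by (simp add: arc_length_def norm_ngz)

context
  fixes U :: "'m::finite \<Rightarrow> real^'q::finite^'q" and \<gamma> v a
  assumes h: "horizontal_on 0 a U \<gamma> v" and a: "0 \<le> a"
begin

lemma ac_derivative_arc_length: "ac_derivative 0 a (arc_length v) (\<lambda>s. norm (v s))"
proof -
  have "v absolutely_integrable_on {0..a}"
    using h a by (intro ac_derivative_absolutely_integrable) (auto simp: horizontal_on_def)
  then have "(\<lambda>s. norm (v s)) absolutely_integrable_on {0..a}"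
    using absolutely_integrable_norm by (fastforce simp: o_def)
  then show ?thesis
    unfolding arc_length_def[abs_def] by (rule ac_derivative_indefinite_integral)
qed

lemma arc_length_mono:
  assumes "0 \<le> r" "r \<le> s" "s \<le> a"
  shows "arc_length v r \<le> arc_length v s"
proof -
  have "0 \<le> arc_length v s - arc_length v r"
    using ac_derivative_has_integral[OF ac_derivative_subinterval[OF ac_derivative_arc_length
        assms(1,3)] assms(2)]
    by (rule has_integral_nonneg) simp
  then show ?thesis by simp
qed

lemma norm_fst_le_arc_length:
  assumes "\<gamma> 0 = origin" "0 \<le> s" "s \<le> a"
  shows "norm (fst (\<gamma> s)) \<le> arc_length v s"
proof -
  have "ac_derivative 0 s (\<lambda>s. fst (\<gamma> s)) v" "ac_derivative 0 s (arc_length v) (\<lambda>s. norm (v s))"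
    using h assms by (auto simp: horizontal_on_def intro: ac_derivative_subinterval
        ac_derivative_arc_length)
  from this[THEN ac_derivative_has_integral, OF assms(2)]
  have "(v has_integral fst (\<gamma> s)) {0..s}" "((\<lambda>s. norm (v s)) has_integral arc_length v s) {0..s}"
    using assms(1) by (simp_all add: origin_def)
  then show ?thesis
    using Henstock_Kurzweil_Integration.integral_norm_bound_integral[of v "{0..s}" "\<lambda>s. norm (v s)"]
    by (auto simp: has_integral_iff)
qed

lemma eq_origin_if_arc_length_0:
  assumes start: "\<gamma> 0 = origin" and zero: "arc_length v a = 0"
  shows "\<gamma> a = origin"
proof -
  have fst: "fst (\<gamma> s) = 0" if "s \<in> {0..a}" for s
  proof -
    have "norm (fst (\<gamma> s)) \<le> arc_length v a"
      using that by (intro order_trans[OF norm_fst_le_arc_length[OF start] arc_length_mono]) auto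
    then show ?thesis by (simp add: zero)
  qed
  have "(1/2) *\<^sub>R bracket U (fst (\<gamma> s)) (v s) = 0" if "s \<in> {0..a}" for s
    using fst[OF that] by (simp add: bounded_bilinear.zero_left[OF bounded_bilinear_bracket])
  moreover have "((\<lambda>s. (1/2) *\<^sub>R bracket U (fst (\<gamma> s)) (v s)) has_integral
      snd (\<gamma> a) - snd (\<gamma> 0)) {0..a}"
    using h a by (intro ac_derivative_has_integral) (auto simp: horizontal_on_def)
  ultimately have "((\<lambda>s. 0) has_integral snd (\<gamma> a) - snd (\<gamma> 0)) {0..a}"
    by (rule has_integral_eq)
  then show ?thesis using fst[of a] a start by (simp add: prod_eq_iff origin_def)
qed

end

subsection \<open>The calibration\<close>

text \<open>The horizontal gradient of the calibration is \<open>2 * geodesic_velocity\<close>, and its time derivative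
  is \<open>- |geodesic_velocity|\<^sup>2\<close>.\<close>

definition calibration :: "('m \<Rightarrow> real^'q^'q) \<Rightarrow> real^'m \<Rightarrow> real \<Rightarrow> (real^'q) \<times> (real^'m) \<Rightarrow> real" where
  "calibration U \<theta> s g = (mexp_int_inv (Ut U \<theta>) s *v fst g) \<bullet> fst g + 4 * (snd g \<bullet> \<theta>)"

lemma calibration_origin [simp]: "calibration U \<theta> s origin = 0"
  by (simp add: calibration_def origin_def)

lemma norm_minus_scaled_direction:
  fixes y v :: "'a::real_inner"
  assumes "w > 0"
  shows "w * norm v - (2 * (y \<bullet> v) - norm v / w * (norm y)\<^sup>2)
      = norm v / w * (norm (y - (w / norm v) *\<^sub>R v))\<^sup>2"
proof (cases "v = 0")
  case False
  have "(norm (y - (w / norm v) *\<^sub>R v))\<^sup>2 = (norm y)\<^sup>2 - 2 * (w / norm v) * (y \<bullet> v) + w\<^sup>2"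
    using False by (simp add: power2_norm_eq_inner inner_diff_left inner_diff_right inner_commute)
      (simp add: power2_norm_eq_inner[symmetric] power2_eq_square)
  then show ?thesis using False assms by (simp add: field_simps power2_eq_square)
qed simp

context
  fixes U :: "'m::finite \<Rightarrow> real^'q::finite^'q" and \<theta> :: "real^'m"
  assumes skew: "skew (Ut U \<theta>)" and \<theta>: "\<theta> \<in> Omega U"
begin

lemma phi_eq_calibration: "phi U g \<theta> = calibration U \<theta> 1 g"
  using phi_eq[OF skew invertible_mexp_int[OF skew OmegaD[OF \<theta>]], of "fst g" "snd g"]
  by (simp add: calibration_def)

lemma geodesic_velocity_ngx:
  "0 < s \<Longrightarrow> s \<le> 1 \<Longrightarrow> geodesic_velocity (Ut U \<theta>) s (ngx U \<zeta> \<theta> s) = ngz U \<zeta> \<theta> s"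
  by (simp add: geodesic_velocity_def ngx_eq_mexp_int ngz_def
      mexp_int_inv_left[OF skew OmegaD[OF \<theta>]])

lemma ac_derivative_mexp_int_inv_mult:
  assumes \<sigma>: "ac_derivative a b \<sigma> u" "\<sigma> ` {a..b} \<subseteq> {c..1}" "0 < c" and x: "ac_derivative a b x v"
  shows "ac_derivative a b (\<lambda>s. mexp_int_inv (Ut U \<theta>) (\<sigma> s) *v x s)
    (\<lambda>s. mexp_int_inv (Ut U \<theta>) (\<sigma> s) *v (v s - u s *\<^sub>R geodesic_velocity (Ut U \<theta>) (\<sigma> s) (x s)))"
proof -
  let ?N = "mexp_int_inv (Ut U \<theta>)"
  let ?N' = "\<lambda>s. - (?N s ** mexp ((2 * s) *\<^sub>R Ut U \<theta>) ** ?N s)"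
  have N: "ac_derivative a b (\<lambda>s. ?N (\<sigma> s)) (\<lambda>s. u s *\<^sub>R ?N' (\<sigma> s))"
  proof (rule ac_derivative_compose[OF \<sigma>(1,2)])
    show "(?N has_vector_derivative ?N' r) (at r within {c..1})" if "r \<in> {c..1}" for r
      using that \<open>0 < c\<close> by (intro mexp_int_inv_has_vector_derivative[OF skew OmegaD[OF \<theta>]]) auto
    show "continuous_on {c..1} ?N'"
      using \<open>0 < c\<close> by (intro continuous_intros continuous_on_mexp_int_inv[OF skew OmegaD[OF \<theta>]])
        auto
  qed
  have "?N (\<sigma> s) *v v s + (u s *\<^sub>R ?N' (\<sigma> s)) *v x s
      = ?N (\<sigma> s) *v (v s - u s *\<^sub>R geodesic_velocity (Ut U \<theta>) (\<sigma> s) (x s))" for s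
    by (simp add: geodesic_velocity_def matrix_vector_mult_diff_distrib matrix_vector_mult_scaleR
        matrix_vector_mul_assoc matrix_mul_assoc scaleR_matrix_vector_assoc[symmetric]
        bounded_bilinear.minus_left[OF bounded_bilinear_matrix_vector_mult])
  with ac_derivative_bounded_bilinear[OF bounded_bilinear_matrix_vector_mult N x] show ?thesis
    by simp
qed

lemma calibration_has_integral:
  assumes \<gamma>: "horizontal_on a b U \<gamma> v" and "a \<le> b"
    and \<sigma>: "ac_derivative a b \<sigma> u" "\<sigma> ` {a..b} \<subseteq> {c..1}" "0 < c"
  shows "((\<lambda>s. 2 * (geodesic_velocity (Ut U \<theta>) (\<sigma> s) (fst (\<gamma> s)) \<bullet> v s)
      - u s * (norm (geodesic_velocity (Ut U \<theta>) (\<sigma> s) (fst (\<gamma> s))))\<^sup>2)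
    has_integral calibration U \<theta> (\<sigma> b) (\<gamma> b) - calibration U \<theta> (\<sigma> a) (\<gamma> a)) {a..b}"
proof -
  let ?A = "Ut U \<theta>"
  let ?N = "\<lambda>s. mexp_int_inv ?A (\<sigma> s)" and ?y = "\<lambda>s. geodesic_velocity ?A (\<sigma> s) (fst (\<gamma> s))"
  have x: "ac_derivative a b (\<lambda>s. fst (\<gamma> s)) v"
    and t: "ac_derivative a b (\<lambda>s. snd (\<gamma> s)) (\<lambda>s. (1/2) *\<^sub>R bracket U (fst (\<gamma> s)) (v s))"
    using \<gamma> by (auto simp: horizontal_on_def)
  have deriv: "((?N s *v fst (\<gamma> s)) \<bullet> v s + (?N s *v (v s - u s *\<^sub>R ?y s)) \<bullet> fst (\<gamma> s))
      + 4 * (((1/2) *\<^sub>R bracket U (fst (\<gamma> s)) (v s)) \<bullet> \<theta>)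
      = 2 * (?y s \<bullet> v s) - u s * (norm (?y s))\<^sup>2" if "s \<in> {a..b}" for s
  proof -
    have s: "0 < \<sigma> s" "\<sigma> s \<le> 1" using subsetD[OF \<sigma>(2) imageI[OF that]] \<sigma>(3) by auto
    have "?N s *v fst (\<gamma> s) = ?y s - 2 *\<^sub>R (?A *v fst (\<gamma> s))"
      by (simp add: geodesic_velocity_eq[OF skew OmegaD[OF \<theta>] s])
    moreover have "(?N s *v (v s - u s *\<^sub>R ?y s)) \<bullet> fst (\<gamma> s) = v s \<bullet> ?y s - u s * (norm (?y s))\<^sup>2"
      by (simp add: mexp_int_inv_adjoint[OF skew OmegaD[OF \<theta>] s] inner_diff_left
          power2_norm_eq_inner)
    ultimately show ?thesis
      by (simp add: inner_diff_left bracket_inner) (simp add: inner_commute)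
  qed
  have "ac_derivative a b (\<lambda>s. calibration U \<theta> (\<sigma> s) (\<gamma> s))
      (\<lambda>s. ((?N s *v fst (\<gamma> s)) \<bullet> v s + (?N s *v (v s - u s *\<^sub>R ?y s)) \<bullet> fst (\<gamma> s))
        + 4 * (((1/2) *\<^sub>R bracket U (fst (\<gamma> s)) (v s)) \<bullet> \<theta>))"
    unfolding calibration_def
    by (intro ac_derivative_add ac_derivative_bounded_bilinear[OF bounded_bilinear_inner] x
        ac_derivative_mexp_int_inv_mult[OF \<sigma> x]
        ac_derivative_bounded_linear[OF bounded_linear_const_mult[OF bounded_linear_inner_left] t])
  from ac_derivative_has_integral[OF this \<open>a \<le> b\<close>] show ?thesis
    by (rule has_integral_cong[THEN iffD1, rotated]) (rule deriv)
qed

lemma calibration_defect_has_integral: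
  assumes \<gamma>: "horizontal_on a b U \<gamma> v" and "a \<le> b"
    and length: "((\<lambda>s. norm (v s)) has_integral L) {a..b}"
    and \<sigma>: "ac_derivative a b \<sigma> (\<lambda>s. norm (v s) / w)" "\<sigma> ` {a..b} \<subseteq> {c..1}" "0 < c" and w: "w > 0"
  shows "((\<lambda>s. norm (v s) / w *
      (norm (geodesic_velocity (Ut U \<theta>) (\<sigma> s) (fst (\<gamma> s)) - (w / norm (v s)) *\<^sub>R v s))\<^sup>2)
    has_integral w * L - (calibration U \<theta> (\<sigma> b) (\<gamma> b) - calibration U \<theta> (\<sigma> a) (\<gamma> a))) {a..b}"
  unfolding norm_minus_scaled_direction[OF w, symmetric]
  by (intro has_integral_diff has_integral_mult_right length
      calibration_has_integral[OF \<gamma> \<open>a \<le> b\<close> \<sigma>])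

lemma calibration_le_arc_length:
  assumes \<gamma>: "horizontal_on 0 a U \<gamma> v" "\<gamma> 0 = origin" and a: "0 \<le> a" and T: "0 < T" "T \<le> 1"
  shows "T * calibration U \<theta> T (\<gamma> a) \<le> (arc_length v a)\<^sup>2"
proof -
  define L where "L = arc_length v a"
  note length = ac_derivative_arc_length[OF \<gamma>(1) a] and mono = arc_length_mono[OF \<gamma>(1) a]
  have L: "L \<ge> 0" using mono[of 0 a] a by (simp add: L_def)
  \<comment> \<open>The clock \<open>\<sigma>\<close> starts at a positive time, since the calibration is singular at time \<open>0\<close>.\<close>
  have bound: "T * calibration U \<theta> T (\<gamma> a) \<le> (L + \<epsilon>) * L" if \<epsilon>: "\<epsilon> > 0" for \<epsilon>
  proof -
    define w where "w = (L + \<epsilon>) / T"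
    define \<sigma> where "\<sigma> s = arc_length v s / w + \<epsilon> / w" for s
    have w: "w > 0" using L \<epsilon> T by (simp add: w_def)
    have "ac_derivative 0 a (\<lambda>s. \<epsilon> / w) (\<lambda>_. 0)" by (rule ac_derivative_of_C1) auto
    from ac_derivative_add[OF ac_derivative_bounded_linear[OF bounded_linear_divide length] this]
    have \<sigma>: "ac_derivative 0 a \<sigma> (\<lambda>s. norm (v s) / w)" by (simp add: \<sigma>_def[abs_def])
    have ends: "\<sigma> 0 = \<epsilon> / w" "\<sigma> a = T"
      using L \<epsilon> T by (auto simp: \<sigma>_def L_def[symmetric] add_divide_distrib[symmetric])
        (simp add: w_def)
    have "\<epsilon> / w \<le> \<sigma> s \<and> \<sigma> s \<le> \<sigma> a" if "s \<in> {0..a}" for s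
      using that w mono[of 0 s] mono[of s a] by (auto simp: \<sigma>_def divide_right_mono)
    then have range: "\<sigma> ` {0..a} \<subseteq> {\<epsilon> / w..1}" using ends(2) T by force
    have "((\<lambda>s. norm (v s)) has_integral L) {0..a}"
      using ac_derivative_has_integral[OF length a] by (simp add: L_def)
    from has_integral_nonneg[OF calibration_defect_has_integral[OF \<gamma>(1) a this \<sigma> range
      divide_pos_pos[OF \<epsilon> w] w]]
    have "calibration U \<theta> T (\<gamma> a) \<le> w * L" using w by (simp add: ends \<gamma>(2))
    then show ?thesis using T by (simp add: w_def field_simps)
  qed
  have "T * calibration U \<theta> T (\<gamma> a) \<le> L\<^sup>2"
  proof (rule field_le_epsilon)
    fix e :: real assume "e > 0"
    then have "T * calibration U \<theta> T (\<gamma> a) \<le> (L + e / (L + 1)) * L" using L by (intro bound) simp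
    also have "\<dots> = L\<^sup>2 + e * (L / (L + 1))" using L by (simp add: field_simps power2_eq_square)
    also have "\<dots> \<le> L\<^sup>2 + e * 1" using L \<open>e > 0\<close> by (intro add_left_mono mult_left_mono) auto
    finally show "T * calibration U \<theta> T (\<gamma> a) \<le> L\<^sup>2 + e" by simp
  qed
  then show ?thesis by (simp add: L_def)
qed

lemma calibration_normal_geodesic: "calibration U \<theta> 1 (normal_geodesic U \<zeta> \<theta> 1) = (norm \<zeta>)\<^sup>2"
proof -
  let ?X = "ngx U \<zeta> \<theta>" and ?Z = "ngz U \<zeta> \<theta>"
  have integrable: "(\<lambda>r. bracket U (?X r) (?Z r)) integrable_on {0..1}"
    by (intro integrable_continuous_interval continuous_intros)
  have Z: "(?Z has_integral ?X 1) {0..1}"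
    unfolding ngx_def by (intro integrable_integral integrable_continuous_interval
        continuous_intros)
  have "2 * (bracket U (?X r) (?Z r) \<bullet> \<theta>) = (norm \<zeta>)\<^sup>2 - \<zeta> \<bullet> ?Z r" if "r \<in> {0..1}" for r
  proof -
    have "2 * (bracket U (?X r) (?Z r) \<bullet> \<theta>) = (?Z r - \<zeta>) \<bullet> ?Z r"
      using ngz_eq[of r U \<zeta> \<theta>] that by (simp add: bracket_inner)
    then show ?thesis by (simp add: inner_diff_left dot_square_norm norm_ngz[OF skew])
  qed
  then have "((\<lambda>r. 2 * (bracket U (?X r) (?Z r) \<bullet> \<theta>)) has_integral (norm \<zeta>)\<^sup>2 - \<zeta> \<bullet> ?X 1) {0..1}"
    using has_integral_diff[OF has_integral_const_real[of "(norm \<zeta>)\<^sup>2" 0 1]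
        has_integral_linear[OF Z bounded_linear_inner_right[of \<zeta>]]]
    by (subst has_integral_cong) (auto simp: o_def)
  moreover have "((\<lambda>r. 2 * (bracket U (?X r) (?Z r) \<bullet> \<theta>)) has_integral
      2 * (integral {0..1} (\<lambda>r. bracket U (?X r) (?Z r)) \<bullet> \<theta>)) {0..1}"
    using has_integral_linear[OF integrable_integral[OF integrable] bounded_linear_inner_left[of \<theta>]]
    by (intro has_integral_mult_right) (simp add: o_def)
  ultimately have "2 * (integral {0..1} (\<lambda>r. bracket U (?X r) (?Z r)) \<bullet> \<theta>) = (norm \<zeta>)\<^sup>2 - \<zeta> \<bullet> ?X 1"
    by (rule has_integral_unique[symmetric])
  then show ?thesis
    by (simp add: calibration_def normal_geodesic_def ngx_eq_mexp_int
        mexp_int_inv_left[OF skew OmegaD[OF \<theta>]])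
qed

end

subsection \<open>Normal geodesics are the unique shortest curves\<close>

definition normalized_arc_length :: "(real \<Rightarrow> real^'q) \<Rightarrow> real \<Rightarrow> real" where
  "normalized_arc_length v s = arc_length v s / curve_length v"

lemma normalized_arc_length_0 [simp]: "normalized_arc_length v 0 = 0"
  by (simp add: normalized_arc_length_def)

lemma normalized_arc_length_1: "curve_length v > 0 \<Longrightarrow> normalized_arc_length v 1 = 1"
  by (simp add: normalized_arc_length_def arc_length_1)

context
  fixes U :: "'m::finite \<Rightarrow> real^'q::finite^'q" and \<gamma> v
  assumes \<gamma>: "horizontal_on 0 1 U \<gamma> v" and pos: "curve_length v > 0"
begin

lemma ac_derivative_normalized_arc_length:
  "0 \<le> a \<Longrightarrow> ac_derivative a 1 (normalized_arc_length v) (\<lambda>s. norm (v s) / curve_length v)"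
  unfolding normalized_arc_length_def[abs_def]
  by (intro ac_derivative_bounded_linear[OF bounded_linear_divide]
      ac_derivative_subinterval[OF ac_derivative_arc_length[OF \<gamma>]]) auto

lemma mono_on_normalized_arc_length: "mono_on {0..1} (normalized_arc_length v)"
  unfolding normalized_arc_length_def
  using arc_length_mono[OF \<gamma>] pos by (intro mono_onI divide_right_mono) auto

lemma normalized_arc_length_range:
  assumes "0 \<le> a"
  shows "normalized_arc_length v ` {a..1} \<subseteq> {normalized_arc_length v a..1}"
proof clarify
  fix s assume "s \<in> {a..1}"
  then show "normalized_arc_length v s \<in> {normalized_arc_length v a..1}"
    using mono_onD[OF mono_on_normalized_arc_length, of a s]
      mono_onD[OF mono_on_normalized_arc_length, of s 1] assms
    by (simp add: normalized_arc_length_1[OF pos])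
qed

lemma continuous_on_normalized_arc_length: "continuous_on {0..1} (normalized_arc_length v)"
  using ac_derivative_normalized_arc_length[of 0]
  by (simp add: ac_derivative_def abs_cont_on_imp_continuous_on)

lemma normalized_arc_length_image: "normalized_arc_length v ` {0..1} = {0..1}"
proof
  show "normalized_arc_length v ` {0..1} \<subseteq> {0..1}"
    using normalized_arc_length_range[of 0] by auto
  show "{0..1} \<subseteq> normalized_arc_length v ` {0..1}"
  proof
    fix y :: real assume "y \<in> {0..1}"
    then show "y \<in> normalized_arc_length v ` {0..1}"
      using IVT'[of "normalized_arc_length v" 0 y 1] continuous_on_normalized_arc_length
      by (auto simp: normalized_arc_length_1[OF pos])
  qed
qed

end

context
  fixes U :: "'m::finite \<Rightarrow> real^'q::finite^'q" and \<theta> :: "real^'m" and \<gamma> v \<zeta>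
  assumes skew: "skew (Ut U \<theta>)" and \<theta>: "\<theta> \<in> Omega U"
    and horizontal: "horizontal U \<gamma> v" and start: "\<gamma> 0 = origin"
      and stop: "\<gamma> 1 = normal_geodesic U \<zeta> \<theta> 1"
begin

lemma horizontal_on_01: "horizontal_on 0 1 U \<gamma> v"
  using horizontal by (simp add: horizontal_iff_horizontal_on)

lemma norm_le_curve_length: "norm \<zeta> \<le> curve_length v"
proof -
  have "(norm \<zeta>)\<^sup>2 \<le> (curve_length v)\<^sup>2"
    using calibration_le_arc_length[OF skew \<theta> horizontal_on_01 start, of 1]
    by (simp add: stop calibration_normal_geodesic[OF skew \<theta>] arc_length_1)
  moreover have "0 \<le> curve_length v"
    using arc_length_mono[OF horizontal_on_01, of 0 1] by (simp add: arc_length_1)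
  ultimately show ?thesis by (rule power2_le_imp_le)
qed

context
  assumes length: "curve_length v = norm \<zeta>" and nonzero: "\<zeta> \<noteq> 0"
begin

lemma curve_length_pos: "curve_length v > 0"
  using length nonzero by simp

lemma normalized_arc_length_cases:
  assumes s: "s \<in> {0..1}"
  obtains "\<gamma> s = origin" "normalized_arc_length v s = 0"
  | "0 < normalized_arc_length v s" "normalized_arc_length v s \<le> 1"
proof (cases "normalized_arc_length v s = 0")
  case True
  then have "arc_length v s = 0" using curve_length_pos by (simp add: normalized_arc_length_def)
  then have "\<gamma> s = origin"
    using s by (intro eq_origin_if_arc_length_0[OF horizontal_on_subinterval[OF horizontal_on_01] _
        start]) auto
  then show thesis using True by (rule that(1))
next
  case False
  have "normalized_arc_length v s \<in> {normalized_arc_length v 0..1}"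
    by (rule subsetD[OF normalized_arc_length_range[OF horizontal_on_01 curve_length_pos order_refl]
        imageI[OF s]])
  then show thesis using False by (intro that(2)) simp_all
qed

lemma velocity_eq_geodesic_velocity_ae:
  assumes a: "a \<in> {0..1}" "0 < normalized_arc_length v a"
  obtains N where "negligible N" "\<And>s. s \<in> {a..1} - N \<Longrightarrow>
    v s = (norm (v s) / norm \<zeta>) *\<^sub>R geodesic_velocity (Ut U \<theta>) (normalized_arc_length v s)
    (fst (\<gamma> s))"
proof -
  let ?L = "norm \<zeta>" and ?\<sigma> = "normalized_arc_length v"
  let ?y = "\<lambda>s. geodesic_velocity (Ut U \<theta>) (?\<sigma> s) (fst (\<gamma> s))"
  define defect where "defect s = norm (v s) / ?L * (norm (?y s - (?L / norm (v s)) *\<^sub>R v s))\<^sup>2" for s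
  have L: "?L > 0" and "a \<le> 1" using nonzero a(1) by simp_all
  have \<gamma>: "horizontal_on a 1 U \<gamma> v" "horizontal_on 0 a U \<gamma> v"
    using horizontal_on_subinterval[OF horizontal_on_01] a(1) by auto
  have \<sigma>: "ac_derivative a 1 ?\<sigma> (\<lambda>s. norm (v s) / ?L)"
    using ac_derivative_normalized_arc_length[OF horizontal_on_01 curve_length_pos, of a] a(1)
    by (simp add: length)
  have range: "?\<sigma> ` {a..1} \<subseteq> {?\<sigma> a..1}"
    using normalized_arc_length_range[OF horizontal_on_01 curve_length_pos] a(1) by simp
  have "((\<lambda>s. norm (v s)) has_integral arc_length v 1 - arc_length v a) {a..1}"
    using ac_derivative_subinterval[OF ac_derivative_arc_length[OF horizontal_on_01]] a(1)
    by (intro ac_derivative_has_integral) auto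
  from calibration_defect_has_integral[OF skew \<theta> \<gamma>(1) \<open>a \<le> 1\<close> this \<sigma> range a(2) L]
  have integral: "(defect has_integral ?L * (arc_length v 1 - arc_length v a)
      - (calibration U \<theta> (?\<sigma> 1) (\<gamma> 1) - calibration U \<theta> (?\<sigma> a) (\<gamma> a)))
      {a..1}" (is "(_ has_integral ?D) _")
    unfolding defect_def[abs_def] .
  have nonneg: "defect s \<ge> 0" for s by (simp add: defect_def)
  have "?\<sigma> a * calibration U \<theta> (?\<sigma> a) (\<gamma> a) \<le> ?\<sigma> a * (?L * arc_length v a)"
    using calibration_le_arc_length[OF skew \<theta> \<gamma>(2) start _ a(2)] subsetD[OF range imageI, of a] a(1)
      nonzero
    by (simp add: normalized_arc_length_def length power2_eq_square)
  then have "?D \<le> 0"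
    using calibration_normal_geodesic[OF skew \<theta>, of \<zeta>] a(2)
    by (simp add: normalized_arc_length_1[OF curve_length_pos] stop arc_length_1 length
        power2_eq_square algebra_simps)
  with has_integral_nonneg[OF integral] nonneg have "(defect has_integral 0) {a..1}"
    using integral by (metis order_antisym)
  then have "negligible {s\<in>{a..1}. defect s \<noteq> 0}"
    using nonneg by (rule has_integral_0_nonneg_imp_negligible)
  moreover have "v s = (norm (v s) / ?L) *\<^sub>R ?y s" if "s \<in> {a..1} - {s\<in>{a..1}. defect s \<noteq> 0}" for s
    using that nonzero by (cases "v s = 0") (auto simp: defect_def)
  ultimately show thesis by (rule that)
qed

lemma fst_eq_ngx:
  assumes s: "s \<in> {0..1}"
  shows "fst (\<gamma> s) = ngx U \<zeta> \<theta> (normalized_arc_length v s)"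
proof (cases rule: normalized_arc_length_cases[OF s])
  case 1
  then show ?thesis by (simp add: origin_def)
next
  case pos: 2
  let ?N = "mexp_int_inv (Ut U \<theta>)" and ?\<sigma> = "normalized_arc_length v"
  obtain N where N: "negligible N" "\<And>r. r \<in> {s..1} - N \<Longrightarrow>
      v r = (norm (v r) / norm \<zeta>) *\<^sub>R geodesic_velocity (Ut U \<theta>) (?\<sigma> r) (fst (\<gamma> r))"
    using velocity_eq_geodesic_velocity_ae[OF s pos(1)] by blast
  have "ac_derivative s 1 ?\<sigma> (\<lambda>r. norm (v r) / norm \<zeta>)" "?\<sigma> ` {s..1} \<subseteq> {?\<sigma> s..1}"
    using ac_derivative_normalized_arc_length[OF horizontal_on_01 curve_length_pos, of s]
      normalized_arc_length_range[OF horizontal_on_01 curve_length_pos, of s] s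
      by (simp_all add: length)
  moreover have "ac_derivative s 1 (\<lambda>r. fst (\<gamma> r)) v"
    using horizontal_on_subinterval[OF horizontal_on_01] s by (simp add: horizontal_on_def)
  ultimately have "ac_derivative s 1 (\<lambda>r. ?N (?\<sigma> r) *v fst (\<gamma> r)) (\<lambda>r. ?N (?\<sigma> r) *v
      (v r - (norm (v r) / norm \<zeta>) *\<^sub>R geodesic_velocity (Ut U \<theta>) (?\<sigma> r) (fst (\<gamma> r))))"
    by (intro ac_derivative_mexp_int_inv_mult[OF skew \<theta> _ _ pos(1)])
  then have "ac_derivative s 1 (\<lambda>r. ?N (?\<sigma> r) *v fst (\<gamma> r)) (\<lambda>_. 0)"
    by (rule ac_derivative_spike[OF _ N(1)]) (simp flip: N(2))
  moreover have "ac_derivative s 1 (\<lambda>_. \<zeta>) (\<lambda>_. 0)" by (rule ac_derivative_of_C1) auto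
  moreover have "?N (?\<sigma> 1) *v fst (\<gamma> 1) = \<zeta>"
    by (simp add: normalized_arc_length_1[OF curve_length_pos] stop normal_geodesic_def
        ngx_eq_mexp_int mexp_int_inv_left[OF skew OmegaD[OF \<theta>]])
  ultimately have "?N (?\<sigma> s) *v fst (\<gamma> s) = \<zeta>"
    by (rule ac_derivative_unique[where c = 1]) (use s in auto)
  then show ?thesis
    using mexp_int_inv_right[OF skew OmegaD[OF \<theta>] pos, of "fst (\<gamma> s)"]
    by (simp add: ngx_eq_mexp_int)
qed

lemma velocity_eq_ngz_ae:
  assumes s: "s \<in> {0..1}" "0 < normalized_arc_length v s"
  obtains N where "negligible N"
    "\<And>r. r \<in> {s..1} - N \<Longrightarrow> v r = (norm (v r) / norm \<zeta>) *\<^sub>R ngz U \<zeta> \<theta> (normalized_arc_length v r)"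
proof -
  let ?\<sigma> = "normalized_arc_length v"
  obtain N where N: "negligible N" "\<And>r. r \<in> {s..1} - N \<Longrightarrow>
      v r = (norm (v r) / norm \<zeta>) *\<^sub>R geodesic_velocity (Ut U \<theta>) (?\<sigma> r) (fst (\<gamma> r))"
    using velocity_eq_geodesic_velocity_ae[OF s] by blast
  have "geodesic_velocity (Ut U \<theta>) (?\<sigma> r) (fst (\<gamma> r)) = ngz U \<zeta> \<theta> (?\<sigma> r)" if r: "r \<in> {s..1}" for r
  proof -
    have "?\<sigma> r \<in> {?\<sigma> s..1}"
      using subsetD[OF normalized_arc_length_range[OF horizontal_on_01 curve_length_pos]
          imageI[OF r]] s(1) by simp
    then show ?thesis
      using fst_eq_ngx[of r] geodesic_velocity_ngx[OF skew \<theta>, of "?\<sigma> r" \<zeta>] r s by simp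
  qed
  then show thesis using N by (intro that[of N]) (metis DiffD1)+
qed

lemma snd_eq_normal_geodesic:
  assumes s: "s \<in> {0..1}"
  shows "snd (\<gamma> s) = snd (normal_geodesic U \<zeta> \<theta> (normalized_arc_length v s))"
proof (cases rule: normalized_arc_length_cases[OF s])
  case 1
  then show ?thesis by (simp add: normal_geodesic_0)
next
  case pos: 2
  let ?\<sigma> = "normalized_arc_length v"
  obtain N where N: "negligible N"
    "\<And>r. r \<in> {s..1} - N \<Longrightarrow> v r = (norm (v r) / norm \<zeta>) *\<^sub>R ngz U \<zeta> \<theta> (?\<sigma> r)"
    using velocity_eq_ngz_ae[OF s pos(1)] by blast
  have \<sigma>: "ac_derivative s 1 ?\<sigma> (\<lambda>r. norm (v r) / norm \<zeta>)" "?\<sigma> ` {s..1} \<subseteq> {?\<sigma> s..1}"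
    using ac_derivative_normalized_arc_length[OF horizontal_on_01 curve_length_pos, of s]
      normalized_arc_length_range[OF horizontal_on_01 curve_length_pos, of s] s
      by (simp_all add: length)
  have "ac_derivative s 1 (\<lambda>r. snd (normal_geodesic U \<zeta> \<theta> (?\<sigma> r)))
      (\<lambda>r. (norm (v r) / norm \<zeta>) *\<^sub>R (1/2) *\<^sub>R bracket U (ngx U \<zeta> \<theta> (?\<sigma> r)) (ngz U \<zeta> \<theta> (?\<sigma> r)))"
  proof (rule ac_derivative_compose[OF \<sigma>(1), of 0 1])
    show "?\<sigma> ` {s..1} \<subseteq> {0..1}" using \<sigma>(2) pos(1) by auto
    show "continuous_on {0..1} (\<lambda>r. (1/2) *\<^sub>R bracket U (ngx U \<zeta> \<theta> r) (ngz U \<zeta> \<theta> r))"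
      by (intro continuous_intros)
  qed (rule normal_geodesic_snd_has_vector_derivative)
  then have "ac_derivative s 1 (\<lambda>r. snd (normal_geodesic U \<zeta> \<theta> (?\<sigma> r)))
      (\<lambda>r. (1/2) *\<^sub>R bracket U (fst (\<gamma> r)) (v r))"
  proof (rule ac_derivative_spike[OF _ N(1)])
    fix r assume r: "r \<in> {s..1} - N"
    then show "(1/2) *\<^sub>R bracket U (fst (\<gamma> r)) (v r)
        = (norm (v r) / norm \<zeta>) *\<^sub>R (1/2) *\<^sub>R bracket U (ngx U \<zeta> \<theta> (?\<sigma> r)) (ngz U \<zeta> \<theta> (?\<sigma> r))"
      using fst_eq_ngx[of r] s
      by (subst N(2)[OF r]) (simp add: bounded_bilinear.scaleR_right[OF bounded_bilinear_bracket])
  qed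
  moreover have "ac_derivative s 1 (\<lambda>r. snd (\<gamma> r)) (\<lambda>r. (1/2) *\<^sub>R bracket U (fst (\<gamma> r)) (v r))"
    using horizontal_on_subinterval[OF horizontal_on_01, of s 1] s by (simp add: horizontal_on_def)
  moreover have "snd (normal_geodesic U \<zeta> \<theta> (?\<sigma> 1)) = snd (\<gamma> 1)"
    by (simp add: stop normalized_arc_length_1[OF curve_length_pos])
  ultimately have "snd (normal_geodesic U \<zeta> \<theta> (?\<sigma> s)) = snd (\<gamma> s)"
    by (rule ac_derivative_unique[where c = 1]) (use s in auto)
  then show ?thesis ..
qed

theorem eq_normal_geodesic_normalized_arc_length:
  "s \<in> {0..1} \<Longrightarrow> \<gamma> s = normal_geodesic U \<zeta> \<theta> (normalized_arc_length v s)"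
  using fst_eq_ngx snd_eq_normal_geodesic by (simp add: prod_eq_iff normal_geodesic_def)

end

end

lemma dist_cc_normal_geodesic:
  assumes skew: "skew (Ut U \<theta>)" and \<theta>: "\<theta> \<in> Omega U"
  shows "dist_cc U (normal_geodesic U \<zeta> \<theta> 1) = norm \<zeta>"
  unfolding dist_cc_def
proof (rule cInf_eq_minimum)
  show "norm \<zeta> \<in> {L. \<exists>\<gamma> v. horizontal U \<gamma> v \<and> \<gamma> 0 = origin
      \<and> \<gamma> 1 = normal_geodesic U \<zeta> \<theta> 1 \<and> L = curve_length v}"
    using horizontal_normal_geodesic[of U \<zeta> \<theta>] normal_geodesic_0[of U \<zeta> \<theta>]
      curve_length_ngz[OF skew, of \<zeta>] by force
qed (use norm_le_curve_length[OF skew \<theta>] in blast)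

lemma shortest_geodesic_normal_geodesic:
  assumes "skew (Ut U \<theta>)" "\<theta> \<in> Omega U"
  shows "shortest_geodesic U (normal_geodesic U \<zeta> \<theta> 1) (normal_geodesic U \<zeta> \<theta>)"
  unfolding shortest_geodesic_def dist_cc_normal_geodesic[OF assms]
  using horizontal_normal_geodesic normal_geodesic_0 curve_length_ngz[OF assms(1)] by blast

theorem shortest_geodesic_unique:
  assumes skew: "skew (Ut U \<theta>)" and \<theta>: "\<theta> \<in> Omega U" and nonzero: "\<zeta> \<noteq> 0"
    and shortest: "shortest_geodesic U (normal_geodesic U \<zeta> \<theta> 1) \<gamma>"
  shows "\<exists>h. continuous_on {0..1} h \<and> mono_on {0..1} h \<and> h ` {0..1} = {0..1}
    \<and> (\<forall>s\<in>{0..1}. \<gamma> s = normal_geodesic U \<zeta> \<theta> (h s))"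
proof -
  obtain v where v: "horizontal U \<gamma> v" "\<gamma> 0 = origin" "\<gamma> 1 = normal_geodesic U \<zeta> \<theta> 1"
    "curve_length v = norm \<zeta>"
    using shortest unfolding shortest_geodesic_def dist_cc_normal_geodesic[OF skew \<theta>] by blast
  have \<gamma>: "horizontal_on 0 1 U \<gamma> v" "curve_length v > 0"
    using v(1,4) nonzero by (simp_all add: horizontal_iff_horizontal_on)
  show ?thesis
    using continuous_on_normalized_arc_length[OF \<gamma>] mono_on_normalized_arc_length[OF \<gamma>]
      normalized_arc_length_image[OF \<gamma>]
      eq_normal_geodesic_normalized_arc_length[OF skew \<theta> v nonzero]
    by blast
qed

lemma normal_geodesic_eq_if_same_endpoint:
  assumes "skew (Ut U \<theta>)" "\<theta> \<in> Omega U" "skew (Ut U \<theta>')" "\<theta>' \<in> Omega U" and nonzero: "\<zeta> \<noteq> 0"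
    and endpoint: "normal_geodesic U \<zeta>' \<theta>' 1 = normal_geodesic U \<zeta> \<theta> 1" and s: "s \<in> {0..1}"
  shows "normal_geodesic U \<zeta>' \<theta>' s = normal_geodesic U \<zeta> \<theta> s"
proof -
  have norm: "norm \<zeta>' = norm \<zeta>"
    using dist_cc_normal_geodesic[OF assms(1,2), of \<zeta>] dist_cc_normal_geodesic[OF assms(3,4), of \<zeta>']
      endpoint by simp
  have "normal_geodesic U \<zeta>' \<theta>' s = normal_geodesic U \<zeta> \<theta> (normalized_arc_length (ngz U \<zeta>' \<theta>') s)"
    using curve_length_ngz[OF assms(3), of \<zeta>'] norm
    by (intro eq_normal_geodesic_normalized_arc_length[OF assms(1,2) horizontal_normal_geodesic
          normal_geodesic_0 endpoint _ nonzero s]) simp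
  moreover have "normalized_arc_length (ngz U \<zeta>' \<theta>') s = s"
    using s norm nonzero
    by (simp add: normalized_arc_length_def arc_length_ngz curve_length_ngz assms(3))
  ultimately show ?thesis by simp
qed

subsection \<open>Maximizers\<close>

definition initial_velocity :: "('m \<Rightarrow> real^'q^'q) \<Rightarrow> real^'m \<Rightarrow> real^'q \<Rightarrow> real^'q" where
  "initial_velocity U \<theta> x = mexp_int_inv (Ut U \<theta>) 1 *v x"

definition vertical_endpoint :: "('m \<Rightarrow> real^'q^'q) \<Rightarrow> real^'q \<Rightarrow> real^'m \<Rightarrow> real^'m" where
  "vertical_endpoint U x \<theta> = snd (normal_geodesic U (initial_velocity U \<theta> x) \<theta> 1)"

context
  fixes U :: "'m::finite \<Rightarrow> real^'q::finite^'q"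
  assumes skew: "\<And>\<tau>. skew (Ut U \<tau>)"
begin

lemma normal_geodesic_initial_velocity_1:
  assumes "\<theta> \<in> Omega U"
  shows "normal_geodesic U (initial_velocity U \<theta> x) \<theta> 1 = (x, vertical_endpoint U x \<theta>)"
  using mexp_int_inv_right[OF skew OmegaD[OF assms] zero_less_one order_refl]
  by (simp add: prod_eq_iff vertical_endpoint_def)
    (simp add: normal_geodesic_def ngx_eq_mexp_int initial_velocity_def)

lemma phi_vertical_endpoint:
  "\<theta> \<in> Omega U \<Longrightarrow> phi U (x, vertical_endpoint U x \<theta>) \<theta> = (norm (initial_velocity U \<theta> x))\<^sup>2"
  using phi_eq_calibration[OF skew] calibration_normal_geodesic[OF skew]
    normal_geodesic_initial_velocity_1 by metis

lemma vertical_endpoint_maximizes: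
  assumes "\<theta> \<in> Omega U" "\<tau> \<in> Omega U"
  shows "phi U (x, vertical_endpoint U x \<tau>) \<theta> \<le> phi U (x, vertical_endpoint U x \<tau>) \<tau>"
proof -
  let ?\<zeta> = "initial_velocity U \<tau> x"
  have "1 * calibration U \<theta> 1 (normal_geodesic U ?\<zeta> \<tau> 1) \<le> (arc_length (ngz U ?\<zeta> \<tau>) 1)\<^sup>2"
    using horizontal_normal_geodesic normal_geodesic_0
    by (intro calibration_le_arc_length[OF skew assms(1)])
      (auto simp: horizontal_iff_horizontal_on[symmetric])
  then show ?thesis
    by (simp add: phi_vertical_endpoint assms phi_eq_calibration[OF skew assms(1)]
        normal_geodesic_initial_velocity_1 arc_length_ngz[OF skew])
qed

lemma phi_diff: "\<theta> \<in> Omega U \<Longrightarrow> phi U (x, t) \<theta> - phi U (x, t') \<theta> = 4 * ((t - t') \<bullet> \<theta>)"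
  by (simp add: phi_eq_calibration[OF skew] calibration_def inner_diff_left)

lemma continuous_on_vertical_endpoint: "continuous_on (Omega U) (vertical_endpoint U x)"
proof -
  note Ut [continuous_intros] = bounded_linear.continuous_on[OF bounded_linear_Ut]
  have "continuous_on (Omega U) (\<lambda>\<theta>. mexp_int_inv (Ut U \<theta>) 1)"
    unfolding continuous_on_def mexp_int_inv_def
  proof (intro ballI tendsto_matrix_inv)
    fix \<theta> assume \<theta>: "\<theta> \<in> Omega U"
    show "invertible (mexp_int (Ut U \<theta>) 1)"
      using invertible_mexp_int[OF skew OmegaD[OF \<theta>], of 1] by simp
    have "continuous_on (Omega U) (\<lambda>\<theta>. mexp_int (Ut U \<theta>) 1)" by (intro continuous_intros) auto
    then show "((\<lambda>\<theta>. mexp_int (Ut U \<theta>) 1) \<longlongrightarrow> mexp_int (Ut U \<theta>) 1) (at \<theta> within Omega U)"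
      using \<theta> by (simp add: continuous_on_def)
  qed
  then have velocity: "continuous_on (Omega U) (\<lambda>\<theta>. initial_velocity U \<theta> x)"
    unfolding initial_velocity_def by (intro continuous_intros)
  have "continuous_on (Omega U \<times> cbox 0 1)
      (\<lambda>(\<theta>, r). bracket U (ngx U (initial_velocity U \<theta> x) \<theta> r) (ngz U (initial_velocity U \<theta> x) \<theta> r))"
    unfolding case_prod_unfold ngx_eq_mexp_int ngz_def
    by (intro continuous_intros continuous_on_compose2[OF velocity]) auto
  from integral_continuous_on_param[OF this] show ?thesis
    unfolding vertical_endpoint_def normal_geodesic_def by (auto intro!: continuous_intros)
qed

lemma Omega_eventually_add_scaleR:
  assumes \<theta>: "\<theta> \<in> Omega U"
  shows "\<forall>\<^sub>F e in at_right 0. \<theta> + e *\<^sub>R \<eta> \<in> Omega U"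
proof -
  let ?a = "onorm ((*v) (Ut U \<theta>))" and ?h = "onorm ((*v) (Ut U \<eta>))"
  have "((\<lambda>e. ?a + e * ?h) \<longlongrightarrow> ?a + 0 * ?h) (at_right 0)"
    by (intro tendsto_intros)
  then have "\<forall>\<^sub>F e in at_right 0. ?a + e * ?h < pi"
    using OmegaD[OF \<theta>] by (intro order_tendstoD) simp_all
  moreover have "\<forall>\<^sub>F e in at_right (0::real). e > 0" by (rule eventually_at_right_less)
  ultimately show ?thesis
  proof eventually_elim
    case (elim e)
    have "(*v) (Ut U (\<theta> + e *\<^sub>R \<eta>)) = (\<lambda>x. Ut U \<theta> *v x + e *\<^sub>R (Ut U \<eta> *v x))"
      by (simp add: fun_eq_iff linear_add[OF bounded_linear.linear[OF bounded_linear_Ut]]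
          linear_scale[OF bounded_linear.linear[OF bounded_linear_Ut]]
          matrix_vector_mult_add_rdistrib scaleR_matrix_vector_assoc)
    then have "onorm ((*v) (Ut U (\<theta> + e *\<^sub>R \<eta>))) \<le> ?a + onorm (\<lambda>x. e *\<^sub>R (Ut U \<eta> *v x))"
      using onorm_triangle[OF matrix_vector_mul_bounded_linear[of "Ut U \<theta>"]
          bounded_linear_const_scaleR[OF matrix_vector_mul_bounded_linear[of "Ut U \<eta>"]], of e]
          by simp
    then show ?case
      using elim by (simp add: Omega_def onorm_scaleR[OF matrix_vector_mul_bounded_linear])
  qed
qed

theorem vertical_endpoint_maximizer:
  assumes "\<theta> \<in> maximizers U (x, t)"
  shows "vertical_endpoint U x \<theta> = t"
proof -
  let ?p = "vertical_endpoint U x"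
  have \<theta>: "\<theta> \<in> Omega U" and max: "\<And>\<tau>. \<tau> \<in> Omega U \<Longrightarrow> phi U (x, t) \<tau> \<le> phi U (x, t) \<theta>"
    using assms by (auto simp: maximizers_def)
  define \<eta> where "\<eta> = t - ?p \<theta>"
  have ineq: "t \<bullet> \<eta> \<le> ?p (\<theta> + e *\<^sub>R \<eta>) \<bullet> \<eta>" if e: "e > 0" and \<tau>: "\<theta> + e *\<^sub>R \<eta> \<in> Omega U" for e
  proof -
    have "(t - ?p (\<theta> + e *\<^sub>R \<eta>)) \<bullet> (\<theta> + e *\<^sub>R \<eta>) \<le> (t - ?p (\<theta> + e *\<^sub>R \<eta>)) \<bullet> \<theta>"
      using max[OF \<tau>] vertical_endpoint_maximizes[OF \<theta> \<tau>, of x]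
        phi_diff[OF \<theta>, of x t "?p (\<theta> + e *\<^sub>R \<eta>)"] phi_diff[OF \<tau>, of x t "?p (\<theta> + e *\<^sub>R \<eta>)"]
        by linarith
    then have "e * ((t - ?p (\<theta> + e *\<^sub>R \<eta>)) \<bullet> \<eta>) \<le> 0" by (simp add: inner_add_right)
    then show ?thesis using e by (simp add: mult_le_0_iff inner_diff_left)
  qed
  have near: "\<forall>\<^sub>F e in at_right 0. \<theta> + e *\<^sub>R \<eta> \<in> Omega U" by (rule Omega_eventually_add_scaleR[OF \<theta>])
  have "((\<lambda>e. \<theta> + e *\<^sub>R \<eta>) \<longlongrightarrow> \<theta> + 0 *\<^sub>R \<eta>) (at_right 0)" by (intro tendsto_intros)
  then have "((\<lambda>e. ?p (\<theta> + e *\<^sub>R \<eta>) \<bullet> \<eta>) \<longlongrightarrow> ?p \<theta> \<bullet> \<eta>) (at_right 0)"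
    using continuous_on_tendsto_compose[OF continuous_on_vertical_endpoint _ \<theta> near]
    by (intro tendsto_inner tendsto_const) simp
  moreover have "\<forall>\<^sub>F e in at_right 0. t \<bullet> \<eta> \<le> ?p (\<theta> + e *\<^sub>R \<eta>) \<bullet> \<eta>"
    using near eventually_at_right_less[of 0] by eventually_elim (rule ineq)
  ultimately have "t \<bullet> \<eta> \<le> ?p \<theta> \<bullet> \<eta>" by (rule tendsto_lowerbound) simp
  then have "\<eta> \<bullet> \<eta> \<le> 0" by (simp add: \<eta>_def inner_diff_left)
  then have "\<eta> = 0" by (metis inner_eq_zero_iff inner_ge_zero order_antisym)
  then show ?thesis by (simp add: \<eta>_def)
qed

lemma maximizer_normal_geodesic:
  assumes "\<theta> \<in> maximizers U (x, t)"
  shows "\<theta> \<in> Omega U" "normal_geodesic U (initial_velocity U \<theta> x) \<theta> 1 = (x, t)"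
    "phi U (x, t) \<theta> = (norm (initial_velocity U \<theta> x))\<^sup>2"
proof -
  show \<theta>: "\<theta> \<in> Omega U" using assms by (simp add: maximizers_def)
  show "normal_geodesic U (initial_velocity U \<theta> x) \<theta> 1 = (x, t)"
    using normal_geodesic_initial_velocity_1[OF \<theta>, of x] vertical_endpoint_maximizer[OF assms]
    by simp
  show "phi U (x, t) \<theta> = (norm (initial_velocity U \<theta> x))\<^sup>2"
    using phi_vertical_endpoint[OF \<theta>, of x] vertical_endpoint_maximizer[OF assms] by simp
qed

lemma initial_velocity_nonzero:
  assumes "\<theta> \<in> maximizers U (x, t)" "(x, t) \<noteq> origin"
  shows "initial_velocity U \<theta> x \<noteq> 0"
proof
  assume zero: "initial_velocity U \<theta> x = 0"
  have "ngx U 0 \<theta> s = 0" "ngz U 0 \<theta> s = 0" for s by (simp_all add: ngx_eq_mexp_int ngz_def)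
  then have "normal_geodesic U 0 \<theta> 1 = origin"
    by (simp add: normal_geodesic_def origin_def
        bounded_bilinear.zero_left[OF bounded_bilinear_bracket])
  then show False using maximizer_normal_geodesic(2)[OF assms(1)] zero assms(2) by simp
qed

lemma matfun_normal_geodesic:
  assumes \<theta>: "\<theta> \<in> Omega U" and s: "s \<in> {0..1}"
  shows "cvec (fst (normal_geodesic U (initial_velocity U \<theta> x) \<theta> s))
      = matfun (sinratio s) (Uc U \<theta>) *v cvec (mexp ((s - 1) *\<^sub>R Ut U \<theta>) *v x)"
    and "cvec (ngz U (initial_velocity U \<theta> x) \<theta> s)
      = matfun zsin (Uc U \<theta>) *v cvec (mexp ((2 * s - 1) *\<^sub>R Ut U \<theta>) *v x)"
proof -
  have inv: "invertible (mexp_int (Ut U \<theta>) 1)"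
    using invertible_mexp_int[OF skew OmegaD[OF \<theta>], of 1] by simp
  show "cvec (fst (normal_geodesic U (initial_velocity U \<theta> x) \<theta> s))
      = matfun (sinratio s) (Uc U \<theta>) *v cvec (mexp ((s - 1) *\<^sub>R Ut U \<theta>) *v x)"
    using matfun_sinratio_mexp[OF skew inv, of s x] s
    by (simp add: normal_geodesic_def ngx_eq_mexp_int initial_velocity_def)
  show "cvec (ngz U (initial_velocity U \<theta> x) \<theta> s)
      = matfun zsin (Uc U \<theta>) *v cvec (mexp ((2 * s - 1) *\<^sub>R Ut U \<theta>) *v x)"
    by (simp add: matfun_zsin_mexp[OF skew inv] ngz_def initial_velocity_def)
qed

lemma abnormal_maximizer_geodesic:
  assumes g: "(x, t) \<in> Mt2 U" "(x, t) \<noteq> origin" and \<theta>: "\<theta> \<in> maximizers U (x, t)"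
  shows "abnormal U (normal_geodesic U (initial_velocity U \<theta> x) \<theta>)"
proof -
  let ?\<gamma> = "\<lambda>\<theta>. normal_geodesic U (initial_velocity U \<theta> x) \<theta>"
  obtain \<theta>1 \<theta>2 where max: "\<theta>1 \<in> maximizers U (x, t)" "\<theta>2 \<in> maximizers U (x, t)" and ne: "\<theta>1 \<noteq> \<theta>2"
    using g(1) by (auto simp: Mt2_def)
  have "?\<gamma> \<theta> s = ?\<gamma> \<tau> s" if \<tau>: "\<tau> \<in> maximizers U (x, t)" and s: "s \<in> {0..1}" for \<tau> s
    by (rule normal_geodesic_eq_if_same_endpoint[OF skew maximizer_normal_geodesic(1)[OF \<tau>] skew
          maximizer_normal_geodesic(1)[OF \<theta>] initial_velocity_nonzero[OF \<tau> g(2)] _ s])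
      (simp add: maximizer_normal_geodesic(2)[OF \<tau>] maximizer_normal_geodesic(2)[OF \<theta>])
  moreover have "normal_lift U (initial_velocity U \<theta>1 x) \<theta>1 0
      \<noteq> normal_lift U (initial_velocity U \<theta>2 x) \<theta>2 0"
    using ne by (simp add: normal_lift_def)
  ultimately show ?thesis
    using max unfolding abnormal_def by (metis atLeastAtMost_iff order_refl zero_le_one)
qed

end

theorem theorem2p7:
  fixes U :: "'m::finite \<Rightarrow> real^'q::finite^'q"
    and x0 :: "real^'q" and t0 :: "real^'m" and \<theta>0 :: "real^'m"
  assumes skewU: "\<And>j. skew (U j)"
    and injU: "inj U" and indepU: "independent (range U)"
    and g0M: "(x0, t0) \<in> Mt U" and g0ne: "(x0, t0) \<noteq> origin"
    and \<theta>0max: "\<theta>0 \<in> maximizers U (x0, t0)"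
  shows "(dist_cc U (x0, t0))\<^sup>2 = phi U (x0, t0) \<theta>0
    \<and> (\<exists>\<gamma>0 \<zeta>.
         (\<forall>s\<in>{0..1}.
            cvec (fst (\<gamma>0 s)) = matfun (sinratio s) (Uc U \<theta>0)
                                   *v cvec (mexp ((s - 1) *\<^sub>R Ut U \<theta>0) *v x0)
          \<and> cvec (\<zeta> s) = matfun zsin (Uc U \<theta>0)
                                   *v cvec (mexp ((2 * s - 1) *\<^sub>R Ut U \<theta>0) *v x0)
          \<and> snd (\<gamma>0 s) = (1/2) *\<^sub>R integral {0..s} (\<lambda>r. bracket U (fst (\<gamma>0 r)) (\<zeta> r)))
       \<and> shortest_geodesic U (x0, t0) \<gamma>0
       \<and> (\<forall>\<gamma>. shortest_geodesic U (x0, t0) \<gamma> \<longrightarrow>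
            (\<exists>h. continuous_on {0..1} h \<and> mono_on {0..1} h \<and> h ` {0..1} = {0..1}
                 \<and> (\<forall>s\<in>{0..1}. \<gamma> s = \<gamma>0 (h s))))
       \<and> ((x0, t0) \<in> Mt2 U \<longrightarrow> abnormal U \<gamma>0))"
proof -
  let ?\<zeta> = "initial_velocity U \<theta>0 x0"
  let ?\<gamma> = "normal_geodesic U ?\<zeta> \<theta>0"
  have skew: "skew (Ut U \<tau>)" for \<tau> by (rule skew_Ut[OF skewU])
  note \<theta>0 = maximizer_normal_geodesic(1)[OF skew \<theta>0max]
    and endpoint = maximizer_normal_geodesic(2)[OF skew \<theta>0max]
  have "dist_cc U (x0, t0) = norm ?\<zeta>"
    using dist_cc_normal_geodesic[OF skew \<theta>0, of ?\<zeta>] by (simp add: endpoint)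
  then have "(dist_cc U (x0, t0))\<^sup>2 = phi U (x0, t0) \<theta>0"
    by (simp add: maximizer_normal_geodesic(3)[OF skew \<theta>0max])
  moreover have "snd (?\<gamma> s) = (1/2) *\<^sub>R integral {0..s} (\<lambda>r. bracket U (fst (?\<gamma> r)) (ngz U ?\<zeta> \<theta>0 r))"
    for s
    by (simp add: normal_geodesic_def)
  moreover have "shortest_geodesic U (x0, t0) ?\<gamma>"
    using shortest_geodesic_normal_geodesic[OF skew \<theta>0, of ?\<zeta>] by (simp add: endpoint)
  moreover note shortest_geodesic_unique[OF skew \<theta>0 initial_velocity_nonzero[OF skew \<theta>0max g0ne],
    unfolded endpoint]
    and abnormal_maximizer_geodesic[OF skew _ g0ne \<theta>0max] and matfun_normal_geodesic[OF skew \<theta>0]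
  ultimately show ?thesis by blast
qed

end
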